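(* Let $\alpha>0$, $\varphi(z)=\alpha(\log^+|z|)^2$, and $\lambda_n=e^{\frac{1+n}{2\alpha}}$ for $n\ge 0$. Let $\Gamma=\{\gamma_n : n\ge 0\}\subset\mathbb{C}$ be a sequence of pairwise distinct points with $|\gamma_n|\le|\gamma_{n+1}|$ for all $n\geq 0$, and write $\gamma_n=\lambda_n e^{\delta_n}e^{i\theta_n}$ with $\delta_n,\theta_n\in\mathbb{R}$. Consider the following three conditions together: (a) $\Gamma$ is $d_\rho$-separated; (b) $(\delta_n)_{n\ge0}$ is a bounded real sequence; (c) there exists an integer $N\ge1$ such that $$-\frac{1}{4\alpha}<\nabla_N\le\Delta_N<\frac{1}{4\alpha}.$$ Then $\left(e^{-\frac{1}{4\alpha}}\Gamma\right)\setminus\{*\}$ is a complete interpolating set for $\mathcal{F}^{4/3}_\varphi$ if and only if (a), (b) and (c) hold; and $e^{-\frac{1}{4\alpha}}\Gamma$ is a complete interpolating set for $\mathcal{F}^{4}_\varphi$ if and only if (a), (b) and (c) hold. Here $e^{-\frac{1}{4\alpha}}\Gamma=\{e^{-\frac1{4\alpha}}\gamma_n: n\ge0\}$, and for a sequence $S$, $S\setminus\{*\}$ is the sequence obtained by removing any one point from $S$ (the equivalence holds whichever point is removed).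
   Context: For $1\le p<\infty$, $\mathcal{F}^p_\varphi$ is the Banach space of entire functions $f$ with $\|f\|_{p,\varphi}^p:=\int_{\mathbb{C}}|f(z)e^{-\varphi(z)}|^p\,dm(z)<\infty$, where $dm$ is area Lebesgue measure on $\mathbb{C}$, and $\log^+ x=\max(\log x,0)$. For a countable set $S\subset\mathbb{C}$ and a family $v=(v_s)_{s\in S}$ of complex numbers put $\|v\|_{p,\varphi,S}^p:=\sum_{s\in S}(1+|s|)^2|v_s|^p e^{-p\varphi(s)}$; for a function $f$, $\|f\|_{p,\varphi,S}$ is this quantity with $v_s=f(s)$. - $S$ is sampling for $\mathcal{F}^p_\varphi$ if there is $C\ge1$ with $\frac1C\|f\|_{p,\varphi}^p\le\|f\|_{p,\varphi,S}^p\le C\|f\|_{p,\varphi}^p$ for all $f\in\mathcal{F}^p_\varphi$. - $S$ is interpolating for $\mathcal{F}^p_\varphi$ if for every $v=(v_s)_{s\in S}$ with $\|v\|_{p,\varphi,S}<\infty$ there is $f\in\mathcal{F}^p_\varphi$ with $f(s)=v_s$ for all $s\in S$. - $S$ is a complete interpolating sequence (or set) for $\mathcal{F}^p_\varphi$ if it is both sampling and interpolating for $\mathcal{F}^p_\varphi$. Let $\rho(z)=|z|/\sqrt{2\alpha}$ and $d_\rho(z,w)=\dfrac{|z-w|}{1+\min\{\rho(z),\rho(w)\}}$ for $z,w\in\mathbb{C}$. A set $S\subset\mathbb{C}$ is $d_\rho$-separated if $\inf\{d_\rho(s,s'): s\ne s',\ s,s'\in S\}>0$. For the real sequence $(\delta_n)_{n\geq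 0}$ and a positive integer $N$, $$\nabla_N:=\inf_{n\ge0}\frac1N\sum_{k=n+1}^{n+N}\delta_k,\qquad \Delta_N:=\sup_{n\ge0}\frac1N\sum_{k=n+1}^{n+N}\delta_k.$$ *)

theory Defs
  imports "HOL-Analysis.Analysis"
begin

text \<open>
  Norms enter only through their \<open>p\<close>-th powers, which are taken in \<^typ>\<open>ennreal\<close> so that
  divergence is the honest value \<open>\<infinity>\<close>.  Note that \<^prop>\<open>0 powr p = (0::real)\<close> for every \<open>p\<close>.
\<close>

definition fock_norm_pow :: "real \<Rightarrow> (complex \<Rightarrow> real) \<Rightarrow> (complex \<Rightarrow> complex) \<Rightarrow> ennreal"
  where "fock_norm_pow p \<phi> f =
    (\<integral>\<^sup>+ z. ennreal (cmod (f z * complex_of_real (exp (- \<phi> z))) powr p) \<partial>lborel)"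

definition fock_space :: "real \<Rightarrow> (complex \<Rightarrow> real) \<Rightarrow> (complex \<Rightarrow> complex) set"
  where "fock_space p \<phi> = {f. f holomorphic_on UNIV \<and> fock_norm_pow p \<phi> f < \<infinity>}"

text \<open>
  A family \<open>(v\<^sub>s)\<close> indexed by \<open>S\<close> is a total function of which only the values on \<open>S\<close> are used.
\<close>

definition seq_norm_pow ::
    "real \<Rightarrow> (complex \<Rightarrow> real) \<Rightarrow> complex set \<Rightarrow> (complex \<Rightarrow> complex) \<Rightarrow> ennreal"
  where "seq_norm_pow p \<phi> S v =
    (\<Sum>\<^sub>\<infinity>s\<in>S. ennreal ((1 + cmod s)\<^sup>2 * cmod (v s) powr p * exp (- (p * \<phi> s))))"

definition sampling :: "real \<Rightarrow> (complex \<Rightarrow> real) \<Rightarrow> complex set \<Rightarrow> bool"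
  where "sampling p \<phi> S \<longleftrightarrow>
    (\<exists>C::real. C \<ge> 1 \<and> (\<forall>f \<in> fock_space p \<phi>.
       ennreal (1 / C) * fock_norm_pow p \<phi> f \<le> seq_norm_pow p \<phi> S f \<and>
       seq_norm_pow p \<phi> S f \<le> ennreal C * fock_norm_pow p \<phi> f))"

definition interpolating :: "real \<Rightarrow> (complex \<Rightarrow> real) \<Rightarrow> complex set \<Rightarrow> bool"
  where "interpolating p \<phi> S \<longleftrightarrow>
    (\<forall>v. seq_norm_pow p \<phi> S v < \<infinity> \<longrightarrow> (\<exists>f \<in> fock_space p \<phi>. \<forall>s\<in>S. f s = v s))"

definition complete_interpolating :: "real \<Rightarrow> (complex \<Rightarrow> real) \<Rightarrow> complex set \<Rightarrow> bool"
  where "complete_interpolating p \<phi> S \<longleftrightarrow> sampling p \<phi> S \<and> interpolating p \<phi> S"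

text \<open>At \<open>0\<close> this yields \<open>0\<close>, as it should, because \<^prop>\<open>ln 0 = (0::real)\<close>.\<close>

definition log_plus :: "real \<Rightarrow> real"
  where "log_plus x = max (ln x) 0"

definition log_weight :: "real \<Rightarrow> complex \<Rightarrow> real"
  where "log_weight \<alpha> z = \<alpha> * (log_plus (cmod z))\<^sup>2"

definition rho :: "real \<Rightarrow> complex \<Rightarrow> real"
  where "rho \<alpha> z = cmod z / sqrt (2 * \<alpha>)"

definition d_rho :: "real \<Rightarrow> complex \<Rightarrow> complex \<Rightarrow> real"
  where "d_rho \<alpha> z w = cmod (z - w) / (1 + min (rho \<alpha> z) (rho \<alpha> w))"

text \<open>
  The infima and suprema below are taken in \<^typ>\<open>ereal\<close>, since those of \<^typ>\<open>real\<close> are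
  meaningless for empty or unbounded sets.
\<close>

definition d_rho_separated :: "real \<Rightarrow> complex set \<Rightarrow> bool"
  where "d_rho_separated \<alpha> S \<longleftrightarrow>
    0 < Inf {ereal (d_rho \<alpha> s s') | s s'. s \<in> S \<and> s' \<in> S \<and> s \<noteq> s'}"

definition nabla_mean :: "(nat \<Rightarrow> real) \<Rightarrow> nat \<Rightarrow> ereal"
  where "nabla_mean \<delta> N = (INF n. ereal (1 / real N * (\<Sum>k = n + 1..n + N. \<delta> k)))"

definition Delta_mean :: "(nat \<Rightarrow> real) \<Rightarrow> nat \<Rightarrow> ereal"
  where "Delta_mean \<delta> N = (SUP n. ereal (1 / real N * (\<Sum>k = n + 1..n + N. \<delta> k)))"

definition lambda_seq :: "real \<Rightarrow> nat \<Rightarrow> real"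
  where "lambda_seq \<alpha> n = exp ((1 + real n) / (2 * \<alpha>))"

definition separated_bounded_mean :: "real \<Rightarrow> complex set \<Rightarrow> (nat \<Rightarrow> real) \<Rightarrow> bool"
  where "separated_bounded_mean \<alpha> \<Gamma> \<delta> \<longleftrightarrow>
    d_rho_separated \<alpha> \<Gamma> \<and>
    bounded (range \<delta>) \<and>
    (\<exists>N\<ge>1. ereal (- 1 / (4 * \<alpha>)) < nabla_mean \<delta> N \<and>
       nabla_mean \<delta> N \<le> Delta_mean \<delta> N \<and>
       Delta_mean \<delta> N < ereal (1 / (4 * \<alpha>)))"

end

theory Submission
  imports Defs "HOL-Complex_Analysis.Complex_Analysis"
begin

text \<open>
  In the coordinate \<open>t = ln |z|\<close> the weight \<open>e\<^sup>-\<^sup>\<phi>\<close>, together with the area element, becomes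
  \<open>e\<^bsup>-P(t)\<^esup>\<close> with \<open>P(t) = \<alpha> t\<^sup>2 - 2 t / p\<close>.  For the points \<open>t\<^sub>n = (n + 2 / p) / (2 \<alpha>)\<close>
  one has \<open>n t - P(t) = n t\<^sub>n - P(t\<^sub>n) - \<alpha> (t - t\<^sub>n)\<^sup>2\<close>, so the norm lives on annuli around
  \<open>|z| = e\<^bsup>t\<^sub>n\<^esup>\<close>, and the characterization holds for every exponent \<open>p \<ge> 1\<close> and every
  sequence with \<open>ln |\<sigma>\<^sub>n| = t\<^sub>n + \<delta>\<^sub>n\<close>.  The exponents \<open>4\<close> and \<open>4/3\<close> give the scaled
  sequence itself and, after an index shift, the scaled sequence without one point.

  If the three conditions hold, the weighted Lagrange polynomials of the finite sections decay like
  \<open>e\<^bsup>-\<eta> |ln |z| - ln |\<sigma>\<^sub>n||\<^esup>\<close> off their node, uniformly in the section.  Summation and Montel's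
  theorem produce an interpolating function with a norm bound.  Uniqueness follows from the
  maximum principle, and turns the bound into the sampling inequality.

  Conversely, sampling and interpolation yield functions \<open>L\<^sub>n\<close> with \<open>L\<^sub>n(\<sigma>\<^sub>j) = [n = j]\<close> and
  controlled norm.  A derivative estimate for \<open>L\<^sub>n\<close> gives separation.  The maximum principle for
  \<open>L\<^sub>n\<close>, and the sampling inequality for \<open>\<Prod>j<n. (z - \<sigma>\<^sub>j)\<close>, bound \<open>\<delta>\<^sub>n\<close> from below
  and above.  The norms of the same functions, read off on well separated circles, give
  \<open>\<Sum>k<n. b\<^sub>k \<le> C b\<^sub>n\<close> (and its mirror image) for exponentials \<open>b\<^sub>n\<close> of partial sums of
  \<open>\<delta>\<close>; such sequences grow geometrically, which is the strict inequality for the means.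
\<close>

section \<open>Holomorphic functions and weighted sums\<close>

text \<open>Here 2 / p is 1/2 for p = 4 and 3/2 for p = 4/3, so the nodes t_n of the second exponent
  are those of the first moved by one index. The scaled points have logarithmic modulus (n + 1/2) /
  (2 \<alpha>) + \<delta>_n, which fits p = 4 as it stands and p = 4/3 once a point is gone. The
  number 1 / (4 \<alpha>) is half the gap h = 1 / (2 \<alpha>) between nodes. From one node circle
  to the next, the logarithm of the weighted size of the partial products changes by h / 2 minus a
  deviation; both directions turn on its average slope lying strictly between 0 and h. Two obstacles
  shape the estimates. The logarithm of the weight has unbounded slope 2 \<alpha> ln |z|;
  multiplying by (z0 / z)^N with an integer N near that slope removes it holomorphically, at bounded
  cost on discs of radius comparable to |z0|. And the products have unboundedly many factors; each
  factor is replaced by its dominant term at the price of an error in the exponent of size exp (-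
  |ln |z| - ln |\<sigma>_j||), and these errors have a bounded sum as soon as ln |\<sigma>_j| grows
  linearly.\<close>

lemma holomorphic_bounded_lipschitz:
  fixes g :: "complex \<Rightarrow> complex"
  assumes hol: "g holomorphic_on ball a s" and bd: "\<And>z. z \<in> ball a s \<Longrightarrow> cmod (g z) \<le> M"
    and s: "s > 0" and z: "z \<in> ball a (s/2)"
  shows "cmod (g z - g a) \<le> 4 * M / s * cmod (z - a)"
proof (rule field_differentiable_bound[where f' = "deriv g" and S = "ball a (s/2)"])
  fix w assume w: "w \<in> ball a (s/2)"
  have sub: "cball w (s/4) \<subseteq> ball a s"
  proof
    fix x assume "x \<in> cball w (s/4)"
    then have "dist w x \<le> s/4" by simp
    moreover have "dist a w < s/2" using w by simp
    ultimately show "x \<in> ball a s" using dist_triangle[of a x w] s by simp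
  qed
  show "(g has_field_derivative deriv g w) (at w within ball a (s/2))"
    using hol holomorphic_derivI[OF hol, of w] w s
    by (auto intro: has_field_derivative_at_within)
  have "cmod ((deriv ^^ 1) g w) \<le> fact 1 * M / (s/4)^1"
  proof (rule Cauchy_inequality)
    show "g holomorphic_on ball w (s/4)"
      using hol sub by (meson ball_subset_cball holomorphic_on_subset)
    show "continuous_on (cball w (s/4)) g"
      using hol sub by (meson holomorphic_on_imp_continuous_on holomorphic_on_subset)
    show "cmod (g x) \<le> M" if "cmod (w - x) = s/4" for x
      using sub that by (intro bd) (auto simp: dist_norm)
  qed (use s in auto)
  then show "cmod (deriv g w) \<le> 4 * M / s" by (simp add: mult.commute)
qed (use s z in auto)

lemma emeasure_ball_complex: "r \<ge> 0 \<Longrightarrow> emeasure lborel (ball (c::complex) r) = ennreal (pi * r\<^sup>2)"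
  by (simp add: emeasure_ball unit_ball_vol_2)

text \<open>The factor 4096 is 4 * 32^2: it compares the square of 2 * s with the area of a disc of
  radius s / 32. The factor \<open>2 powr p\<close> comes from the lower bound A / 2 for |g| on that
  disc.\<close>

definition submean_const :: "real \<Rightarrow> real"
  where "submean_const p = pi / (4096 * 2 powr p)"

lemma submean_const_pos [simp]: "submean_const p > 0"
  by (simp add: submean_const_def)

text \<open>
  The area is bounded below near a maximum point of \<open>|g(z)| (r - |z - z\<^sub>0|)\<^sup>2\<close>,
  which avoids the mean value formula over discs.
\<close>

lemma submean_powr:
  fixes g :: "complex \<Rightarrow> complex"
  assumes hol: "g holomorphic_on S" and sub: "cball z0 r \<subseteq> S" and r: "r > 0" and p: "p \<ge> 1"
  shows "ennreal (submean_const p * r\<^sup>2 * cmod (g z0) powr p)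
    \<le> (\<integral>\<^sup>+ z \<in> ball z0 r. ennreal (cmod (g z) powr p) \<partial>lborel)"
proof (cases "g z0 = 0")
  case True
  then show ?thesis by simp
next
  case False
  define u where "u z = cmod (g z) * (r - cmod (z - z0))\<^sup>2" for z
  have cont: "continuous_on (cball z0 r) g"
    using hol sub holomorphic_on_imp_continuous_on holomorphic_on_subset by blast
  then have "continuous_on (cball z0 r) u"
    unfolding u_def by (intro continuous_intros)
  then obtain w where w: "w \<in> cball z0 r" and max: "\<And>z. z \<in> cball z0 r \<Longrightarrow> u z \<le> u w"
    using continuous_attains_sup[of "cball z0 r" u] r by auto
  have u0: "u z0 = cmod (g z0) * r\<^sup>2" by (simp add: u_def)
  have uw: "u w > 0" using max[of z0] u0 False r
    by (smt (verit) centre_in_cball mult_pos_pos zero_less_norm_iff zero_less_power)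
  define s where "s = (r - cmod (w - z0)) / 2"
  define A where "A = cmod (g w)"
  have s0: "s > 0" using uw w unfolding u_def s_def
    by (smt (verit) dist_norm dist_commute mem_cball mult_eq_0_iff half_gt_zero power_zero_numeral)
  have A0: "A > 0" using uw unfolding u_def A_def
    by (smt (verit) mult_eq_0_iff norm_ge_zero)
  have s_le: "2 * s \<le> r" unfolding s_def by simp
  have s2: "2 * s = r - cmod (w - z0)" unfolding s_def by simp
  have near: "cmod (z - z0) \<le> r - s" if "z \<in> ball w s" for z
    using that norm_triangle_ineq[of "z - w" "w - z0"] unfolding s_def
    by (auto simp: dist_norm norm_minus_commute field_simps)
  \<comment> \<open>Within distance s of w the factor r - |z - z0| is still at least s, half of its
    value at w, so maximality of u at w costs only a factor 4.\<close>
  have bd: "cmod (g z) \<le> 4 * A" if "z \<in> ball w s" for z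
  proof -
    have "cmod (g z) * s\<^sup>2 \<le> u z"
      unfolding u_def using near[OF that] s0 by (intro mult_left_mono power_mono) auto
    also have "\<dots> \<le> u w" using near[OF that] s0 by (intro max) (auto simp: dist_norm norm_minus_commute)
    also have "\<dots> = 4 * A * s\<^sup>2" unfolding u_def A_def s_def by (simp add: power2_eq_square)
    finally show ?thesis using s0 by (simp)
  qed
  have bsub: "ball w s \<subseteq> S"
    using near sub s0 by (force simp: dist_norm norm_minus_commute)
  \<comment> \<open>The Lipschitz constant on the half-radius ball is 16 * A / s, so radius s / 32
    allows a variation of at most A / 2.\<close>
  have low: "cmod (g z) \<ge> A / 2" if "z \<in> ball w (s/32)" for z
  proof -
    have "cmod (g z - g w) \<le> 4 * (4 * A) / s * cmod (z - w)"
      using bd hol bsub s0 that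
      by (intro holomorphic_bounded_lipschitz) (auto intro: holomorphic_on_subset)
    also have "\<dots> \<le> 4 * (4 * A) / s * (s/32)"
      using that s0 A0 by (intro mult_left_mono) (auto simp: dist_norm norm_minus_commute)
    also have "\<dots> = A / 2" using s0 by simp
    finally show ?thesis unfolding A_def
      using norm_triangle_ineq2[of "g w" "g z"] by (simp add: norm_minus_commute)
  qed
  have sub2: "ball w (s/32) \<subseteq> ball z0 r"
  proof
    fix z assume "z \<in> ball w (s/32)"
    then have "z \<in> ball w s" using s0 by auto
    from near[OF this] show "z \<in> ball z0 r" using s0 by (simp add: dist_norm norm_minus_commute)
  qed
  have "submean_const p * r\<^sup>2 * cmod (g z0) powr p \<le> (A/2) powr p * (pi * (s/32)\<^sup>2)"
  proof -
    have "cmod (g z0) * r\<^sup>2 \<le> A * (2 * s)\<^sup>2"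
      using max[of z0] u0 r s2 unfolding u_def A_def by simp
    then have "cmod (g z0) \<le> A * (2 * s/r)\<^sup>2" using r by (simp add: field_simps power_divide)
    \<comment> \<open>As 2 * s / r is at most 1 and 2 / p at most 2, the exponent may be lowered;
      its p-th power is then exactly the ratio of areas.\<close>
    also have "\<dots> \<le> A * (2 * s/r) powr (2/p)"
    proof -
      have "(2 * s/r) powr 2 \<le> (2 * s/r) powr (2/p)"
        using s0 s_le r p by (intro powr_mono') (auto simp: field_simps)
      then show ?thesis using s0 r A0 by (intro mult_left_mono) (auto)
    qed
    finally have "cmod (g z0) powr p \<le> (A * (2 * s/r) powr (2/p)) powr p"
      using p by (intro powr_mono2) auto
    also have "\<dots> = A powr p * (2 * s/r)\<^sup>2"
      using A0 s0 r p by (simp add: powr_mult powr_powr)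
    finally have "r\<^sup>2 * cmod (g z0) powr p \<le> A powr p * (2 * s)\<^sup>2"
      using r by (simp add: field_simps power_divide)
    then have "submean_const p * (r\<^sup>2 * cmod (g z0) powr p) \<le> submean_const p * (A powr p * (2 * s)\<^sup>2)"
      by (intro mult_left_mono) (auto simp: less_imp_le)
    also have "\<dots> = (A/2) powr p * (pi * (s/32)\<^sup>2)"
      using A0 by (simp add: submean_const_def powr_divide power2_eq_square field_simps)
    finally show ?thesis by (simp add: mult.assoc)
  qed
  then have "ennreal (submean_const p * r\<^sup>2 * cmod (g z0) powr p)
      \<le> ennreal ((A/2) powr p) * emeasure lborel (ball w (s/32))"
    using s0 by (simp add: emeasure_ball_complex ennreal_mult[symmetric] ennreal_leI)
  also have "\<dots> = (\<integral>\<^sup>+ z. ennreal ((A/2) powr p) * indicator (ball w (s/32)) z \<partial>lborel)"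
    by (rule nn_integral_cmult_indicator[symmetric]) simp
  also have "\<dots> \<le> (\<integral>\<^sup>+ z \<in> ball z0 r. ennreal (cmod (g z) powr p) \<partial>lborel)"
  proof (rule nn_integral_mono)
    fix z
    show "ennreal ((A/2) powr p) * indicator (ball w (s/32)) z
      \<le> ennreal (cmod (g z) powr p) * indicator (ball z0 r) z"
      using low[of z] sub2 A0 p by (auto simp: indicator_def intro!: ennreal_leI powr_mono2)
  qed
  finally show ?thesis .
qed

text \<open>A substitute for Hoelder's inequality: every term is compared with \<open>(\<Sum>K a\<^sup>p)\<^bsup>1/p\<^esup>\<close>.\<close>

lemma weighted_sum_powr_le:
  fixes K a :: "'a \<Rightarrow> real"
  assumes p: "p \<ge> 1" and K: "\<And>i. i \<in> I \<Longrightarrow> K i \<ge> 0" and a: "\<And>i. i \<in> I \<Longrightarrow> a i \<ge> 0"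
    and A: "(\<Sum>i\<in>I. K i) \<le> A"
  shows "(\<Sum>i\<in>I. K i * a i) powr p \<le> (A + 1) powr p * (\<Sum>i\<in>I. K i * a i powr p)"
proof (cases "(\<Sum>i\<in>I. K i * a i powr p) = 0")
  case True
  show ?thesis
  proof (cases "finite I")
    case fin: True
    have "K i * a i powr p = 0" if "i \<in> I" for i
      using True sum_nonneg_eq_0_iff[OF fin, of "\<lambda>i. K i * a i powr p"] K that by auto
    then have "K i * a i = 0" if "i \<in> I" for i using that by fastforce
    then have "(\<Sum>i\<in>I. K i * a i) = 0" by (intro sum.neutral) blast
    then show ?thesis using True p by simp
  qed (use p in auto)
next
  case False
  define T where "T = (\<Sum>i\<in>I. K i * a i powr p)"
  have "T \<ge> 0" using K unfolding T_def by (intro sum_nonneg mult_nonneg_nonneg) auto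
  then have T0: "T > 0" using False unfolding T_def by simp
  define s where "s = T powr (1/p)"
  have s0: "s > 0" using T0 by (simp add: s_def)
  have sp: "s powr p = T" using T0 p by (simp add: s_def powr_powr)
  have A0: "A \<ge> 0" using A K sum_nonneg[of I K] by (auto intro: order_trans)
  have le: "x \<le> s + s powr (1 - p) * x powr p" if "x \<ge> 0" for x
  proof (cases "x \<le> s")
    case True
    then show ?thesis by (simp add: add_increasing2)
  next
    case False
    then have x: "x > s" by simp
    have "x = x powr (1-p) * x powr p" using x s0 by (simp flip: powr_add)
    also have "\<dots> \<le> s powr (1-p) * x powr p" using x s0 p by (intro mult_right_mono powr_mono2') auto
    finally show ?thesis using s0 by simp
  qed
  have "(\<Sum>i\<in>I. K i * a i) \<le> (\<Sum>i\<in>I. K i * (s + s powr (1 - p) * a i powr p))"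
    using le a K by (intro sum_mono mult_left_mono) auto
  also have "\<dots> = s * (\<Sum>i\<in>I. K i) + s powr (1-p) * T"
    unfolding T_def by (simp add: sum_distrib_left sum.distrib algebra_simps)
  also have "s powr (1-p) * T = s" unfolding sp[symmetric] using s0 by (simp flip: powr_add)
  also have "s * (\<Sum>i\<in>I. K i) + s \<le> (A + 1) * s" using A s0 by (simp add: algebra_simps)
  finally have "(\<Sum>i\<in>I. K i * a i) powr p \<le> ((A + 1) * s) powr p"
    using p K a by (intro powr_mono2 sum_nonneg) auto
  also have "\<dots> = (A+1) powr p * T" using A0 s0 by (simp add: powr_mult sp)
  finally show ?thesis unfolding T_def .
qed

section \<open>Division by zeros and a Jensen-type inequality\<close>

lemma holomorphic_divide_zeros:
  assumes "f holomorphic_on UNIV" "finite A" "\<And>a. a \<in> A \<Longrightarrow> f a = (0::complex)"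
  shows "\<exists>g. g holomorphic_on UNIV \<and> (\<forall>z. f z = g z * (\<Prod>a\<in>A. z - a))"
  using assms(2,1,3)
proof (induction A arbitrary: f rule: finite_induct)
  case empty
  then show ?case by auto
next
  case (insert b A)
  define h where "h z = (if z = b then deriv f b else (f z - f b) / (z - b))" for z
  have h: "h holomorphic_on UNIV" unfolding h_def
    using pole_lemma_open[OF insert.prems(1) open_UNIV, of b] by simp
  have fh: "f z = h z * (z - b)" for z using insert.prems(2)[of b] by (simp add: h_def)
  have "h a = 0" if "a \<in> A" for a using fh[of a] insert.prems(2)[of a] insert.hyps that by auto
  from insert.IH[OF h this] obtain g where "g holomorphic_on UNIV" "\<forall>z. h z = g z * (\<Prod>a\<in>A. z - a)"
    by auto
  then show ?case using insert.hyps fh by (intro exI[of _ g]) (auto simp: mult_ac)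
qed

lemma max_modulus_circle:
  assumes "f holomorphic_on UNIV" "R > 0" "cmod z \<le> R"
  obtains w where "cmod w = R" "cmod (f z) \<le> cmod (f w)"
proof -
  have co: "continuous_on (sphere (0::complex) R) (\<lambda>z. cmod (f z))"
    using assms(1) by (intro continuous_intros) (meson holomorphic_on_imp_continuous_on continuous_on_subset top_greatest)
  moreover have "sphere (0::complex) R \<noteq> {}" using assms by simp
  ultimately obtain w where w: "w \<in> sphere 0 R" and max: "\<And>v. v \<in> sphere 0 R \<Longrightarrow> cmod (f v) \<le> cmod (f w)"
    using continuous_attains_sup[of "sphere (0::complex) R" "\<lambda>z. cmod (f z)"] by auto
  have "cmod (f z) \<le> cmod (f w)"
  proof (rule maximum_modulus_frontier[where S = "cball 0 R" and f = f])
    show "f holomorphic_on interior (cball 0 R)" using assms(1) by (rule holomorphic_on_subset) simp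
    show "continuous_on (closure (cball 0 R)) f"
      using assms(1) by (meson holomorphic_on_imp_continuous_on continuous_on_subset top_greatest)
    show "cmod (f v) \<le> cmod (f w)" if "v \<in> frontier (cball 0 R)" for v
      using max that by simp
    show "z \<in> cball 0 R" using assms by simp
  qed auto
  with w that show thesis by simp
qed

lemma one_minus_ge_exp: 
  fixes x :: real
  assumes "0 \<le> x" "x \<le> 1/2"
  shows "exp (- 2 * x) \<le> 1 - x"
proof -
  have "1 - x > 0" using assms by simp
  have "1 / (1 - x) \<le> 1 + 2 * x" using assms by (simp add: field_simps mult_left_mono power2_eq_square)
      (use assms in \<open>smt (verit) mult_left_le mult_nonneg_nonneg\<close>)
  also have "\<dots> \<le> exp (2 * x)" by simp
  finally show ?thesis using \<open>1 - x > 0\<close> by (simp add: exp_minus field_simps)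
qed

text \<open>An elementary form of Jensen's inequality: the maximum principle is applied to f divided
  by the product of the z - a. On |w| = R each factor is at least R - |a|, hence at least R * exp (-
  2 |a| / R), so the division gains a power of R up to the exponential of the sum of |a| / R. That
  sum stays bounded for zeros whose moduli grow geometrically.\<close>

lemma max_modulus_zeros:
  assumes hol: "f holomorphic_on UNIV" and fin: "finite A" and zero: "\<And>a. a \<in> A \<Longrightarrow> f a = 0"
    and R: "R > 0" and small: "\<And>a. a \<in> A \<Longrightarrow> 2 * cmod a \<le> R" and z: "cmod z \<le> R"
  obtains w where "cmod w = R"
    "cmod (f z) * R ^ card A \<le> exp (2 * (\<Sum>a\<in>A. cmod a / R)) * (\<Prod>a\<in>A. cmod (z - a)) * cmod (f w)"
proof -
  obtain g where g: "g holomorphic_on UNIV" and fg: "\<And>z. f z = g z * (\<Prod>a\<in>A. z - a)"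
    using holomorphic_divide_zeros[OF hol fin zero] by blast
  obtain w where w: "cmod w = R" and gw: "cmod (g z) \<le> cmod (g w)"
    using max_modulus_circle[OF g R z] by blast
  let ?E = "exp (- (2 * (\<Sum>a\<in>A. cmod a / R)))"
  have "?E * R ^ card A = (\<Prod>a\<in>A. exp (- 2 * (cmod a / R)) * R)"
    by (simp add: exp_sum[OF fin, symmetric] prod.distrib sum_distrib_left flip: sum_negf)
  also have "\<dots> \<le> (\<Prod>a\<in>A. cmod (w - a))"
  proof (rule prod_mono)
    fix a assume a: "a \<in> A"
    have "exp (- 2 * (cmod a / R)) * R \<le> (1 - cmod a / R) * R"
      using small[OF a] R by (intro mult_right_mono one_minus_ge_exp) (auto simp: field_simps)
    also have "\<dots> = R - cmod a" using R by (simp add: field_simps)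
    also have "\<dots> \<le> cmod (w - a)" using norm_triangle_ineq2[of w a] w by simp
    finally show "0 \<le> exp (- 2 * (cmod a / R)) * R \<and> exp (- 2 * (cmod a / R)) * R \<le> cmod (w - a)"
      using R by simp
  qed
  finally have 1: "?E * R ^ card A \<le> (\<Prod>a\<in>A. cmod (w - a))" .
  have "cmod (f z) * (?E * R ^ card A) \<le> cmod (f z) * (\<Prod>a\<in>A. cmod (w - a))"
    using 1 by (intro mult_left_mono) auto
  also have "\<dots> = (\<Prod>a\<in>A. cmod (z - a)) * (cmod (g z) * (\<Prod>a\<in>A. cmod (w - a)))"
    by (simp add: fg norm_mult mult_ac prod_norm[symmetric])
  also have "\<dots> \<le> (\<Prod>a\<in>A. cmod (z - a)) * (cmod (g w) * (\<Prod>a\<in>A. cmod (w - a)))"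
    using gw by (intro mult_left_mono mult_right_mono prod_nonneg) auto
  also have "\<dots> = (\<Prod>a\<in>A. cmod (z - a)) * cmod (f w)"
    by (simp add: fg norm_mult prod_norm[symmetric])
  finally have "exp (2 * (\<Sum>a\<in>A. cmod a / R)) * (cmod (f z) * (?E * R ^ card A))
     \<le> exp (2 * (\<Sum>a\<in>A. cmod a / R)) * ((\<Prod>a\<in>A. cmod (z - a)) * cmod (f w))"
    by (intro mult_left_mono) auto
  then have "cmod (f z) * R ^ card A \<le> exp (2 * (\<Sum>a\<in>A. cmod a / R)) * (\<Prod>a\<in>A. cmod (z - a)) * cmod (f w)"
    by (simp add: exp_minus mult_ac)
  with w that show thesis by blast
qed

section \<open>Exponentially decaying sequences and mean values\<close>

lemma sum_power_inj_le:
  fixes x :: real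
  assumes "0 \<le> x" "x < 1" "finite F" "inj_on d F"
  shows "(\<Sum>j\<in>F. x ^ d j) \<le> 1 / (1 - x)"
proof -
  have "(\<Sum>j\<in>F. x ^ d j) = (\<Sum>i\<in>d ` F. x ^ i)" using assms by (simp add: sum.reindex)
  also have "\<dots> \<le> (\<Sum>i. x ^ i)" using assms by (intro sum_le_suminf) (auto simp: summable_geometric)
  also have "\<dots> = 1 / (1 - x)" using assms by (simp add: suminf_geometric)
  finally show ?thesis .
qed

text \<open>The sequence may stall, but on average it gains at least \<kappa> per index; c pays for
  the stalls. In the necessity part this weak information is available before the deviations are
  known to be bounded, and it already controls all the error sums.\<close>

definition lin_growth :: "real \<Rightarrow> real \<Rightarrow> (nat \<Rightarrow> real) \<Rightarrow> bool"
  where "lin_growth \<kappa> c \<tau> \<longleftrightarrow> \<kappa> > 0 \<and> mono \<tau> \<and> (\<forall>n j. n \<le> j \<longrightarrow> \<kappa> * (real j - real n) - c \<le> \<tau> j - \<tau> n)"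

text \<open>Points left of t are counted downwards from the last of them, points right of t upwards
  from the first of them. On either side the distance to t is at least \<kappa> times the index
  distance minus c, so a geometric series dominates, independently of t and of the finite index
  set.\<close>

lemma sum_exp_dist_le:
  assumes lg: "lin_growth \<kappa> c \<tau>" and eta: "\<eta> > 0"
  shows "\<exists>C>0. \<forall>t F. finite F \<longrightarrow> (\<Sum>j\<in>F. exp (- \<eta> * \<bar>t - \<tau> j\<bar>)) \<le> C"
proof -
  define x where "x = exp (- \<eta> * \<kappa>)"
  have kap: "\<kappa> > 0" and mon: "mono \<tau>"
    and gr: "\<And>n j. n \<le> j \<Longrightarrow> \<kappa> * (real j - real n) - c \<le> \<tau> j - \<tau> n"
    using lg by (auto simp: lin_growth_def)
  have x: "0 \<le> x" "x < 1" using kap eta by (auto simp: x_def)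
  define C where "C = exp (\<eta> * c) / (1 - x)"
  have C0: "C > 0" using x by (simp add: C_def)
  have half: "(\<Sum>j\<in>F. exp (- \<eta> * \<bar>t - \<tau> j\<bar>)) \<le> C"
    if F: "finite F" "inj_on d F" and d: "\<And>j. j \<in> F \<Longrightarrow> \<kappa> * real (d j) - c \<le> \<bar>t - \<tau> j\<bar>" for t F and d :: "nat \<Rightarrow> nat"
  proof -
    have "(\<Sum>j\<in>F. exp (- \<eta> * \<bar>t - \<tau> j\<bar>)) \<le> (\<Sum>j\<in>F. exp (\<eta> * c) * x ^ d j)"
    proof (rule sum_mono)
      fix j assume "j \<in> F"
      then have "exp (- \<eta> * \<bar>t - \<tau> j\<bar>) \<le> exp (- \<eta> * (\<kappa> * real (d j) - c))" using d eta by simp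
      also have "\<dots> = exp (\<eta> * c) * x ^ d j"
        by (simp add: x_def algebra_simps flip: exp_of_nat_mult exp_add)
      finally show "exp (- \<eta> * \<bar>t - \<tau> j\<bar>) \<le> exp (\<eta> * c) * x ^ d j" .
    qed
    also have "\<dots> \<le> exp (\<eta> * c) * (1 / (1 - x))"
      unfolding sum_distrib_left[symmetric] using x F by (intro mult_left_mono sum_power_inj_le) auto
    finally show ?thesis by (simp add: C_def)
  qed
  have left: "(\<Sum>j\<in>F. exp (- \<eta> * \<bar>t - \<tau> j\<bar>)) \<le> C" if F: "finite F" and le: "\<And>j. j \<in> F \<Longrightarrow> \<tau> j \<le> t" for t F
  proof (cases "F = {}")
    case False
    define n where "n = Max F"
    have n: "n \<in> F" "\<And>j. j \<in> F \<Longrightarrow> j \<le> n" using F False by (auto simp: n_def)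
    show ?thesis
    proof (rule half[OF F])
      show "inj_on (\<lambda>j. n - j) F" using n(2) by (intro inj_onI) (metis diff_diff_cancel)
      show "\<kappa> * real (n - j) - c \<le> \<bar>t - \<tau> j\<bar>" if "j \<in> F" for j
        using gr[OF n(2)[OF that]] le[OF n(1)] n(2)[OF that] by (simp add: of_nat_diff)
    qed
  qed (use C0 in auto)
  have right: "(\<Sum>j\<in>F. exp (- \<eta> * \<bar>t - \<tau> j\<bar>)) \<le> C" if F: "finite F" and le: "\<And>j. j \<in> F \<Longrightarrow> t \<le> \<tau> j" for t F
  proof (cases "F = {}")
    case False
    define n where "n = Min F"
    have n: "n \<in> F" "\<And>j. j \<in> F \<Longrightarrow> n \<le> j" using F False by (auto simp: n_def)
    show ?thesis
    proof (rule half[OF F])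
      show "inj_on (\<lambda>j. j - n) F" using n(2) by (intro inj_onI) (metis le_add_diff_inverse)
      show "\<kappa> * real (j - n) - c \<le> \<bar>t - \<tau> j\<bar>" if "j \<in> F" for j
        using gr[OF n(2)[OF that]] le[OF n(1)] n(2)[OF that] by (simp add: of_nat_diff)
    qed
  qed (use C0 in auto)
  have "(\<Sum>j\<in>F. exp (- \<eta> * \<bar>t - \<tau> j\<bar>)) \<le> C + C" if F: "finite F" for t F
  proof -
    have "(\<Sum>j\<in>F. exp (- \<eta> * \<bar>t - \<tau> j\<bar>)) = (\<Sum>j\<in>{j\<in>F. \<tau> j \<le> t}. exp (- \<eta> * \<bar>t - \<tau> j\<bar>)) + (\<Sum>j\<in>{j\<in>F. \<not> \<tau> j \<le> t}. exp (- \<eta> * \<bar>t - \<tau> j\<bar>))"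
      using F by (subst sum.union_disjoint[symmetric]) (auto intro!: sum.cong)
    also have "\<dots> \<le> C + C" using F by (intro add_mono left right) auto
    finally show ?thesis .
  qed
  then show ?thesis using C0 by (intro exI[of _ "C + C"]) auto
qed

lemma lin_growth_of_nat: "lin_growth 1 0 real"
  by (auto simp: lin_growth_def mono_def)

text \<open>The tails \<open>T\<^sub>n\<close> satisfy \<open>T\<^sub>n\<^sub>+\<^sub>1 = T\<^sub>n - b\<^sub>n \<le> C / (C + 1) T\<^sub>n\<close>.\<close>

lemma exp_decay_of_sum_le:
  fixes b :: "nat \<Rightarrow> real"
  assumes pos: "\<And>n. b n > 0" and C: "C > 0" and le: "\<And>n K. (\<Sum>k\<in>{n<..K}. b k) \<le> C * b n"
  shows "\<exists>D>0. \<exists>\<epsilon>>0. \<forall>n k. n \<le> k \<longrightarrow> b k \<le> D * exp (- \<epsilon> * (real k - real n)) * b n"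
proof -
  define \<theta> where "\<theta> = C / (C + 1)"
  have th: "0 < \<theta>" "\<theta> < 1" using C by (auto simp: \<theta>_def)
  define \<epsilon> where "\<epsilon> = - ln \<theta>"
  have eps: "\<epsilon> > 0" using th by (simp add: \<epsilon>_def)
  have "b K \<le> (C + 1) * exp (- \<epsilon> * (real K - real n)) * b n" if "n \<le> K" for n K
  proof -
    define T where "T m = (\<Sum>k\<in>{m..K}. b k)" for m
    have split: "T m = b m + T (Suc m)" if "m \<le> K" for m
      using that by (simp add: T_def sum.atLeast_Suc_atMost)
    have Tb: "T m \<le> (C + 1) * b m" if "m \<le> K" for m
      using le[of m K] split[OF that] by (simp add: T_def atLeastSucAtMost_greaterThanAtMost algebra_simps)
    have step: "T (Suc m) \<le> \<theta> * T m" if "m \<le> K" for m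
    proof -
      have "T m / (C + 1) \<le> b m" using Tb[OF that] C by (simp add: field_simps)
      then have "T (Suc m) \<le> T m - T m / (C + 1)" using split[OF that] by simp
      also have "\<dots> = \<theta> * T m" using C by (simp add: \<theta>_def field_simps)
      finally show ?thesis .
    qed
    have it: "T (n + i) \<le> \<theta> ^ i * T n" if "n + i \<le> K" for i
      using that
    proof (induction i)
      case (Suc i)
      have "T (n + Suc i) \<le> \<theta> * T (n + i)" using step[of "n + i"] Suc.prems by simp
      also have "\<dots> \<le> \<theta> * (\<theta> ^ i * T n)" using Suc th by (intro mult_left_mono) auto
      finally show ?case by simp
    qed simp
    have "b K = T (n + (K - n))" using that by (simp add: T_def)
    also have "\<dots> \<le> \<theta> ^ (K - n) * T n" using that by (intro it) auto
    also have "\<dots> \<le> \<theta> ^ (K - n) * ((C + 1) * b n)" using th Tb[OF that] by (intro mult_left_mono) auto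
    also have "\<theta> ^ (K - n) = exp (- \<epsilon> * (real K - real n))"
    proof -
      have "\<theta> ^ (K - n) = exp (real (K - n) * ln \<theta>)" using th by (simp add: exp_of_nat_mult)
      then show ?thesis using that by (simp add: \<epsilon>_def of_nat_diff algebra_simps)
    qed
    finally show ?thesis by (simp add: mult_ac)
  qed
  then show ?thesis using C eps by (intro exI[of _ "C + 1"] conjI exI[of _ \<epsilon>]) auto
qed

text \<open>The mirror image of the previous argument, with partial sums instead of tails: b at n +
  1 is at least 1 / (C + 1) of the sum up to n + 1, hence
  \<open>U n \<le> \<theta> * U (Suc n)\<close> with \<theta> = C / (C + 1).\<close>

lemma exp_growth_of_sum_le:
  fixes b :: "nat \<Rightarrow> real"
  assumes pos: "\<And>n. b n > 0" and C: "C > 0" and le: "\<And>n. (\<Sum>k<n. b k) \<le> C * b n"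
  shows "\<exists>D>0. \<exists>\<epsilon>>0. \<forall>k n. k \<le> n \<longrightarrow> b k \<le> D * exp (- \<epsilon> * (real n - real k)) * b n"
proof -
  define \<theta> where "\<theta> = C / (C + 1)"
  have th: "0 < \<theta>" "\<theta> < 1" using C by (auto simp: \<theta>_def)
  define \<epsilon> where "\<epsilon> = - ln \<theta>"
  have eps: "\<epsilon> > 0" using th by (simp add: \<epsilon>_def)
  define U where "U n = (\<Sum>k<Suc n. b k)" for n
  have Ub: "U n \<le> (C + 1) * b n" for n using le[of n] by (simp add: U_def algebra_simps)
  have step: "U n \<le> \<theta> * U (Suc n)" for n
  proof -
    have eq: "U (Suc n) = U n + b (Suc n)" by (simp add: U_def)
    have "U (Suc n) / (C + 1) \<le> b (Suc n)" using Ub[of "Suc n"] C by (simp add: field_simps)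
    then have "U n \<le> U (Suc n) - U (Suc n) / (C + 1)" using eq by simp
    also have "\<dots> = \<theta> * U (Suc n)" using C by (simp add: \<theta>_def field_simps)
    finally show ?thesis .
  qed
  have it: "U k \<le> \<theta> ^ i * U (k + i)" for i k
  proof (induction i)
    case (Suc i)
    have "\<theta> ^ i * U (k + i) \<le> \<theta> ^ i * (\<theta> * U (k + Suc i))" using step[of "k + i"] th by (intro mult_left_mono) auto
    then show ?case using Suc by (simp add: mult_ac)
  qed simp
  have "b k \<le> (C + 1) * exp (- \<epsilon> * (real n - real k)) * b n" if "k \<le> n" for k n
  proof -
    have "b k \<le> U k" unfolding U_def using pos by (simp add: sum_nonneg less_imp_le)
    also have "\<dots> \<le> \<theta> ^ (n - k) * U n" using it[of k "n - k"] that by simp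
    also have "\<dots> \<le> \<theta> ^ (n - k) * ((C + 1) * b n)" using th Ub by (intro mult_left_mono) auto
    also have "\<theta> ^ (n - k) = exp (- \<epsilon> * (real n - real k))"
    proof -
      have "\<theta> ^ (n - k) = exp (real (n - k) * ln \<theta>)" using th by (simp add: exp_of_nat_mult)
      then show ?thesis using that by (simp add: \<epsilon>_def of_nat_diff algebra_simps)
    qed
    finally show ?thesis by (simp add: mult_ac)
  qed
  then show ?thesis using C eps by (intro exI[of _ "C + 1"] conjI exI[of _ \<epsilon>]) auto
qed

text \<open>The strict inequality for the means without a distinguished block length: sums over
  every block of length l are at most (\<beta> - \<epsilon>) l + C in absolute value. The additive C
  makes the condition insensitive to bounded changes of the partial sums, such as those caused by an
  index shift.\<close>

definition small_drift :: "real \<Rightarrow> (nat \<Rightarrow> real) \<Rightarrow> bool"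
  where "small_drift \<beta> \<delta> \<longleftrightarrow> (\<exists>\<epsilon>>0. \<exists>C. \<forall>n k. n \<le> k \<longrightarrow>
    \<bar>(\<Sum>j<k. \<delta> j) - (\<Sum>j<n. \<delta> j)\<bar> \<le> (\<beta> - \<epsilon>) * (real k - real n) + C)"

lemma small_drift_perturb:
  assumes "small_drift \<beta> \<delta>" and bd: "\<And>n. \<bar>(\<Sum>j<n. \<delta>' j) - (\<Sum>j<n. \<delta> j)\<bar> \<le> D"
  shows "small_drift \<beta> \<delta>'"
proof -
  obtain \<epsilon> C where *: "\<epsilon> > 0" "\<And>n k. n \<le> k \<Longrightarrow> \<bar>(\<Sum>j<k. \<delta> j) - (\<Sum>j<n. \<delta> j)\<bar> \<le> (\<beta> - \<epsilon>) * (real k - real n) + C"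
    using assms by (auto simp: small_drift_def)
  have "\<bar>(\<Sum>j<k. \<delta>' j) - (\<Sum>j<n. \<delta>' j)\<bar> \<le> (\<beta> - \<epsilon>) * (real k - real n) + (C + 2 * D)" if "n \<le> k" for n k
    using *(2)[OF that] bd[of n] bd[of k] by linarith
  then show ?thesis using *(1) unfolding small_drift_def by blast
qed

lemma sum_diff_lessThan:
  fixes f :: "nat \<Rightarrow> real"
  assumes "n \<le> k"
  shows "(\<Sum>j<k. f j) - (\<Sum>j<n. f j) = (\<Sum>j\<in>{n..<k}. f j)"
  using sum_diff_nat_ivl[of 0 n k f] assms by (simp add: atLeast0LessThan)

text \<open>From means to drift, a block is cut into pieces of length N; the remainder has fewer
  than N terms and costs at most N * B. In the converse direction N is taken so large that C / N is
  at most half of \<epsilon>.\<close>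

lemma means_iff_small_drift:
  assumes bd: "bounded (range \<delta>)" and beta: "\<beta> > 0"
  shows "(\<exists>N\<ge>1. ereal (- \<beta>) < nabla_mean \<delta> N \<and> nabla_mean \<delta> N \<le> Delta_mean \<delta> N \<and> Delta_mean \<delta> N < ereal \<beta>)
    \<longleftrightarrow> small_drift \<beta> \<delta>"
proof
  obtain B where B: "\<And>n. \<bar>\<delta> n\<bar> \<le> B" using bd by (auto simp: bounded_iff)
  have B0: "B \<ge> 0" using B[of 0] by simp
  assume "\<exists>N\<ge>1. ereal (- \<beta>) < nabla_mean \<delta> N \<and> nabla_mean \<delta> N \<le> Delta_mean \<delta> N \<and> Delta_mean \<delta> N < ereal \<beta>"
  then obtain N where N: "N \<ge> 1" "ereal (- \<beta>) < nabla_mean \<delta> N" "Delta_mean \<delta> N < ereal \<beta>" by auto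
  obtain a where a: "ereal (-\<beta>) < ereal a" "ereal a < nabla_mean \<delta> N" using ereal_dense2[OF N(2)] by blast
  obtain b where b: "Delta_mean \<delta> N < ereal b" "ereal b < ereal \<beta>" using ereal_dense2[OF N(3)] by blast
  \<comment> \<open>The entry \<beta> / 2 keeps \<beta> - \<epsilon> positive, so that bounds with
    this factor may be enlarged.\<close>
  define \<epsilon> where "\<epsilon> = min (min (a + \<beta>) (\<beta> - b)) (\<beta>/2)"
  have eps: "\<epsilon> > 0" "\<epsilon> < \<beta>" using a b beta by (auto simp: \<epsilon>_def)
  \<comment> \<open>The averages run over n + 1, ..., n + N, so they speak only about blocks that
    start at index 1 or later. The entry at index 0 is put back separately at the end, at cost
    B.\<close>
  have block: "\<bar>\<Sum>k\<in>{n..<n+N}. \<delta> k\<bar> \<le> (\<beta> - \<epsilon>) * real N" if "n \<ge> 1" for n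
  proof -
    have eq: "{n..<n+N} = {(n - 1) + 1..(n - 1) + N}" using that N by auto
    define s where "s = (\<Sum>k\<in>{n..<n+N}. \<delta> k)"
    have "ereal a < ereal (1 / real N * s)"
      using a(2) unfolding nabla_mean_def s_def eq by (rule less_le_trans) (rule INF_lower, simp)
    moreover have "ereal (1 / real N * s) < ereal b"
      unfolding s_def eq by (rule le_less_trans[OF _ b(1)[unfolded Delta_mean_def]]) (rule SUP_upper, simp)
    ultimately have "a * real N < s" "s < b * real N" using N(1) by (auto simp: field_simps)
    moreover have "- (\<beta> - \<epsilon>) * real N \<le> a * real N" "b * real N \<le> (\<beta> - \<epsilon>) * real N"
      unfolding \<epsilon>_def by (intro mult_right_mono; simp)+
    ultimately show ?thesis unfolding s_def[symmetric] by linarith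
  qed
  have ge1: "\<bar>\<Sum>k\<in>{n..<n+m}. \<delta> k\<bar> \<le> (\<beta> - \<epsilon>) * real m + real N * B" if "n \<ge> 1" for n m
    using that
  proof (induction m arbitrary: n rule: less_induct)
    case (less m)
    show ?case
    proof (cases "m < N")
      case True
      have "\<bar>\<Sum>k\<in>{n..<n+m}. \<delta> k\<bar> \<le> (\<Sum>k\<in>{n..<n+m}. B)" using B by (intro order_trans[OF sum_abs] sum_mono) auto
      also have "\<dots> \<le> real N * B" using True B0 by (auto intro!: mult_right_mono)
      finally show ?thesis using eps by (simp add: add_increasing)
    next
      case False
      have "(\<Sum>k\<in>{n..<n+m}. \<delta> k) = (\<Sum>k\<in>{n..<n+N}. \<delta> k) + (\<Sum>k\<in>{n+N..<n+N+(m-N)}. \<delta> k)"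
        using False by (subst sum.atLeastLessThan_concat) auto
      moreover have "\<bar>\<Sum>k\<in>{n+N..<n+N+(m-N)}. \<delta> k\<bar> \<le> (\<beta> - \<epsilon>) * real (m-N) + real N * B"
        using less.prems False N(1) by (intro less.IH) auto
      moreover have "(\<beta> - \<epsilon>) * real (m - N) = (\<beta> - \<epsilon>) * real m - (\<beta> - \<epsilon>) * real N"
        using False by (simp add: of_nat_diff algebra_simps)
      ultimately show ?thesis using block[OF less.prems] by linarith
    qed
  qed
  have "\<bar>(\<Sum>j<k. \<delta> j) - (\<Sum>j<n. \<delta> j)\<bar> \<le> (\<beta> - \<epsilon>) * (real k - real n) + (real N * B + B)" if "n \<le> k" for n k
  proof (cases "n \<ge> 1 \<or> k = 0")
    case True
    then show ?thesis using ge1[of n "k - n"] that B0 N by (auto simp: sum_diff_lessThan of_nat_diff)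
  next
    case False
    then have n: "n = 0" "k \<ge> 1" by auto
    have "(\<Sum>j\<in>{0..<k}. \<delta> j) = \<delta> 0 + (\<Sum>j\<in>{1..<1+(k-1)}. \<delta> j)"
      using n by (simp add: sum.atLeast_Suc_lessThan)
    then have "\<bar>\<Sum>j<k. \<delta> j\<bar> \<le> B + ((\<beta> - \<epsilon>) * real (k - 1) + real N * B)"
      using ge1[of 1 "k-1"] B[of 0] unfolding atLeast0LessThan by linarith
    also have "(\<beta> - \<epsilon>) * real (k - 1) \<le> (\<beta> - \<epsilon>) * real k" using eps by (intro mult_left_mono) auto
    finally show ?thesis using n by simp
  qed
  then show "small_drift \<beta> \<delta>" using eps unfolding small_drift_def by blast
next
  assume "small_drift \<beta> \<delta>"
  then obtain \<epsilon> C where *: "\<epsilon> > 0" "\<And>n k. n \<le> k \<Longrightarrow> \<bar>(\<Sum>j<k. \<delta> j) - (\<Sum>j<n. \<delta> j)\<bar> \<le> (\<beta> - \<epsilon>) * (real k - real n) + C"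
    by (auto simp: small_drift_def)
  obtain N :: nat where N: "real N > 2 * C / \<epsilon> + 1" using reals_Archimedean2 by blast
  have "C \<ge> 0" using *(2)[of 0 0] by simp
  then have N1: "real N > 1" using N *(1) by (smt (verit) divide_nonneg_pos)
  have CN: "C / real N \<le> \<epsilon> / 2" using N N1 *(1) by (simp add: field_simps)
  have avg: "\<bar>1 / real N * (\<Sum>k = n + 1..n + N. \<delta> k)\<bar> \<le> \<beta> - \<epsilon> / 2" for n
  proof -
    have "(\<Sum>k = n + 1..n + N. \<delta> k) = (\<Sum>j<n+1+N. \<delta> j) - (\<Sum>j<n+1. \<delta> j)"
    proof -
      have "{n + 1..n + N} = {n + 1..<n + 1 + N}" by auto
      then show ?thesis by (subst sum_diff_lessThan) auto
    qed
    then have "\<bar>\<Sum>k = n + 1..n + N. \<delta> k\<bar> \<le> (\<beta> - \<epsilon>) * real N + C" using *(2)[of "n+1" "n+1+N"] by simp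
    then have "\<bar>1 / real N * (\<Sum>k = n + 1..n + N. \<delta> k)\<bar> \<le> ((\<beta> - \<epsilon>) * real N + C) / real N"
      using N1 by (simp add: abs_mult divide_right_mono)
    also have "\<dots> = \<beta> - \<epsilon> + C / real N" using N1 by (simp add: field_simps)
    finally show ?thesis using CN by linarith
  qed
  have "ereal (- \<beta>) < ereal (- (\<beta> - \<epsilon>/2))" using *(1) by simp
  also have "\<dots> \<le> nabla_mean \<delta> N" unfolding nabla_mean_def
  proof (rule INF_greatest)
    show "ereal (- (\<beta> - \<epsilon>/2)) \<le> ereal (1 / real N * (\<Sum>k = n + 1..n + N. \<delta> k))" for n
      using avg[of n] unfolding ereal_less_eq abs_le_iff by linarith
  qed
  finally have 1: "ereal (- \<beta>) < nabla_mean \<delta> N" .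
  have "Delta_mean \<delta> N \<le> ereal (\<beta> - \<epsilon>/2)" unfolding Delta_mean_def
  proof (rule SUP_least)
    show "ereal (1 / real N * (\<Sum>k = n + 1..n + N. \<delta> k)) \<le> ereal (\<beta> - \<epsilon>/2)" for n
      using avg[of n] unfolding ereal_less_eq abs_le_iff by linarith
  qed
  also have "\<dots> < ereal \<beta>" using *(1) by simp
  finally have 2: "Delta_mean \<delta> N < ereal \<beta>" .
  have 3: "nabla_mean \<delta> N \<le> Delta_mean \<delta> N" unfolding nabla_mean_def Delta_mean_def
    by (rule INF_le_SUP) simp
  show "\<exists>N\<ge>1. ereal (- \<beta>) < nabla_mean \<delta> N \<and> nabla_mean \<delta> N \<le> Delta_mean \<delta> N \<and> Delta_mean \<delta> N < ereal \<beta>"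
    using 1 2 3 N1 by (intro exI[of _ N]) auto
qed

section \<open>Pointwise and integral bounds in the weighted space\<close>

lemma le_suminf_ennreal: "(g k :: ennreal) \<le> (\<Sum>k. g k)"
  using sum_le_suminf[of g "{k}"] by (simp add: summableI)

locale small_fock =
  fixes \<alpha> p :: real
  assumes alpha_pos: "\<alpha> > 0" and p_ge_1: "p \<ge> 1"
begin

definition pot :: "real \<Rightarrow> real" where "pot t = \<alpha> * t\<^sup>2 - 2 / p * t"

text \<open>For |z| at least 1 the p-th power is |f e^{-\<phi>}|^p |z|^2, the density times the area
  of an annulus at z up to constants. Since \<open>pot\<close> uses ln and not its positive part,
  comparisons with the norm keep |z| above some m > 0.\<close>

definition wval :: "(complex \<Rightarrow> complex) \<Rightarrow> complex \<Rightarrow> real"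
  where "wval f z = cmod (f z) * exp (- pot (ln (cmod z)))"

abbreviation "fnorm \<equiv> fock_norm_pow p (log_weight \<alpha>)"

abbreviation "fspace \<equiv> fock_space p (log_weight \<alpha>)"

abbreviation "dens f z \<equiv> ennreal (cmod (f z * complex_of_real (exp (- log_weight \<alpha> z))) powr p)"

text \<open>In the exponent, 1 + 2 \<alpha> |ln m| bounds the distance of the slope 2 \<alpha> ln
  |z| from the natural number that approximates it, and \<alpha> bounds the quadratic remainder of
  the weight. The denominator comes from the sub-mean-value inequality on a disc of radius c
  |z|.\<close>

definition ptw_const :: "real \<Rightarrow> real \<Rightarrow> real"
  where "ptw_const m c = exp (p * (1 + 2 * \<alpha> * \<bar>ln m\<bar> + \<alpha>)) / (submean_const p * c\<^sup>2)"

lemma p_pos: "p > 0" using p_ge_1 by simp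

lemma wval_nonneg [simp]: "wval f z \<ge> 0" by (simp add: wval_def)

lemma log_plus_sq_le: "(log_plus x)\<^sup>2 \<le> (ln x)\<^sup>2"
  unfolding log_plus_def by (cases "ln x \<ge> 0") (auto simp: max_def)

lemma log_weight_measurable [measurable]: "log_weight \<alpha> \<in> borel_measurable borel"
  unfolding log_weight_def log_plus_def by measurable

lemma fock_integrand_measurable:
  assumes "f holomorphic_on UNIV"
  shows "dens f \<in> borel_measurable borel"
proof -
  have [measurable]: "f \<in> borel_measurable borel"
    using assms holomorphic_on_imp_continuous_on borel_measurable_continuous_onI by blast
  show ?thesis by measurable
qed

lemma ptw_const_pos: "c > 0 \<Longrightarrow> ptw_const m c > 0"
  by (simp add: ptw_const_def)

text \<open>In u = ln |w| - ln |z| the exponent \<alpha> (ln |w|)^2 is linear with slope 2 \<alpha>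
  T up to a bounded term. The factor (z / w)^N compensates the linear part without destroying
  holomorphy, so \<open>submean_powr\<close> applies to g with an essentially constant
  weight.\<close>

lemma wval_powr_le_integral:
  assumes m: "m > 0" and c: "0 < c" "c \<le> 1/2" and f: "f holomorphic_on UNIV" and z: "m \<le> cmod z"
  shows "ennreal (wval f z powr p)
    \<le> ennreal (ptw_const m c) * (\<integral>\<^sup>+ w \<in> ball z (c * cmod z). dens f w \<partial>lborel)"
proof -
  define D where "D = 1 + 2 * \<alpha> * \<bar>ln m\<bar>"
  define k where "k = submean_const p * c\<^sup>2 * exp (- p * (D + \<alpha>))"
  have k0: "k > 0" using c by (simp add: k_def)
  have k_eq: "ptw_const m c = 1 / k"
    by (simp add: ptw_const_def k_def D_def exp_minus divide_inverse)
  have z0: "cmod z > 0" using m z by linarith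
  define T where "T = ln (cmod z)"
  \<comment> \<open>For negative T this is 0. The error is then 2 \<alpha> |T|, which is at most 2
    \<alpha> |ln m| because m is a lower bound for |z|.\<close>
  define N where "N = nat \<lfloor>2 * \<alpha> * T\<rfloor>"
  define E where "E = exp (- (\<alpha> * T\<^sup>2 + D + \<alpha>))"
  have N: "\<bar>real N - 2 * \<alpha> * T\<bar> \<le> D"
  proof (cases "T \<ge> 0")
    case True
    then have "real N = of_int \<lfloor>2 * \<alpha> * T\<rfloor>" using alpha_pos by (simp add: N_def)
    then have "\<bar>real N - 2 * \<alpha> * T\<bar> \<le> 1" by linarith
    also have "1 \<le> D" using alpha_pos by (simp add: D_def)
    finally show ?thesis .
  next
    case False
    then have "2 * \<alpha> * T < 0" using alpha_pos by (intro mult_pos_neg) auto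
    then have "2 * \<alpha> * T < 1" by linarith
    then have "N = 0" unfolding N_def by simp
    have "ln m \<le> T" using m z z0 unfolding T_def by (subst ln_le_cancel_iff) auto
    then have "\<bar>T\<bar> \<le> \<bar>ln m\<bar>" using False by simp
    then have "2 * \<alpha> * \<bar>T\<bar> \<le> 2 * \<alpha> * \<bar>ln m\<bar>" using alpha_pos by simp
    moreover have "\<bar>real N - 2 * \<alpha> * T\<bar> = 2 * \<alpha> * \<bar>T\<bar>"
      using \<open>N = 0\<close> alpha_pos by (simp add: abs_mult)
    ultimately show ?thesis unfolding D_def by linarith
  qed
  define g where "g w = f w * (z / w) ^ N" for w
  have sub: "cball z (c * cmod z) \<subseteq> - {0}"
  proof
    fix w assume "w \<in> cball z (c * cmod z)"
    then have "cmod (z - w) \<le> c * cmod z" by (simp add: dist_norm)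
    also have "\<dots> < cmod z" using c z0 by simp
    finally show "w \<in> - {0}" by auto
  qed
  have gh: "g holomorphic_on - {0}"
    unfolding g_def using f by (intro holomorphic_intros) (auto intro: holomorphic_on_subset)
  have gz: "g z = f z" using z0 by (simp add: g_def)
  have le: "cmod (g w) * E \<le> cmod (f w * complex_of_real (exp (- log_weight \<alpha> w)))"
    if w: "w \<in> ball z (c * cmod z)" for w
  proof -
    have d: "cmod (z - w) < cmod z / 2"
      using w mult_right_mono[OF c(2), of "cmod z"] by (simp add: dist_norm)
    have w1: "cmod z / 2 < cmod w" using d norm_triangle_ineq2[of z w] by simp
    have w2: "cmod w < 2 * cmod z" using d norm_triangle_ineq2[of w z] norm_minus_commute[of w z] z0 by linarith
    have w0: "cmod w > 0" using w1 z0 by (smt (verit) half_gt_zero)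
    define u where "u = ln (cmod w) - T"
    have u_eq: "u = ln (cmod w / cmod z)" using w0 z0 by (simp add: u_def T_def ln_div)
    have "u \<le> ln 2" unfolding u_eq using w2 w0 z0 by (subst ln_le_cancel_iff) (auto simp: field_simps)
    moreover have "ln (1/2) \<le> u" unfolding u_eq using w1 w0 z0 by (subst ln_le_cancel_iff) (auto simp: field_simps)
    ultimately have u1: "\<bar>u\<bar> \<le> 1" using ln_2_less_1 by (simp add: ln_div)
    have "log_weight \<alpha> w \<le> \<alpha> * (T + u)\<^sup>2"
      unfolding log_weight_def u_def using alpha_pos log_plus_sq_le by simp
    also have "\<dots> = \<alpha> * T\<^sup>2 + 2 * \<alpha> * T * u + \<alpha> * u\<^sup>2" by (simp add: power2_eq_square algebra_simps)
    also have "2 * \<alpha> * T * u \<le> real N * u + D"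
    proof -
      have "(2 * \<alpha> * T - real N) * u \<le> \<bar>2 * \<alpha> * T - real N\<bar> * \<bar>u\<bar>" by (metis abs_ge_self abs_mult)
      also have "\<dots> \<le> D * 1" using N u1 by (intro mult_mono) auto
      finally show ?thesis by (simp add: algebra_simps)
    qed
    also have "\<alpha> * u\<^sup>2 \<le> \<alpha> * 1" using alpha_pos u1 by (intro mult_left_mono) (auto simp: abs_square_le_1)
    finally have lw: "log_weight \<alpha> w \<le> \<alpha> * T\<^sup>2 + D + \<alpha> + real N * u" by simp
    have "cmod ((z / w) ^ N) = exp (- (real N * u))"
    proof -
      have "cmod (z / w) = exp (- u)" using u_eq w0 z0 by (simp add: exp_minus norm_divide)
      then show ?thesis by (simp add: norm_power exp_of_nat_mult[symmetric])
    qed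
    then have "cmod (g w) * E = cmod (f w) * exp (- (\<alpha> * T\<^sup>2 + D + \<alpha> + real N * u))"
      by (simp add: g_def E_def norm_mult mult.assoc flip: exp_add)
    also have "\<dots> \<le> cmod (f w) * exp (- log_weight \<alpha> w)" using lw by (intro mult_left_mono) auto
    finally show ?thesis by (simp add: norm_mult)
  qed
  have E0: "E > 0" by (simp add: E_def)
  \<comment> \<open>The linear term of \<open>pot\<close> contributes, after the p-th power, the
    factor |z|^2; it matches the square of the radius c |z| in the sub-mean-value
    inequality.\<close>
  have eq: "k * wval f z powr p = E powr p * (submean_const p * (c * cmod z)\<^sup>2 * cmod (g z) powr p)"
  proof -
    have "exp (- pot T) powr p = exp (- p * \<alpha> * T\<^sup>2) * (cmod z)\<^sup>2"
    proof -
      have "exp (- pot T) powr p = exp (- p * \<alpha> * T\<^sup>2 + 2 * T)"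
        using p_pos by (simp add: powr_def pot_def algebra_simps)
      also have "\<dots> = exp (- p * \<alpha> * T\<^sup>2) * exp (2 * T)" by (rule exp_add)
      also have "exp (2 * T) = (cmod z)\<^sup>2" using z0
        by (simp add: T_def exp_double)
      finally show ?thesis .
    qed
    then have "wval f z powr p = cmod (f z) powr p * (exp (- p * \<alpha> * T\<^sup>2) * (cmod z)\<^sup>2)"
      unfolding wval_def T_def[symmetric] by (simp add: powr_mult)
    moreover have "E powr p = exp (- p * (D + \<alpha>)) * exp (- p * \<alpha> * T\<^sup>2)"
      by (simp add: E_def powr_def algebra_simps flip: exp_add)
    ultimately show ?thesis by (simp add: k_def gz power_mult_distrib)
  qed
  have "ennreal (k * wval f z powr p) = ennreal (E powr p) * ennreal (submean_const p * (c * cmod z)\<^sup>2 * cmod (g z) powr p)"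
    unfolding eq by (rule ennreal_mult) (auto simp: less_imp_le)
  also have "\<dots> \<le> ennreal (E powr p) * (\<integral>\<^sup>+ w \<in> ball z (c * cmod z). ennreal (cmod (g w) powr p) \<partial>lborel)"
    using c z0 by (intro mult_left_mono submean_powr[OF gh sub _ p_ge_1]) auto
  also have "\<dots> = (\<integral>\<^sup>+ w. ennreal (E powr p) * (ennreal (cmod (g w) powr p) * indicator (ball z (c * cmod z)) w) \<partial>lborel)"
  proof (rule nn_integral_cmult[symmetric])
    have [measurable]: "f \<in> borel_measurable borel"
      using f holomorphic_on_imp_continuous_on borel_measurable_continuous_onI by blast
    have [measurable]: "g \<in> borel_measurable borel" unfolding g_def by measurable
    show "(\<lambda>w. ennreal (cmod (g w) powr p) * indicator (ball z (c * cmod z)) w) \<in> borel_measurable lborel"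
      by (intro borel_measurable_times_ennreal borel_measurable_indicator) simp_all
  qed
  also have "\<dots> \<le> (\<integral>\<^sup>+ w \<in> ball z (c * cmod z). dens f w \<partial>lborel)"
  proof (rule nn_integral_mono)
    fix w
    have "E powr p * cmod (g w) powr p \<le> cmod (f w * complex_of_real (exp (- log_weight \<alpha> w))) powr p"
      if "w \<in> ball z (c * cmod z)"
      using powr_mono2[OF _ _ le[OF that], of p] p_pos E0
      by (simp add: powr_mult mult.commute)
    then show "ennreal (E powr p) * (ennreal (cmod (g w) powr p) * indicator (ball z (c * cmod z)) w)
      \<le> dens f w * indicator (ball z (c * cmod z)) w"
      by (auto simp: indicator_def ennreal_mult[symmetric] intro!: ennreal_leI)
  qed
  finally have main: "ennreal (k * wval f z powr p) \<le> \<dots>" .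
  have "ennreal (wval f z powr p) = ennreal (1/k) * ennreal (k * wval f z powr p)"
    using k0 by (subst ennreal_mult[symmetric]) auto
  also have "\<dots> \<le> ennreal (1/k) * (\<integral>\<^sup>+ w \<in> ball z (c * cmod z). dens f w \<partial>lborel)"
    using main by (intro mult_left_mono) auto
  finally show ?thesis unfolding k_eq .
qed

text \<open>A Plancherel-Polya type inequality: the discs are disjoint, so the local integrals add
  up to at most the full norm.\<close>

lemma sum_wval_powr_le:
  fixes I :: "nat set"
  assumes m: "m > 0" and c: "0 < c" "c \<le> 1/2" and f: "f holomorphic_on UNIV"
    and K: "0 \<le> K" "fnorm f \<le> ennreal K" and I: "finite I" and z: "\<And>i. i \<in> I \<Longrightarrow> m \<le> cmod (z i)"
    and dis: "disjoint_family_on (\<lambda>i. ball (z i) (c * cmod (z i))) I"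
  shows "(\<Sum>i\<in>I. wval f (z i) powr p) \<le> ptw_const m c * K"
proof -
  let ?C = "ptw_const m c"
  have C: "?C > 0" using c(1) by (rule ptw_const_pos)
  let ?B = "\<lambda>i. ball (z i) (c * cmod (z i))"
  have F: "dens f \<in> borel_measurable borel" by (rule fock_integrand_measurable[OF f])
  have "ennreal (\<Sum>i\<in>I. wval f (z i) powr p) = (\<Sum>i\<in>I. ennreal (wval f (z i) powr p))"
    by (rule sum_ennreal[symmetric]) simp
  also have "\<dots> \<le> (\<Sum>i\<in>I. ennreal ?C * (\<integral>\<^sup>+ w \<in> ?B i. dens f w \<partial>lborel))"
    using z by (intro sum_mono wval_powr_le_integral[OF m c f]) auto
  also have "\<dots> = ennreal ?C * (\<integral>\<^sup>+ w. (\<Sum>i\<in>I. dens f w * indicator (?B i) w) \<partial>lborel)"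
  proof (subst nn_integral_sum)
    show "(\<lambda>w. dens f w * indicator (?B i) w) \<in> borel_measurable lborel" for i
      using F by (intro borel_measurable_times_ennreal borel_measurable_indicator) auto
  qed (simp add: sum_distrib_left)
  also have "\<dots> \<le> ennreal ?C * fnorm f"
    unfolding fock_norm_pow_def
  proof (intro mult_left_mono nn_integral_mono)
    fix w
    have "(\<Sum>i\<in>I. indicator (?B i) w :: ennreal) = indicator (\<Union>i\<in>I. ?B i) w"
      by (rule indicator_UN_disjoint[OF I dis, symmetric])
    also have "\<dots> \<le> 1" by (simp add: indicator_def)
    finally have "dens f w * (\<Sum>i\<in>I. indicator (?B i) w) \<le> dens f w * 1" by (intro mult_left_mono) auto
    then show "(\<Sum>i\<in>I. dens f w * indicator (?B i) w) \<le> dens f w" by (simp add: sum_distrib_left)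
  qed simp
  also have "\<dots> \<le> ennreal ?C * ennreal K" using K by (intro mult_left_mono) auto
  also have "\<dots> = ennreal (?C * K)" using C K by (simp add: ennreal_mult)
  finally show ?thesis using C K by (simp add: ennreal_le_iff)
qed

lemma wval_powr_le:
  assumes "m > 0" "f holomorphic_on UNIV" "0 \<le> K" "fnorm f \<le> ennreal K" "m \<le> cmod z"
  shows "wval f z powr p \<le> ptw_const m (1/2) * K"
  using sum_wval_powr_le[of m "1/2" f K "{0}" "\<lambda>_. z"] assms by (simp add: disjoint_family_on_def)

text \<open>The annulus where ln |z| lies between k and k + 1 has area at most a constant times e^{2
  k}, which cancels the factor |z|^2 hidden in \<open>wval\<close>. The unit disc is handled by the
  maximum principle: on |w| = 1 the potential vanishes, so |f| is bounded by M 0 there. In the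
  constant, pi is the area of the unit disc and pi * exp 4 belongs to the enclosing balls of radius
  e^{k + 2}.\<close>

lemma fnorm_le:
  assumes f: "f holomorphic_on UNIV"
    and M: "\<And>k z. z \<noteq> 0 \<Longrightarrow> real k \<le> ln (cmod z) \<Longrightarrow> ln (cmod z) \<le> real k + 1 \<Longrightarrow> wval f z \<le> M k"
    and K: "\<And>n. (\<Sum>k<n. M k powr p) \<le> K"
  shows "fnorm f \<le> ennreal ((pi + pi * exp 4) * K)"
proof -
  define A where "A k = {z::complex. z \<noteq> 0 \<and> real k \<le> ln (cmod z) \<and> ln (cmod z) \<le> real k + 1}" for k :: nat
  have A_borel [measurable]: "A k \<in> sets borel" for k unfolding A_def by measurable
  have M0: "M 0 powr p \<le> K" using K[of 1] by simp
  have emA: "emeasure lborel (A k) \<le> ennreal (pi * exp 4 * exp (2 * real k))" for k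
  proof -
    have "A k \<subseteq> ball 0 (exp (real k + 2))"
    proof
      fix z assume "z \<in> A k"
      then have "z \<noteq> 0" "ln (cmod z) < real k + 2" by (auto simp: A_def)
      then have "cmod z < exp (real k + 2)" by (metis exp_less_mono exp_ln zero_less_norm_iff)
      then show "z \<in> ball 0 (exp (real k + 2))" by simp
    qed
    then have "emeasure lborel (A k) \<le> emeasure lborel (ball (0::complex) (exp (real k + 2)))"
      by (intro emeasure_mono) auto
    also have "\<dots> = ennreal (pi * exp 4 * exp (2 * real k))"
      by (simp add: emeasure_ball_complex mult.assoc exp_double[symmetric] flip: exp_add)
    finally show ?thesis .
  qed
  have "dens f z \<le> ennreal (M 0 powr p) * indicator (ball 0 1) z
      + (\<Sum>k. ennreal (M k powr p * exp (- 2 * real k)) * indicator (A k) z)" for z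
  proof (cases "cmod z < 1")
    case True
    obtain w where w: "cmod w = 1" and fw: "cmod (f z) \<le> cmod (f w)"
      using max_modulus_circle[OF f, of 1 z] True by auto
    have "w \<noteq> 0" using w by auto
    then have "cmod (f w) \<le> M 0" using M[of w 0] w by (simp add: wval_def pot_def)
    then have fz: "cmod (f z) \<le> M 0" using fw by simp
    have "exp (- log_weight \<alpha> z) \<le> 1" using alpha_pos by (simp add: log_weight_def)
    then have "cmod (f z * complex_of_real (exp (- log_weight \<alpha> z))) \<le> M 0"
      using mult_mono[OF fz, of "exp (- log_weight \<alpha> z)" 1] fz norm_ge_zero[of "f z"] 
      by (simp add: norm_mult)
    then have "dens f z \<le> ennreal (M 0 powr p)" using p_pos by (intro ennreal_leI powr_mono2) auto
    then show ?thesis using True by (simp add: add_increasing2)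
  next
    case False
    then have z1: "cmod z \<ge> 1" by simp
    then have z0: "z \<noteq> 0" by auto
    have l0: "ln (cmod z) \<ge> 0" using z1 by simp
    define k where "k = nat \<lfloor>ln (cmod z)\<rfloor>"
    have k: "real k \<le> ln (cmod z)" "ln (cmod z) \<le> real k + 1" using l0 unfolding k_def by linarith+
    have "wval f z \<le> M k" using M z0 k by blast
    have "cmod (f z * complex_of_real (exp (- log_weight \<alpha> z))) = wval f z * exp (- 2 / p * ln (cmod z))"
      using l0 by (simp add: norm_mult wval_def log_weight_def log_plus_def pot_def mult.assoc flip: exp_add)
    also have "\<dots> \<le> M k * exp (- 2 / p * real k)"
      using \<open>wval f z \<le> M k\<close> k p_pos order_trans[OF wval_nonneg \<open>wval f z \<le> M k\<close>]
      by (intro mult_mono) (auto simp: divide_right_mono)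
    finally have "dens f z \<le> ennreal ((M k * exp (- 2 / p * real k)) powr p)"
      using p_pos by (intro ennreal_leI powr_mono2) auto
    also have "(M k * exp (- 2 / p * real k)) powr p = M k powr p * exp (- 2 * real k)"
      using p_pos by (simp add: powr_mult exp_powr_real)
    also have "ennreal (M k powr p * exp (- 2 * real k)) = ennreal (M k powr p * exp (- 2 * real k)) * indicator (A k) z"
      using z0 k by (simp add: A_def)
    also have "\<dots> \<le> (\<Sum>k. ennreal (M k powr p * exp (- 2 * real k)) * indicator (A k) z)"
      by (rule le_suminf_ennreal)
    finally show ?thesis by (simp add: add_increasing)
  qed
  note pw = this
  have "fnorm f \<le> (\<integral>\<^sup>+ z. ennreal (M 0 powr p) * indicator (ball 0 1) z
      + (\<Sum>k. ennreal (M k powr p * exp (- 2 * real k)) * indicator (A k) z) \<partial>lborel)"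
    unfolding fock_norm_pow_def by (rule nn_integral_mono) (rule pw)
  also have "\<dots> = ennreal (M 0 powr p) * emeasure lborel (ball (0::complex) 1)
      + (\<Sum>k. ennreal (M k powr p * exp (- 2 * real k)) * emeasure lborel (A k))"
  proof -
    have "(\<integral>\<^sup>+ z. ennreal (M 0 powr p) * indicator (ball (0::complex) 1) z
        + (\<Sum>k. ennreal (M k powr p * exp (- 2 * real k)) * indicator (A k) z) \<partial>lborel)
      = (\<integral>\<^sup>+ z. ennreal (M 0 powr p) * indicator (ball (0::complex) 1) z \<partial>lborel)
        + (\<integral>\<^sup>+ z. (\<Sum>k. ennreal (M k powr p * exp (- 2 * real k)) * indicator (A k) z) \<partial>lborel)"
      by (rule nn_integral_add)
        (intro borel_measurable_times_ennreal borel_measurable_indicator borel_measurable_suminf_order; simp add: A_borel)+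
    also have "(\<integral>\<^sup>+ z. (\<Sum>k. ennreal (M k powr p * exp (- 2 * real k)) * indicator (A k) z) \<partial>lborel)
      = (\<Sum>k. \<integral>\<^sup>+ z. ennreal (M k powr p * exp (- 2 * real k)) * indicator (A k) z \<partial>lborel)"
      by (rule nn_integral_suminf)
        (intro borel_measurable_times_ennreal borel_measurable_indicator; simp add: A_borel)
    finally show ?thesis by (simp add: nn_integral_cmult_indicator A_borel)
  qed
  also have "\<dots> \<le> ennreal (pi * K) + ennreal (pi * exp 4 * K)"
  proof (rule add_mono)
    show "ennreal (M 0 powr p) * emeasure lborel (ball (0::complex) 1) \<le> ennreal (pi * K)"
      using M0 by (auto simp: emeasure_ball_complex mult.commute simp flip: ennreal_mult intro!: ennreal_leI)
    show "(\<Sum>k. ennreal (M k powr p * exp (- 2 * real k)) * emeasure lborel (A k)) \<le> ennreal (pi * exp 4 * K)"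
    proof (rule suminf_le_const[OF summableI])
      fix n
      have "(\<Sum>k<n. ennreal (M k powr p * exp (- 2 * real k)) * emeasure lborel (A k))
        \<le> (\<Sum>k<n. ennreal (M k powr p * exp (- 2 * real k)) * ennreal (pi * exp 4 * exp (2 * real k)))"
        using emA by (intro sum_mono mult_left_mono) auto
      also have "\<dots> = (\<Sum>k<n. ennreal (pi * exp 4 * M k powr p))"
        by (intro sum.cong refl) (simp add: exp_minus mult_ac flip: ennreal_mult)
      also have "\<dots> = ennreal (pi * exp 4 * (\<Sum>k<n. M k powr p))"
        by (simp add: sum_distrib_left)
      also have "\<dots> \<le> ennreal (pi * exp 4 * K)" using K by (intro ennreal_leI mult_left_mono) auto
      finally show "(\<Sum>k<n. ennreal (M k powr p * exp (- 2 * real k)) * emeasure lborel (A k)) \<le> ennreal (pi * exp 4 * K)" .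
    qed
  qed
  also have "\<dots> = ennreal ((pi + pi * exp 4) * K)"
    using order_trans[OF _ M0] by (simp add: algebra_simps flip: ennreal_plus)
  finally show ?thesis .
qed

end

section \<open>Sampling and interpolation along a sequence of points\<close>

text \<open>A scale-invariant form of separation. It agrees with the one for \<open>d_rho\<close>
  when the points stay away from 0.\<close>

definition rel_separated :: "(nat \<Rightarrow> complex) \<Rightarrow> bool"
  where "rel_separated \<sigma> \<longleftrightarrow>
    (\<exists>c>0. \<forall>m n. m \<noteq> n \<longrightarrow> c * max (cmod (\<sigma> m)) (cmod (\<sigma> n)) \<le> cmod (\<sigma> m - \<sigma> n))"

locale fock_seq = small_fock +
  fixes \<sigma> :: "nat \<Rightarrow> complex"
  assumes inj_sigma: "inj \<sigma>" and mono_norm: "\<And>n. cmod (\<sigma> n) \<le> cmod (\<sigma> (Suc n))"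
    and sigma_nonzero: "\<And>n. \<sigma> n \<noteq> 0"
begin

abbreviation "snorm \<equiv> seq_norm_pow p (log_weight \<alpha>) (range \<sigma>)"

definition tau :: "nat \<Rightarrow> real" where "tau n = ln (cmod (\<sigma> n))"

definition h :: real where "h = 1 / (2 * \<alpha>)"

definition node :: "nat \<Rightarrow> real" where "node n = h * (real n + 2 / p)"

definition dev :: "nat \<Rightarrow> real" where "dev n = tau n - node n"

text \<open>Membership in the weighted sequence space with the p-th power of the norm at most K, as
  a statement about finite real sums. The weight is \<open>pot\<close> along the sequence,
  comparable with the original one by \<open>weight_term_cmp\<close>.\<close>

definition ssum_le :: "(nat \<Rightarrow> complex) \<Rightarrow> real \<Rightarrow> bool"
  where "ssum_le v K \<longleftrightarrow> (\<forall>F. finite F \<longrightarrow> (\<Sum>n\<in>F. (cmod (v n) * exp (- pot (tau n))) powr p) \<le> K)"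

lemma h_pos: "h > 0" using alpha_pos by (simp add: h_def)

lemma norm_sigma: "cmod (\<sigma> n) = exp (tau n)"
  using sigma_nonzero[of n] by (simp add: tau_def)

lemma norm_sigma_mono: "m \<le> n \<Longrightarrow> cmod (\<sigma> m) \<le> cmod (\<sigma> n)"
  using mono_norm by (rule lift_Suc_mono_le)

lemma tau_mono: "m \<le> n \<Longrightarrow> tau m \<le> tau n"
  using norm_sigma_mono[of m n] by (simp add: norm_sigma)

lemma mono_tau: "mono tau" by (simp add: mono_def tau_mono)

lemma ssum_le_nonneg: "ssum_le v K \<Longrightarrow> K \<ge> 0"
  unfolding ssum_le_def by (drule spec[of _ "{}"]) simp

text \<open>No point is closer to 0 than the one with index 0. Hence 1 + |s| is comparable with |s|,
  the first factor of C, and replacing the positive part of ln |s| by ln |s| changes only points of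
  the unit disc, by at most the second factor.\<close>

lemma weight_term_cmp:
  "\<exists>C\<ge>1. \<forall>n x. (cmod x * exp (- pot (tau n))) powr p
      \<le> (1 + cmod (\<sigma> n))\<^sup>2 * cmod x powr p * exp (- (p * log_weight \<alpha> (\<sigma> n))) \<and>
    (1 + cmod (\<sigma> n))\<^sup>2 * cmod x powr p * exp (- (p * log_weight \<alpha> (\<sigma> n)))
      \<le> C * (cmod x * exp (- pot (tau n))) powr p"
proof -
  define C where "C = (1 + exp (- tau 0))\<^sup>2 * exp (p * \<alpha> * (tau 0)\<^sup>2)"
  have C1: "C \<ge> 1"
  proof -
    have "1 * 1 \<le> C" unfolding C_def using p_pos alpha_pos
      by (intro mult_mono) (auto intro: one_le_power)
    then show ?thesis by simp
  qed
  have main: "(cmod x * exp (- pot (tau n))) powr p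
      \<le> (1 + cmod (\<sigma> n))\<^sup>2 * cmod x powr p * exp (- (p * log_weight \<alpha> (\<sigma> n))) \<and>
    (1 + cmod (\<sigma> n))\<^sup>2 * cmod x powr p * exp (- (p * log_weight \<alpha> (\<sigma> n)))
      \<le> C * (cmod x * exp (- pot (tau n))) powr p" for n x
  proof -
    define w where "w = cmod x powr p * ((cmod (\<sigma> n))\<^sup>2 * exp (- (p * \<alpha> * (tau n)\<^sup>2)))"
    define A where "A = (1 + cmod (\<sigma> n))\<^sup>2 * exp (- (p * log_weight \<alpha> (\<sigma> n)))"
    have w: "(cmod x * exp (- pot (tau n))) powr p = w"
    proof -
      have "exp (- pot (tau n)) powr p = exp (2 * tau n + - (p * \<alpha> * (tau n)\<^sup>2))"
        using p_pos by (simp add: exp_powr_real pot_def algebra_simps)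
      also have "\<dots> = (cmod (\<sigma> n))\<^sup>2 * exp (- (p * \<alpha> * (tau n)\<^sup>2))"
        by (simp only: exp_add exp_double norm_sigma)
      finally show ?thesis by (simp add: powr_mult w_def)
    qed
    have lw: "log_weight \<alpha> (\<sigma> n) = \<alpha> * (max (tau n) 0)\<^sup>2" by (simp add: log_weight_def log_plus_def tau_def)
    have sq: "(max (tau n) 0)\<^sup>2 \<le> (tau n)\<^sup>2" "(tau n)\<^sup>2 \<le> (max (tau n) 0)\<^sup>2 + (tau 0)\<^sup>2"
    proof -
      show "(max (tau n) 0)\<^sup>2 \<le> (tau n)\<^sup>2" by (auto simp: max_def)
      show "(tau n)\<^sup>2 \<le> (max (tau n) 0)\<^sup>2 + (tau 0)\<^sup>2"
      proof (cases "tau n \<ge> 0")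
        case False
        then have "\<bar>tau n\<bar> \<le> \<bar>tau 0\<bar>" using tau_mono[of 0 n] by simp
        then show ?thesis by (metis abs_le_square_iff le_add_same_cancel2 order_trans zero_le_power2 add_increasing)
      qed simp
    qed
    have e1: "exp (- (p * \<alpha> * (tau n)\<^sup>2)) \<le> exp (- (p * log_weight \<alpha> (\<sigma> n)))"
      using sq(1) p_pos alpha_pos by (simp add: lw)
    have "p * \<alpha> * (tau n)\<^sup>2 \<le> p * \<alpha> * ((max (tau n) 0)\<^sup>2 + (tau 0)\<^sup>2)"
      using sq(2) p_pos alpha_pos by (intro mult_left_mono) auto
    then have e2: "exp (- (p * log_weight \<alpha> (\<sigma> n))) \<le> exp (p * \<alpha> * (tau 0)\<^sup>2) * exp (- (p * \<alpha> * (tau n)\<^sup>2))"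
      by (simp add: lw algebra_simps flip: exp_add)
    have q1: "(cmod (\<sigma> n))\<^sup>2 \<le> (1 + cmod (\<sigma> n))\<^sup>2" by (intro power_mono) auto
    have q2: "(1 + cmod (\<sigma> n))\<^sup>2 \<le> (1 + exp (- tau 0))\<^sup>2 * (cmod (\<sigma> n))\<^sup>2"
    proof -
      have "1 \<le> exp (- tau 0) * cmod (\<sigma> n)" using tau_mono[of 0 n] by (simp add: norm_sigma flip: exp_add)
      then have "(1 + cmod (\<sigma> n))\<^sup>2 \<le> ((1 + exp (- tau 0)) * cmod (\<sigma> n))\<^sup>2"
        by (intro power_mono) (auto simp: algebra_simps)
      then show ?thesis by (simp add: power_mult_distrib)
    qed
    have A1: "(cmod (\<sigma> n))\<^sup>2 * exp (- (p * \<alpha> * (tau n)\<^sup>2)) \<le> A"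
      unfolding A_def using q1 e1 by (intro mult_mono) auto
    have "A \<le> ((1 + exp (- tau 0))\<^sup>2 * (cmod (\<sigma> n))\<^sup>2) * (exp (p * \<alpha> * (tau 0)\<^sup>2) * exp (- (p * \<alpha> * (tau n)\<^sup>2)))"
      unfolding A_def using q2 e2 by (intro mult_mono) auto
    then have A2: "A \<le> C * ((cmod (\<sigma> n))\<^sup>2 * exp (- (p * \<alpha> * (tau n)\<^sup>2)))"
      by (simp add: C_def mult_ac)
    have 1: "cmod x powr p * A \<le> cmod x powr p * (C * ((cmod (\<sigma> n))\<^sup>2 * exp (- (p * \<alpha> * (tau n)\<^sup>2))))"
      using A2 by (intro mult_left_mono) auto
    have 2: "w \<le> cmod x powr p * A" unfolding w_def using A1 by (intro mult_left_mono) auto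
    have 3: "(1 + cmod (\<sigma> n))\<^sup>2 * cmod x powr p * exp (- (p * log_weight \<alpha> (\<sigma> n))) = cmod x powr p * A"
      by (simp add: A_def)
    have 4: "C * w = cmod x powr p * (C * ((cmod (\<sigma> n))\<^sup>2 * exp (- (p * \<alpha> * (tau n)\<^sup>2))))"
      by (simp add: w_def mult_ac)
    show ?thesis unfolding w 3 4 using 1 2 by (intro conjI)
  qed
  show ?thesis using C1 main by blast
qed

lemma seq_norm_pow_range:
  "snorm v =
    (\<Sum>\<^sub>\<infinity>n. ennreal ((1 + cmod (\<sigma> n))\<^sup>2 * cmod (v (\<sigma> n)) powr p * exp (- (p * log_weight \<alpha> (\<sigma> n)))))"
  unfolding seq_norm_pow_def by (subst infsum_reindex[OF inj_sigma]) (simp add: o_def)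

lemma ssum_le_of_seq_norm:
  assumes "snorm v \<le> ennreal K" "K \<ge> 0"
  shows "ssum_le (\<lambda>n. v (\<sigma> n)) K"
  unfolding ssum_le_def
proof (intro allI impI)
  fix F :: "nat set" assume F: "finite F"
  let ?g = "\<lambda>n. (1 + cmod (\<sigma> n))\<^sup>2 * cmod (v (\<sigma> n)) powr p * exp (- (p * log_weight \<alpha> (\<sigma> n)))"
  have "ennreal (\<Sum>n\<in>F. (cmod (v (\<sigma> n)) * exp (- pot (tau n))) powr p) \<le> ennreal (\<Sum>n\<in>F. ?g n)"
    using weight_term_cmp by (intro ennreal_leI sum_mono) blast
  also have "\<dots> = (\<Sum>n\<in>F. ennreal (?g n))" by (rule sum_ennreal[symmetric]) auto
  also have "\<dots> \<le> (\<Sum>\<^sub>\<infinity>n. ennreal (?g n))"     using F by (subst nonneg_infsum_complete) (auto intro!: Sup_upper)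
  also have "\<dots> \<le> ennreal K" using assms(1) by (simp add: seq_norm_pow_range)
  finally show "(\<Sum>n\<in>F. (cmod (v (\<sigma> n)) * exp (- pot (tau n))) powr p) \<le> K"
    using assms(2) by (simp add: ennreal_le_iff)
qed

lemma seq_norm_of_ssum_le:
  "\<exists>C\<ge>1. \<forall>v K. ssum_le (\<lambda>n. v (\<sigma> n)) K \<longrightarrow> snorm v \<le> ennreal (C * K)"
proof -
  obtain C where C: "C \<ge> 1" and le: "\<And>n x. (1 + cmod (\<sigma> n))\<^sup>2 * cmod x powr p * exp (- (p * log_weight \<alpha> (\<sigma> n)))
      \<le> C * (cmod x * exp (- pot (tau n))) powr p"
    using weight_term_cmp by blast
  have "snorm v \<le> ennreal (C * K)" if K: "ssum_le (\<lambda>n. v (\<sigma> n)) K" for v K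
    unfolding seq_norm_pow_range
  proof (rule infsum_le_finite_sums)
    let ?g = "\<lambda>n. (1 + cmod (\<sigma> n))\<^sup>2 * cmod (v (\<sigma> n)) powr p * exp (- (p * log_weight \<alpha> (\<sigma> n)))"
    fix F :: "nat set" assume F: "finite F"
    have "(\<Sum>n\<in>F. ennreal (?g n)) = ennreal (\<Sum>n\<in>F. ?g n)" by (rule sum_ennreal) auto
    also have "\<dots> \<le> ennreal (\<Sum>n\<in>F. C * (cmod (v (\<sigma> n)) * exp (- pot (tau n))) powr p)"
      using le by (intro ennreal_leI sum_mono) auto
    also have "\<dots> \<le> ennreal (C * K)" 
      using K F C unfolding ssum_le_def sum_distrib_left[symmetric] by (intro ennreal_leI mult_left_mono) auto
    finally show "(\<Sum>n\<in>F. ennreal (?g n)) \<le> ennreal (C * K)" .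
  qed (rule nonneg_summable_on_complete, simp)
  with C show ?thesis by blast
qed

lemma sampling_imp:
  assumes "sampling p (log_weight \<alpha>) (range \<sigma>)"
  shows "\<exists>C>0. \<forall>f K. f \<in> fspace \<longrightarrow> K \<ge> 0 \<longrightarrow>
    (fnorm f \<le> ennreal K \<longrightarrow> ssum_le (\<lambda>n. f (\<sigma> n)) (C * K)) \<and>
    (ssum_le (\<lambda>n. f (\<sigma> n)) K \<longrightarrow> fnorm f \<le> ennreal (C * K))"
proof -
  obtain C0 where C0: "C0 \<ge> 1" and s: "\<And>f. f \<in> fspace \<Longrightarrow>
       ennreal (1 / C0) * fnorm f \<le> snorm f \<and>
       snorm f \<le> ennreal C0 * fnorm f"
    using assms unfolding sampling_def by blast
  obtain C1 where C1: "C1 \<ge> 1" and c1: "\<And>v K. ssum_le (\<lambda>n. v (\<sigma> n)) K \<Longrightarrow> snorm v \<le> ennreal (C1 * K)"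
    using seq_norm_of_ssum_le by blast
  have A: "ssum_le (\<lambda>n. f (\<sigma> n)) (C0 * C1 * K)" if f: "f \<in> fspace" "K \<ge> 0" "fnorm f \<le> ennreal K" for f K
  proof -
    have "snorm f \<le> ennreal C0 * fnorm f" using s f by blast
    also have "\<dots> \<le> ennreal C0 * ennreal K" using f by (intro mult_left_mono) auto
    also have "\<dots> = ennreal (C0 * K)" using C0 f by (simp add: ennreal_mult)
    also have "\<dots> \<le> ennreal (C0 * C1 * K)" using C0 C1 f mult_right_mono[of 1 C1 "C0 * K"]
      by (intro ennreal_leI) (simp add: mult_ac)
    finally show ?thesis using C0 C1 f by (intro ssum_le_of_seq_norm) auto
  qed
  have B: "fnorm f \<le> ennreal (C0 * C1 * K)" if f: "f \<in> fspace" "K \<ge> 0" "ssum_le (\<lambda>n. f (\<sigma> n)) K" for f K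
  proof -
    have "fnorm f = ennreal C0 * (ennreal (1 / C0) * fnorm f)"
      using C0 by (simp add: mult.assoc[symmetric] ennreal_mult[symmetric])
    also have "\<dots> \<le> ennreal C0 * snorm f"
      using s f by (intro mult_left_mono) auto
    also have "\<dots> \<le> ennreal C0 * ennreal (C1 * K)" using c1[OF f(3)] by (intro mult_left_mono) auto
    also have "\<dots> = ennreal (C0 * C1 * K)" using C0 C1 f by (simp add: ennreal_mult[symmetric] mult.assoc)
    finally show ?thesis .
  qed
  show ?thesis using A B C0 C1 by (intro exI[of _ "C0 * C1"]) auto
qed

lemma samplingI:
  assumes C: "C > 0"
    and up: "\<And>f K. f \<in> fspace \<Longrightarrow> K \<ge> 0 \<Longrightarrow> fnorm f \<le> ennreal K \<Longrightarrow> ssum_le (\<lambda>n. f (\<sigma> n)) (C * K)"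
    and low: "\<And>f K. f \<in> fspace \<Longrightarrow> K \<ge> 0 \<Longrightarrow> ssum_le (\<lambda>n. f (\<sigma> n)) K \<Longrightarrow> fnorm f \<le> ennreal (C * K)"
  shows "sampling p (log_weight \<alpha>) (range \<sigma>)"
proof -
  obtain C1 where C1: "C1 \<ge> 1" and c1: "\<And>v K. ssum_le (\<lambda>n. v (\<sigma> n)) K \<Longrightarrow> snorm v \<le> ennreal (C1 * K)"
    using seq_norm_of_ssum_le by blast
  define C' where "C' = max 1 (C * C1)"
  have C': "C' \<ge> 1" "C \<le> C'" "C * C1 \<le> C'"   proof -
    have "C \<le> C * C1" using C C1 by simp
    then show "C' \<ge> 1" "C \<le> C'" "C * C1 \<le> C'" unfolding C'_def by linarith+
  qed
  show ?thesis unfolding sampling_def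
  proof (intro exI[of _ C'] conjI ballI C'(1))
    fix f assume f: "f \<in> fspace"
    let ?s = "snorm f"
    have "fnorm f < \<infinity>" using f by (simp add: fock_space_def)
    then obtain K where K: "K \<ge> 0" "fnorm f = ennreal K" by (cases "fnorm f") auto
    have "?s \<le> ennreal (C1 * (C * K))" using up[OF f K(1)] K by (intro c1) auto
    also have "\<dots> \<le> ennreal (C' * K)" using C'(3) K(1) mult_right_mono[OF C'(3) K(1)] by (intro ennreal_leI) (simp add: mult_ac)
    also have "\<dots> = ennreal C' * fnorm f" using K C' by (simp add: ennreal_mult)
    finally show "?s \<le> ennreal C' * fnorm f" .
    show "ennreal (1 / C') * fnorm f \<le> ?s"
    proof (cases ?s)
      case (real K')
      then have "ssum_le (\<lambda>n. f (\<sigma> n)) K'" by (intro ssum_le_of_seq_norm) auto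
      then have "fnorm f \<le> ennreal (C * K')" using low[OF f] real by auto
      also have "\<dots> \<le> ennreal (C' * K')" using C'(2) real by (intro ennreal_leI mult_right_mono) auto
      finally have "ennreal (1 / C') * fnorm f \<le> ennreal (1 / C') * ennreal (C' * K')" by (intro mult_left_mono) auto
      also have "\<dots> = ennreal K'" using C' real by (subst ennreal_mult[symmetric]) auto
      finally show ?thesis using real by simp
    qed (auto simp: top_greatest)
  qed
qed

lemma interpolating_iff:
  "interpolating p (log_weight \<alpha>) (range \<sigma>) \<longleftrightarrow>
    (\<forall>v K. ssum_le v K \<longrightarrow> (\<exists>f\<in>fspace. \<forall>n. f (\<sigma> n) = v n))"
proof
  assume int: "interpolating p (log_weight \<alpha>) (range \<sigma>)"
  obtain C1 where c1: "\<And>v K. ssum_le (\<lambda>n. v (\<sigma> n)) K \<Longrightarrow> snorm v \<le> ennreal (C1 * K)"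
    using seq_norm_of_ssum_le by blast
  show "\<forall>v K. ssum_le v K \<longrightarrow> (\<exists>f\<in>fspace. \<forall>n. f (\<sigma> n) = v n)"
  proof (intro allI impI)
    fix v K assume v: "ssum_le v K"
    define v' where "v' = (\<lambda>s. v (inv \<sigma> s))"
    have v': "v' (\<sigma> n) = v n" for n by (simp add: v'_def inj_sigma)
    have "snorm v' \<le> ennreal (C1 * K)" using v by (intro c1) (simp add: v')
    then have "snorm v' < \<infinity>" by (auto intro: le_less_trans)
    then obtain f where "f \<in> fspace" "\<forall>s\<in>range \<sigma>. f s = v' s"
      using int unfolding interpolating_def by blast
    then show "\<exists>f\<in>fspace. \<forall>n. f (\<sigma> n) = v n" using v' by auto
  qed
next
  assume R: "\<forall>v K. ssum_le v K \<longrightarrow> (\<exists>f\<in>fspace. \<forall>n. f (\<sigma> n) = v n)"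
  show "interpolating p (log_weight \<alpha>) (range \<sigma>)" unfolding interpolating_def
  proof (intro allI impI)
    fix v assume v: "snorm v < \<infinity>"
    then obtain K where K: "K \<ge> 0" "snorm v = ennreal K"
      by (cases "snorm v") auto
    then have "ssum_le (\<lambda>n. v (\<sigma> n)) K" by (intro ssum_le_of_seq_norm) auto
    from R[rule_format, OF this] obtain f where "f \<in> fspace" "\<forall>n. f (\<sigma> n) = v (\<sigma> n)"
      by blast
    then show "\<exists>f\<in>fspace. \<forall>s\<in>range \<sigma>. f s = v s" by auto
  qed
qed

text \<open>The two notions differ by the summand 1 and by min against max. If the moduli of two
  points differ by a factor of at least 2, their distance is at least half the larger modulus
  anyway; otherwise max is at most twice min. The summand 1 is harmless because the moduli are
  bounded below.\<close>

lemma d_rho_separated_iff: "d_rho_separated \<alpha> (range \<sigma>) \<longleftrightarrow> rel_separated \<sigma>"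
proof
  define b where "b = sqrt (2 * \<alpha>)"
  have b: "b > 0" using alpha_pos by (simp add: b_def)
  assume "d_rho_separated \<alpha> (range \<sigma>)"
  then have "ereal 0 < Inf {ereal (d_rho \<alpha> s s') | s s'. s \<in> range \<sigma> \<and> s' \<in> range \<sigma> \<and> s \<noteq> s'}"
    by (simp add: d_rho_separated_def zero_ereal_def)
  then obtain c where c: "ereal 0 < ereal c" "ereal c < Inf {ereal (d_rho \<alpha> s s') | s s'. s \<in> range \<sigma> \<and> s' \<in> range \<sigma> \<and> s \<noteq> s'}"
    using ereal_dense2 by blast
  have sep: "c * (min (cmod (\<sigma> m)) (cmod (\<sigma> n)) / b) \<le> cmod (\<sigma> m - \<sigma> n)" if "m \<noteq> n" for m n
  proof -
    have "\<sigma> m \<noteq> \<sigma> n" using that inj_sigma by (auto dest: injD)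
    then have "ereal c \<le> ereal (d_rho \<alpha> (\<sigma> m) (\<sigma> n))"
      using c(2) by (intro order_trans[OF less_imp_le[OF c(2)]] Inf_lower) blast
    then have "c \<le> cmod (\<sigma> m - \<sigma> n) / (1 + min (rho \<alpha> (\<sigma> m)) (rho \<alpha> (\<sigma> n)))" by (simp add: d_rho_def)
    moreover have "min (rho \<alpha> (\<sigma> m)) (rho \<alpha> (\<sigma> n)) = min (cmod (\<sigma> m)) (cmod (\<sigma> n)) / b"
      using b by (simp add: rho_def b_def min_divide_distrib_right)
    moreover have "min (cmod (\<sigma> m)) (cmod (\<sigma> n)) / b \<ge> 0" using b by simp
    ultimately have "c * (1 + min (cmod (\<sigma> m)) (cmod (\<sigma> n)) / b) \<le> cmod (\<sigma> m - \<sigma> n)"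
      by (simp add: pos_le_divide_eq)
    then show ?thesis using c(1) by (simp add: algebra_simps)
  qed
  define c' where "c' = min (1/2) (c / (2 * b))"
  have c': "c' > 0" "c' \<le> 1/2" "2 * c' \<le> c / b" using c(1) b by (auto simp: c'_def min_def field_simps)
  have "c' * max (cmod (\<sigma> m)) (cmod (\<sigma> n)) \<le> cmod (\<sigma> m - \<sigma> n)" if "m \<noteq> n" for m n
  proof -
    define x where "x = max (cmod (\<sigma> m)) (cmod (\<sigma> n))"
    define y where "y = min (cmod (\<sigma> m)) (cmod (\<sigma> n))"
    have xy: "y \<ge> 0" "x \<ge> 0" by (simp_all add: x_def y_def le_max_iff_disj)
    have d: "x - y \<le> cmod (\<sigma> m - \<sigma> n)"
      using norm_triangle_ineq2[of "\<sigma> m" "\<sigma> n"] norm_triangle_ineq2[of "\<sigma> n" "\<sigma> m"]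
      by (auto simp: x_def y_def norm_minus_commute)
    show ?thesis
    proof (cases "x \<ge> 2 * y")
      case True
      have "c' * x \<le> 1/2 * x" using c' xy by (intro mult_right_mono) auto
      then show ?thesis using True d unfolding x_def[symmetric] by linarith
    next
      case False
      have "c' * x \<le> c' * (2 * y)" using False c' by (intro mult_left_mono) auto
      also have "\<dots> = (2 * c') * y" by simp
      also have "\<dots> \<le> (c / b) * y" using c' xy by (intro mult_right_mono) auto
      also have "\<dots> \<le> cmod (\<sigma> m - \<sigma> n)" using sep[OF that] by (simp add: y_def)
      finally show ?thesis unfolding x_def .
    qed
  qed
  then show "rel_separated \<sigma>" using c'(1) unfolding rel_separated_def by blast
next
  assume "rel_separated \<sigma>"
  then obtain c where c: "c > 0" "\<And>m n. m \<noteq> n \<Longrightarrow> c * max (cmod (\<sigma> m)) (cmod (\<sigma> n)) \<le> cmod (\<sigma> m - \<sigma> n)"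
    unfolding rel_separated_def by blast
  define b where "b = sqrt (2 * \<alpha>)"
  have b: "b > 0" using alpha_pos by (simp add: b_def)
  define \<mu> where "\<mu> = cmod (\<sigma> 0)"
  have mu: "\<mu> > 0" using sigma_nonzero by (simp add: \<mu>_def)
  \<comment> \<open>The function c * y / (1 + y / b) increases in y; this is its value at the
    smallest modulus.\<close>
  define c2 where "c2 = c * \<mu> / (1 + \<mu> / b)"
  have c2: "c2 > 0" using c mu b by (simp add: c2_def add_pos_pos)
  have "ereal c2 \<le> ereal (d_rho \<alpha> (\<sigma> m) (\<sigma> n))" if "m \<noteq> n" for m n
  proof -
    define y where "y = min (cmod (\<sigma> m)) (cmod (\<sigma> n))"
    have y: "y \<ge> \<mu>" using norm_sigma_mono[of 0] by (simp add: y_def \<mu>_def)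
    have "c2 \<le> c * y / (1 + y / b)"
    proof -
      have "\<mu> * (1 + y / b) \<le> y * (1 + \<mu> / b)" using y by (simp add: algebra_simps)
      then have "\<mu> / (1 + \<mu> / b) \<le> y / (1 + y / b)" using mu b y
        by (simp add: pos_divide_le_eq pos_le_divide_eq add_pos_nonneg)
      then have "c * (\<mu> / (1 + \<mu> / b)) \<le> c * (y / (1 + y / b))" using c(1) by (intro mult_left_mono) auto
      then show ?thesis by (simp add: c2_def)
    qed
    also have "\<dots> \<le> cmod (\<sigma> m - \<sigma> n) / (1 + y / b)"
    proof -
      have "c * y \<le> c * max (cmod (\<sigma> m)) (cmod (\<sigma> n))" using c(1) by (intro mult_left_mono) (auto simp: y_def)
      also have "\<dots> \<le> cmod (\<sigma> m - \<sigma> n)" by (rule c(2)[OF that])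
      finally show ?thesis using mu y b by (intro divide_right_mono) auto
    qed
    also have "\<dots> = d_rho \<alpha> (\<sigma> m) (\<sigma> n)"
      using b by (simp add: d_rho_def rho_def b_def y_def min_divide_distrib_right)
    finally show ?thesis by simp
  qed
  note * = this
  have "ereal c2 \<le> Inf {ereal (d_rho \<alpha> s s') | s s'. s \<in> range \<sigma> \<and> s' \<in> range \<sigma> \<and> s \<noteq> s'}"
  proof (rule Inf_greatest)
    fix x assume "x \<in> {ereal (d_rho \<alpha> s s') | s s'. s \<in> range \<sigma> \<and> s' \<in> range \<sigma> \<and> s \<noteq> s'}"
    then obtain m n where "x = ereal (d_rho \<alpha> (\<sigma> m) (\<sigma> n))" "\<sigma> m \<noteq> \<sigma> n" by auto
    with *[of m n] show "ereal c2 \<le> x" by auto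
  qed
  moreover have "0 < ereal c2" using c2 by simp
  ultimately show "d_rho_separated \<alpha> (range \<sigma>)" unfolding d_rho_separated_def by (rule less_le_trans[rotated])
qed

end

section \<open>Sufficiency: Lagrange interpolation by polynomials\<close>

context small_fock
begin

lemma wval_le_of_fnorm:
  assumes "m > 0" "f holomorphic_on UNIV" "0 \<le> K" "fnorm f \<le> ennreal K" "m \<le> cmod z"
  shows "wval f z \<le> (ptw_const m (1/2) * K) powr (1 / p)"
proof -
  have "wval f z = (wval f z powr p) powr (1 / p)" using p_pos by (simp add: powr_powr)
  also have "\<dots> \<le> (ptw_const m (1/2) * K) powr (1 / p)"
    using wval_powr_le[OF assms] p_pos by (intro powr_mono2) auto
  finally show ?thesis .
qed

lemma fock_space_diff:
  assumes "f \<in> fspace" "g \<in> fspace"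
  shows "(\<lambda>z. f z - g z) \<in> fspace"
proof -
    have hol: "f holomorphic_on UNIV" "g holomorphic_on UNIV" using assms by (auto simp: fock_space_def)
  have "dens (\<lambda>z. f z - g z) z \<le> ennreal (2 powr p) * (dens f z + dens g z)" for z
  proof -
    define x where "x = cmod (f z * complex_of_real (exp (- log_weight \<alpha> z)))"
    define y where "y = cmod (g z * complex_of_real (exp (- log_weight \<alpha> z)))"
    have xy: "x \<ge> 0" "y \<ge> 0" by (auto simp: x_def y_def)
    have "cmod ((f z - g z) * complex_of_real (exp (- log_weight \<alpha> z))) \<le> x + y"
      unfolding x_def y_def left_diff_distrib by (rule norm_triangle_ineq4)
    also have "\<dots> \<le> 2 * max x y" by simp
    finally have "cmod ((f z - g z) * complex_of_real (exp (- log_weight \<alpha> z))) powr p \<le> (2 * max x y) powr p"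
      using p_pos by (intro powr_mono2) auto
    also have "\<dots> = 2 powr p * max x y powr p" using xy by (simp add: powr_mult le_max_iff_disj)
    also have "\<dots> \<le> 2 powr p * (x powr p + y powr p)" by (intro mult_left_mono) (auto simp: max_def)
    finally show ?thesis unfolding x_def y_def
      by (simp add: ennreal_leI flip: ennreal_mult ennreal_plus)
  qed
  then have "fnorm (\<lambda>z. f z - g z) \<le> (\<integral>\<^sup>+ z. ennreal (2 powr p) * (dens f z + dens g z) \<partial>lborel)"
    unfolding fock_norm_pow_def by (intro nn_integral_mono)
  also have "\<dots> = ennreal (2 powr p) * (fnorm f + fnorm g)"
    unfolding fock_norm_pow_def
    using fock_integrand_measurable[OF hol(1)] fock_integrand_measurable[OF hol(2)]
    by (subst nn_integral_cmult) (auto simp: nn_integral_add)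
  also have "\<dots> < \<infinity>" using assms by (auto simp: fock_space_def ennreal_mult_less_top)
  finally show ?thesis using hol by (auto simp: fock_space_def intro!: holomorphic_intros)
qed

end

context fock_seq
begin

lemma alpha_node: "2 * \<alpha> * node n = real n + 2 / p"
  using alpha_pos by (simp add: node_def h_def)

lemma linear_minus_pot: "real n * t - pot t = \<alpha> * (node n)\<^sup>2 - \<alpha> * (t - node n)\<^sup>2"
proof -
  have "real n * t - pot t = (real n + 2 / p) * t - \<alpha> * t\<^sup>2" by (simp add: pot_def algebra_simps)
  also have "\<dots> = \<alpha> * (node n)\<^sup>2 - \<alpha> * (t - node n)\<^sup>2"
    unfolding alpha_node[symmetric] by (simp add: power2_eq_square algebra_simps)
  finally show ?thesis .
qed

text \<open>\<open>level k\<close> is the logarithm, up to a bounded error, of the weighted size of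
  \<open>\<Prod>j<k. (z / \<sigma>\<^sub>j - 1)\<close> on circles near \<open>|\<sigma>\<^sub>k|\<close>.\<close>

definition level :: "nat \<Rightarrow> real" where "level k = \<alpha> * (node k)\<^sup>2 - (\<Sum>j<k. tau j)"

text \<open>The quadratic terms of the Gaussian peak and of the sum of the nodes cancel. There
  remains a slope h / 2 and the partial sums of the deviations, so the drift condition with h / 2
  says precisely that \<open>level\<close> has average slope strictly between 0 and h.\<close>

lemma level_eq: "level k = h / 2 * (real k + (2 / p)\<^sup>2) - (\<Sum>j<k. dev j)"
proof -
  have ah: "\<alpha> * h = 1 / 2" using alpha_pos by (simp add: h_def)
  define q where "q = 2 / p"
  have "2 * (\<Sum>j<k. node j) = h * (real k * (real k - 1)) + 2 * (h * q * real k)"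
    by (induction k) (auto simp: node_def q_def[symmetric] algebra_simps)
  then have "(\<Sum>j<k. node j) = h / 2 * (real k * (real k - 1)) + h * q * real k" by simp
  moreover have "\<alpha> * (node k)\<^sup>2 = (\<alpha> * h) * h * (real k + q)\<^sup>2"
    by (simp add: node_def q_def power2_eq_square)
  ultimately have "\<alpha> * (node k)\<^sup>2 - (\<Sum>j<k. node j) = h / 2 * (real k + q\<^sup>2)"
    unfolding ah by (simp add: power2_eq_square field_simps)
  moreover have "(\<Sum>j<k. tau j) = (\<Sum>j<k. node j) + (\<Sum>j<k. dev j)"
    by (simp add: dev_def sum_subtractf)
  ultimately show ?thesis by (simp add: level_def q_def)
qed

lemma node_diff: "node j - node n = h * (real j - real n)"
  by (simp add: node_def algebra_simps)

lemma lin_growth_tau: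
  assumes "\<And>n. \<bar>dev n\<bar> \<le> B"
  shows "lin_growth h (2 * B) tau"
proof -
  have "h * (real j - real n) - 2 * B \<le> tau j - tau n" for n j
    using node_diff[of j n] assms[of j] assms[of n] unfolding dev_def by linarith
  then show ?thesis using h_pos mono_tau by (simp add: lin_growth_def)
qed

text \<open>The summand ln 2 keeps the prescribed zeros inside half the radius, and the sum of
  |\<sigma>_j| / e^T becomes an error sum of the kind bounded by A.\<close>

lemma max_modulus_on_sequence:
  assumes A: "\<And>t F. finite F \<Longrightarrow> (\<Sum>j\<in>F. exp (- 1 * \<bar>t - tau j\<bar>)) \<le> A"
    and I: "finite I" and hol: "f holomorphic_on UNIV" and zero: "\<And>j. j \<in> I \<Longrightarrow> f (\<sigma> j) = 0"
    and T: "\<And>j. j \<in> I \<Longrightarrow> tau j + ln 2 \<le> T" and z: "cmod z \<le> exp T"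
  shows "\<exists>w. cmod w = exp T \<and>
    cmod (f z) * exp (real (card I) * T) \<le> exp (2 * A) * (\<Prod>j\<in>I. cmod (z - \<sigma> j)) * cmod (f w)"
proof -
  have inj: "inj_on \<sigma> I" using inj_sigma by (rule inj_on_subset) simp
  have small: "2 * cmod a \<le> exp T" if a: "a \<in> \<sigma> ` I" for a
  proof -
    obtain j where j: "j \<in> I" "a = \<sigma> j" using a by auto
    have "2 * cmod (\<sigma> j) = exp (tau j + ln 2)" by (simp add: norm_sigma exp_add)
    also have "\<dots> \<le> exp T" using T j by simp
    finally show ?thesis by (simp add: j)
  qed
  obtain w where w: "cmod w = exp T" and mm: "cmod (f z) * exp T ^ card (\<sigma> ` I)
      \<le> exp (2 * (\<Sum>a\<in>\<sigma> ` I. cmod a / exp T)) * (\<Prod>a\<in>\<sigma> ` I. cmod (z - a)) * cmod (f w)"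
    using max_modulus_zeros[OF hol, of "\<sigma> ` I" "exp T" z] I zero small z by auto
  have "(\<Sum>a\<in>\<sigma> ` I. cmod a / exp T) = (\<Sum>j\<in>I. exp (- 1 * \<bar>T - tau j\<bar>))"
    unfolding sum.reindex[OF inj]
  proof (rule sum.cong[OF refl])
    fix j assume j: "j \<in> I"
    have "ln 2 > (0::real)" by simp
    then have "\<bar>T - tau j\<bar> = T - tau j" using T[OF j] by linarith
    then show "((\<lambda>a. cmod a / exp T) \<circ> \<sigma>) j = exp (- 1 * \<bar>T - tau j\<bar>)" by (simp add: norm_sigma exp_diff)
  qed
  then have "exp (2 * (\<Sum>a\<in>\<sigma> ` I. cmod a / exp T)) * (\<Prod>a\<in>\<sigma> ` I. cmod (z - a)) * cmod (f w)
      \<le> exp (2 * A) * (\<Prod>a\<in>\<sigma> ` I. cmod (z - a)) * cmod (f w)"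
    using A[OF I, of T] by (intro mult_right_mono prod_nonneg) auto
  with mm have "cmod (f z) * exp T ^ card (\<sigma> ` I) \<le> exp (2 * A) * (\<Prod>a\<in>\<sigma> ` I. cmod (z - a)) * cmod (f w)"
    by linarith
  then show ?thesis using w by (auto simp: card_image[OF inj] prod.reindex[OF inj] exp_of_nat_mult)
qed

text \<open>The sum of two moduli is the larger one times 1 + e^{-distance}. The correction is
  placed in the exponent so that, in a product over j, the corrections add up to a bounded
  quantity.\<close>

lemma norm_diff_le:
  assumes "z \<noteq> 0"
  shows "cmod (z - \<sigma> j) \<le> exp (max (ln (cmod z)) (tau j) + exp (- \<bar>ln (cmod z) - tau j\<bar>))"
proof -
  define t where "t = ln (cmod z)"
  have z: "cmod z = exp t" using assms by (simp add: t_def)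
  have "cmod (z - \<sigma> j) \<le> exp t + exp (tau j)"
    using norm_triangle_ineq4[of z "\<sigma> j"] by (simp add: z norm_sigma)
  also have "\<dots> = exp (max t (tau j)) * (1 + exp (- \<bar>t - tau j\<bar>))"
    by (cases "t \<le> tau j") (auto simp: max_def algebra_simps simp flip: exp_add)
  also have "\<dots> \<le> exp (max t (tau j)) * exp (exp (- \<bar>t - tau j\<bar>))"
    by (intro mult_left_mono) auto
  finally show ?thesis by (simp add: exp_add t_def)
qed

text \<open>If the moduli differ by a factor of at least 2, the reverse triangle inequality
  suffices, since 1 - x is at least e^{- 2 x}. Separation matters only for comparable moduli; there
  x exceeds 1/2, so a K containing 2 |ln c| absorbs the factor c and the error keeps its summable
  form.\<close>

lemma norm_diff_ge:
  assumes "rel_separated \<sigma>"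
  shows "\<exists>K>0. \<forall>n j. n \<noteq> j \<longrightarrow> exp (max (tau n) (tau j) - K * exp (- \<bar>tau n - tau j\<bar>)) \<le> cmod (\<sigma> n - \<sigma> j)"
proof -
  obtain c where c: "c > 0" "\<And>m n. m \<noteq> n \<Longrightarrow> c * max (cmod (\<sigma> m)) (cmod (\<sigma> n)) \<le> cmod (\<sigma> m - \<sigma> n)"
    using assms unfolding rel_separated_def by blast
  define K where "K = 2 + 2 * \<bar>ln c\<bar>"
  have K: "K > 0" "K \<ge> 2" by (auto simp: K_def)
  have "exp (max (tau n) (tau j) - K * exp (- \<bar>tau n - tau j\<bar>)) \<le> cmod (\<sigma> n - \<sigma> j)" if "n \<noteq> j" for n j
  proof -
    define x where "x = exp (- \<bar>tau n - tau j\<bar>)"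
    define M where "M = max (tau n) (tau j)"
    have x: "0 \<le> x" "x \<le> 1" by (auto simp: x_def)
    have M: "max (cmod (\<sigma> n)) (cmod (\<sigma> j)) = exp M" by (simp add: norm_sigma M_def max_def)
    have "exp (- K * x) * exp M \<le> cmod (\<sigma> n - \<sigma> j)"
    proof (cases "x \<le> 1 / 2")
      case True
      have "exp (- K * x) \<le> exp (- 2 * x)" using K x by (simp add: mult_right_mono)
      also have "\<dots> \<le> 1 - x" by (rule one_minus_ge_exp[OF x(1) True])
      finally have "exp (- K * x) * exp M \<le> (1 - x) * exp M" by (intro mult_right_mono) auto
      also have "\<dots> = \<bar>cmod (\<sigma> n) - cmod (\<sigma> j)\<bar>"
        by (cases "tau n \<le> tau j") (auto simp: norm_sigma x_def M_def max_def algebra_simps simp flip: exp_add)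
      also have "\<dots> \<le> cmod (\<sigma> n - \<sigma> j)" by (rule norm_triangle_ineq3)
      finally show ?thesis .
    next
      case False
      have "2 * \<bar>ln c\<bar> * (1/2) \<le> K * x" using False by (intro mult_mono) (auto simp: K_def)
      then have "- K * x \<le> ln c" by simp
      then have "exp (- K * x) \<le> c" using c(1) by (metis exp_le_cancel_iff exp_ln)
      then have "exp (- K * x) * exp M \<le> c * exp M" by (intro mult_right_mono) auto
      also have "\<dots> \<le> cmod (\<sigma> n - \<sigma> j)" using c(2)[OF that] M by simp
      finally show ?thesis .
    qed
    then show ?thesis by (simp add: x_def M_def algebra_simps flip: exp_add)
  qed
  with K show ?thesis by blast
qed

section \<open>Size of the Lagrange polynomials\<close>

definition lag :: "nat \<Rightarrow> nat \<Rightarrow> complex \<Rightarrow> complex"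
  where "lag m n z = (\<Prod>j\<in>{..<m} - {n}. (z - \<sigma> j) / (\<sigma> n - \<sigma> j))"

lemma sigma_eq_iff: "\<sigma> m = \<sigma> n \<longleftrightarrow> m = n"
  using inj_sigma by (auto dest: injD)

lemma lag_sigma: "n < m \<Longrightarrow> k < m \<Longrightarrow> lag m n (\<sigma> k) = (if k = n then 1 else 0)"
  unfolding lag_def by (auto simp: sigma_eq_iff prod_zero_iff intro!: prod.neutral)

lemma lag_holomorphic: "lag m n holomorphic_on UNIV"
  unfolding lag_def[abs_def] by (intro holomorphic_intros) (auto simp: sigma_eq_iff)

text \<open>Each summand is the positive part of t - \<open>tau j\<close> minus that of
  \<open>tau n - tau j\<close>. The former vanishes from k on and the latter is only increased by
  summing over more indices, so the dependence on m disappears. The term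
  \<open>max 0 (t - tau n)\<close> is the contribution of the omitted factor j = n.\<close>

lemma max_exponent_le:
  assumes n: "n < m" and k: "\<And>j. j < k \<Longrightarrow> tau j < t" "\<And>j. k \<le> j \<Longrightarrow> t \<le> tau j"
  shows "(\<Sum>j\<in>{..<m} - {n}. max t (tau j) - max (tau n) (tau j))
    \<le> (\<Sum>j<k. t - tau j) - max 0 (t - tau n) - (\<Sum>j<n. tau n - tau j)"
proof -
  have "(\<Sum>j\<in>{..<m} - {n}. max t (tau j) - max (tau n) (tau j))
    = (\<Sum>j\<in>{..<m} - {n}. max 0 (t - tau j)) - (\<Sum>j\<in>{..<m} - {n}. max 0 (tau n - tau j))"
    unfolding sum_subtractf[symmetric] by (intro sum.cong refl) (auto simp: max_def)
  moreover have "(\<Sum>j\<in>{..<m} - {n}. max 0 (t - tau j)) = (\<Sum>j<m. max 0 (t - tau j)) - max 0 (t - tau n)"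
    using n by (subst sum_diff1) auto
  moreover have "(\<Sum>j<m. max 0 (t - tau j)) \<le> (\<Sum>j<k. t - tau j)"
  proof -
    have "(\<Sum>j<m. max 0 (t - tau j)) \<le> (\<Sum>j<max m k. max 0 (t - tau j))"
      by (intro sum_mono2) auto
    also have "\<dots> = (\<Sum>j<k. max 0 (t - tau j))"
      using k(2) by (intro sum.mono_neutral_right) (auto simp: max_def intro: order_antisym)
    also have "\<dots> = (\<Sum>j<k. t - tau j)" using k(1) by (intro sum.cong refl) (auto simp: max_def dest: less_imp_le)
    finally show ?thesis .
  qed
  moreover have "(\<Sum>j<n. tau n - tau j) \<le> (\<Sum>j\<in>{..<m} - {n}. max 0 (tau n - tau j))"
  proof -
    have "(\<Sum>j<n. tau n - tau j) \<le> (\<Sum>j<n. max 0 (tau n - tau j))" by (intro sum_mono) auto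
    also have "\<dots> \<le> (\<Sum>j\<in>{..<m} - {n}. max 0 (tau n - tau j))" using n by (intro sum_mono2) auto
    finally show ?thesis .
  qed
  ultimately show ?thesis by linarith
qed

text \<open>Up to bounded terms the left side is at most \<open>level k - level n\<close> minus the
  positive part of t - \<open>tau n\<close>. Towards smaller indices \<open>level\<close> drops by
  \<epsilon> per step. Towards larger ones it rises by at most h - \<epsilon> per step, while the
  omitted factor takes away about h. Both sides thus lose \<epsilon> per index, which is \<epsilon>
  / h per unit of t.\<close>

lemma exponent_decay:
  assumes B: "\<And>n. \<bar>dev n\<bar> \<le> B" and drift: "small_drift (h / 2) dev"
  shows "\<exists>C. \<exists>\<eta>>0. \<forall>t k n. 0 \<le> t \<longrightarrow> (\<forall>j<k. tau j < t) \<longrightarrow> (\<forall>j\<ge>k. t \<le> tau j) \<longrightarrow>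
    (\<Sum>j<k. t - tau j) - max 0 (t - tau n) - (\<Sum>j<n. tau n - tau j) - pot t + pot (tau n)
    \<le> C - \<eta> * \<bar>t - tau n\<bar>"
proof -
  obtain \<epsilon> C where eps: "\<epsilon> > 0" and dr: "\<And>n k. n \<le> k \<Longrightarrow> \<bar>(\<Sum>j<k. dev j) - (\<Sum>j<n. dev j)\<bar> \<le> (h/2 - \<epsilon>) * (real k - real n) + C"
    using drift unfolding small_drift_def by blast
  have B0: "B \<ge> 0" using B[of 0] by simp
  define q where "q = 2 / p"
  have q: "q > 0" using p_pos by (simp add: q_def)
  \<comment> \<open>\<open>D\<close> bounds the excess of |t - \<open>tau n\<close>| over h times
    the index distance. The part h * q is node 0; it is needed when no point lies to the left of t,
    where only 0 \<le> t bounds t from below.\<close>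
  define D where "D = h + 2 * B + h * q"
  define C' where "C' = C + h + 2 * B + \<alpha> * B\<^sup>2 + \<epsilon> * D / h"
  have tdiff: "tau j - tau i \<le> h * (real j - real i) + 2 * B" "h * (real j - real i) - 2 * B \<le> tau j - tau i" for i j
    using node_diff[of j i] B[of j] B[of i] unfolding dev_def by linarith+
  have main: "(\<Sum>j<k. t - tau j) - max 0 (t - tau n) - (\<Sum>j<n. tau n - tau j) - pot t + pot (tau n)
    \<le> C' - \<epsilon> / h * \<bar>t - tau n\<bar>"
    if t: "0 \<le> t" "\<forall>j<k. tau j < t" "\<forall>j\<ge>k. t \<le> tau j" for t k n
  proof -
    have "(\<Sum>j<k. t - tau j) - pot t = level k - \<alpha> * (t - node k)\<^sup>2"
      using linear_minus_pot[of k t] by (simp add: level_def sum_subtractf)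
    also have "\<dots> \<le> level k" using alpha_pos by simp
    finally have 1: "(\<Sum>j<k. t - tau j) - pot t \<le> level k" .
    have "(\<Sum>j<n. tau n - tau j) - pot (tau n) = level n - \<alpha> * (dev n)\<^sup>2"
      using linear_minus_pot[of n "tau n"] by (simp add: level_def sum_subtractf dev_def)
    moreover have "\<alpha> * (dev n)\<^sup>2 \<le> \<alpha> * B\<^sup>2" using alpha_pos B[of n] B0
      by (intro mult_left_mono) (auto simp: abs_le_square_iff[symmetric])
    ultimately have 2: "(\<Sum>j<n. tau n - tau j) - pot (tau n) \<ge> level n - \<alpha> * B\<^sup>2" by simp
    have lev: "level k - level n = h / 2 * (real k - real n) - ((\<Sum>j<k. dev j) - (\<Sum>j<n. dev j))"
      by (simp add: level_eq field_simps)
    define d where "d = \<bar>real k - real n\<bar>"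
    have 3: "level k - level n - max 0 (t - tau n) \<le> C + h + 2 * B - \<epsilon> * d \<and> \<bar>t - tau n\<bar> \<le> h * d + D"
    proof (cases "n < k")
      case True
      then have d: "d = real k - real n" by (simp add: d_def)
      have "h / 2 * (real k - real n) + ((h/2 - \<epsilon>) * (real k - real n) + C) = (h - \<epsilon>) * d + C"
        by (simp add: d algebra_simps)
      then have a: "level k - level n \<le> (h - \<epsilon>) * d + C"
        using lev dr[of n k] True by linarith
      have k1: "tau (k - 1) < t" using t(2) True by simp
      have "h * (real (k - 1) - real n) - 2 * B \<le> t - tau n" using tdiff(2)[of "k - 1" n] k1 by linarith
      then have b: "h * d - h - 2 * B \<le> t - tau n" using True by (simp add: d of_nat_diff algebra_simps)
      have "tau n \<le> t" using t(2) True by (simp add: less_imp_le)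
      moreover have "t \<le> tau k" using t(3) by simp
      ultimately have "\<bar>t - tau n\<bar> \<le> h * d + 2 * B" using tdiff(1)[of k n] by (simp add: d)
      moreover have "(h - \<epsilon>) * d = h * d - \<epsilon> * d" by (simp add: algebra_simps)
      moreover have "h * q > 0" using h_pos q by simp
      moreover have "t - tau n \<le> max 0 (t - tau n)" by simp
      ultimately show ?thesis using a b h_pos unfolding D_def by (intro conjI; linarith)
    next
      case False
      then have d: "d = real n - real k" by (simp add: d_def)
      have "- h / 2 * d + ((h/2 - \<epsilon>) * d + C) = - \<epsilon> * d + C" by (simp add: algebra_simps)
      moreover have "\<bar>(\<Sum>j<n. dev j) - (\<Sum>j<k. dev j)\<bar> \<le> (h/2 - \<epsilon>) * d + C" using dr[of k n] False d by simp
      moreover have "level k - level n = - h / 2 * d + ((\<Sum>j<n. dev j) - (\<Sum>j<k. dev j))"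
        using lev by (simp add: d field_simps)
      ultimately have a: "level k - level n \<le> - \<epsilon> * d + C" by linarith
      have "t \<le> tau n" using t(3) False by simp
      then have abs: "\<bar>t - tau n\<bar> = tau n - t" by simp
      have "tau n - t \<le> h * d + D"
      proof (cases "k = 0")
        case True
        have "tau n \<le> node n + B" using B[of n] unfolding dev_def by linarith
        also have "node n = h * d + h * q" by (simp add: node_def d True q_def algebra_simps)
        finally show ?thesis using t(1) h_pos B0 unfolding D_def by linarith
      next
        case k: False
        then have "tau (k - 1) < t" using t(2) by simp
        then have "tau n - t \<le> h * (real n - real (k - 1)) + 2 * B" using tdiff(1)[of n "k - 1"] by linarith
        also have "\<dots> = h * d + h + 2 * B" using k by (simp add: d of_nat_diff algebra_simps)
        finally show ?thesis using h_pos q mult_pos_pos[OF h_pos q] unfolding D_def by linarith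
      qed
      then show ?thesis using a abs h_pos B0 by simp
    qed
    have "\<epsilon> / h * \<bar>t - tau n\<bar> \<le> \<epsilon> / h * (h * d + D)" using 3 eps h_pos by (intro mult_left_mono) auto
    also have "\<dots> = \<epsilon> * d + \<epsilon> * D / h" using h_pos by (simp add: field_simps)
    finally have 4: "\<epsilon> / h * \<bar>t - tau n\<bar> \<le> \<epsilon> * d + \<epsilon> * D / h" .
    show ?thesis using 1 2 3 4 unfolding C'_def by linarith
  qed
  show ?thesis using main eps h_pos by (intro exI[of _ C'] exI[of _ "\<epsilon> / h"] conjI) auto
qed

text \<open>Numerators are estimated by \<open>norm_diff_le\<close>, denominators by
  \<open>norm_diff_ge\<close>. All correction exponents together are at most C1 + K * C1, whatever
  the number m of nodes, and the main exponents are those of \<open>exponent_decay\<close>.\<close>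

lemma wval_lag_le:
  assumes sep: "rel_separated \<sigma>" and B: "\<And>n. \<bar>dev n\<bar> \<le> B" and drift: "small_drift (h / 2) dev"
  shows "\<exists>C>0. \<exists>\<eta>>0. \<forall>m n z. n < m \<longrightarrow> 1 \<le> cmod z \<longrightarrow>
    wval (lag m n) z \<le> C * exp (- \<eta> * \<bar>ln (cmod z) - tau n\<bar>) * exp (- pot (tau n))"
proof -
  obtain C0 \<eta> where eta: "\<eta> > 0" and ex: "\<And>t k n. 0 \<le> t \<Longrightarrow> (\<forall>j<k. tau j < t) \<Longrightarrow> (\<forall>j\<ge>k. t \<le> tau j) \<Longrightarrow>
    (\<Sum>j<k. t - tau j) - max 0 (t - tau n) - (\<Sum>j<n. tau n - tau j) - pot t + pot (tau n)
    \<le> C0 - \<eta> * \<bar>t - tau n\<bar>"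
    using exponent_decay[OF B drift] by blast
  obtain C1 where C1: "C1 > 0" "\<And>t F. finite F \<Longrightarrow> (\<Sum>j\<in>F. exp (- 1 * \<bar>t - tau j\<bar>)) \<le> C1"
    using sum_exp_dist_le[OF lin_growth_tau[OF B], of 1] by auto
  obtain K where K: "K > 0" "\<And>n j. n \<noteq> j \<Longrightarrow> exp (max (tau n) (tau j) - K * exp (- \<bar>tau n - tau j\<bar>)) \<le> cmod (\<sigma> n - \<sigma> j)"
    using norm_diff_ge[OF sep] by blast
  have main: "wval (lag m n) z \<le> exp (C0 + C1 + K * C1) * exp (- \<eta> * \<bar>ln (cmod z) - tau n\<bar>) * exp (- pot (tau n))"
    if n: "n < m" and z: "1 \<le> cmod z" for m n z
  proof -
    define t where "t = ln (cmod z)"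
    have t0: "t \<ge> 0" using z by (simp add: t_def)
    have z0: "z \<noteq> 0" using z by auto
    have ub: "\<exists>k. t \<le> tau k"
    proof -
      obtain k :: nat where "real k > (t + B) / h" using reals_Archimedean2 by blast
      then have "h * real k > t + B" using h_pos by (simp add: field_simps)
      moreover have "node k \<ge> h * real k" using h_pos p_pos by (simp add: node_def algebra_simps)
      ultimately show ?thesis using B[of k] unfolding dev_def by (intro exI[of _ k]) linarith
    qed
    \<comment> \<open>This counts the points of modulus smaller than |z|.\<close>
    define k where "k = (LEAST k. t \<le> tau k)"
    have k1: "t \<le> tau k" unfolding k_def using ub by (rule LeastI_ex)
    have k2: "\<forall>j<k. tau j < t" unfolding k_def using not_less_Least by (metis not_le)
    have k3: "\<forall>j\<ge>k. t \<le> tau j" using k1 tau_mono order_trans by blast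
    let ?A = "{..<m} - {n}"
    have "cmod (lag m n z) = (\<Prod>j\<in>?A. cmod (z - \<sigma> j) / cmod (\<sigma> n - \<sigma> j))"
      by (simp add: lag_def norm_divide flip: prod_norm)
    also have "\<dots> \<le> (\<Prod>j\<in>?A. exp (max t (tau j) + exp (- \<bar>t - tau j\<bar>)) / exp (max (tau n) (tau j) - K * exp (- \<bar>tau n - tau j\<bar>)))"
      using norm_diff_le[OF z0] K(2) unfolding t_def
      by (intro prod_mono conjI frac_le) auto
    also have "\<dots> = exp (\<Sum>j\<in>?A. (max t (tau j) - max (tau n) (tau j)) + (exp (- \<bar>t - tau j\<bar>) + K * exp (- \<bar>tau n - tau j\<bar>)))"
      by (simp add: exp_sum exp_diff[symmetric] algebra_simps)
    also have "\<dots> \<le> exp ((\<Sum>j<k. t - tau j) - max 0 (t - tau n) - (\<Sum>j<n. tau n - tau j) + (C1 + K * C1))"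
    proof -
      have "(\<Sum>j\<in>?A. exp (- \<bar>t - tau j\<bar>) + K * exp (- \<bar>tau n - tau j\<bar>)) \<le> C1 + K * C1"
        unfolding sum.distrib sum_distrib_left[symmetric] using C1(2)[of ?A t] C1(2)[of ?A "tau n"] K(1)
        by (intro add_mono mult_left_mono) auto
      moreover have "(\<Sum>j\<in>?A. max t (tau j) - max (tau n) (tau j)) \<le> (\<Sum>j<k. t - tau j) - max 0 (t - tau n) - (\<Sum>j<n. tau n - tau j)"
        using k2 k3 by (intro max_exponent_le[OF n]) auto
      ultimately show ?thesis by (simp add: sum.distrib)
    qed
    finally have "wval (lag m n) z \<le> exp ((\<Sum>j<k. t - tau j) - max 0 (t - tau n) - (\<Sum>j<n. tau n - tau j) + (C1 + K * C1)) * exp (- pot t)"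
      unfolding wval_def t_def by (intro mult_right_mono) auto
    also have "\<dots> \<le> exp (C0 + C1 + K * C1 - \<eta> * \<bar>t - tau n\<bar> - pot (tau n))"
      unfolding exp_add[symmetric] using ex[OF t0 k2 k3, of n] by simp
    also have "\<dots> = exp (C0 + C1 + K * C1) * exp (- \<eta> * \<bar>t - tau n\<bar>) * exp (- pot (tau n))"
      by (simp add: exp_add[symmetric])
    finally show ?thesis by (simp add: t_def)
  qed
  show ?thesis using main eta by (intro exI[of _ "exp (C0 + C1 + K * C1)"] conjI exI[of _ \<eta>]) auto
qed

section \<open>Interpolation with a norm bound\<close>

definition lagsum :: "(nat \<Rightarrow> complex) \<Rightarrow> nat \<Rightarrow> complex \<Rightarrow> complex"
  where "lagsum v m z = (\<Sum>n<m. v n * lag m n z)"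

lemma lagsum_holomorphic: "lagsum v m holomorphic_on UNIV"
  unfolding lagsum_def[abs_def] by (intro holomorphic_intros lag_holomorphic)

lemma lagsum_sigma: "n < m \<Longrightarrow> lagsum v m (\<sigma> n) = v n"
proof -
  assume n: "n < m"
  have "lagsum v m (\<sigma> n) = (\<Sum>k<m. if k = n then v k else 0)"
    unfolding lagsum_def using n by (intro sum.cong refl) (auto simp: lag_sigma)
  then show ?thesis using n by simp
qed

text \<open>A Schur test for the kernel exp (- \<eta> |k - \<open>tau n\<close>|), with k numbering
  annuli and n numbering points: the sums over n enter through \<open>weighted_sum_powr_le\<close>,
  those over k after exchanging the order of summation.\<close>

lemma fnorm_lagsum_le:
  assumes sep: "rel_separated \<sigma>" and B: "\<And>n. \<bar>dev n\<bar> \<le> B" and drift: "small_drift (h / 2) dev"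
  shows "\<exists>C>0. \<forall>v K m. ssum_le v K \<longrightarrow> fnorm (lagsum v m) \<le> ennreal (C * K)"
proof -
  obtain C0 \<eta> where C0: "C0 > 0" and eta: "\<eta> > 0" and lag: "\<And>m n z. n < m \<Longrightarrow> 1 \<le> cmod z \<Longrightarrow>
    wval (lag m n) z \<le> C0 * exp (- \<eta> * \<bar>ln (cmod z) - tau n\<bar>) * exp (- pot (tau n))"
    using wval_lag_le[OF sep B drift] by blast
  obtain A where A: "A > 0" "\<And>t F. finite F \<Longrightarrow> (\<Sum>j\<in>F. exp (- \<eta> * \<bar>t - tau j\<bar>)) \<le> A"
    using sum_exp_dist_le[OF lin_growth_tau[OF B] eta] by auto
  obtain A' where A': "A' > 0" "\<And>t F. finite F \<Longrightarrow> (\<Sum>j\<in>F. exp (- \<eta> * \<bar>t - real j\<bar>)) \<le> A'"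
    using sum_exp_dist_le[OF lin_growth_of_nat eta] by auto
  define C1 where "C1 = pi + pi * exp 4"
  have C1: "C1 > 0" unfolding C1_def by (intro add_pos_pos) auto
  define C2 where "C2 = (C0 * exp \<eta>) powr p * (A + 1) powr p"
  have C2: "C2 > 0" using C0 A by (simp add: C2_def)
  have main: "fnorm (lagsum v m) \<le> ennreal (C1 * (C2 * A' * K))" if v: "ssum_le v K" for v K m
  proof -
    define a where "a n = cmod (v n) * exp (- pot (tau n))" for n
    have a0: "a n \<ge> 0" for n by (simp add: a_def)
    have aK: "(\<Sum>n<m. a n powr p) \<le> K" using v unfolding ssum_le_def a_def by auto
    \<comment> \<open>The factor \<open>exp \<eta>\<close> pays for replacing ln |z| by k on an
      annulus of logarithmic width 1.\<close>
    define M where "M k = C0 * exp \<eta> * (\<Sum>n<m. exp (- \<eta> * \<bar>real k - tau n\<bar>) * a n)" for k :: nat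
    show ?thesis unfolding C1_def
    proof (rule fnorm_le[OF lagsum_holomorphic])
      fix k :: nat and z :: complex assume z: "z \<noteq> 0" "real k \<le> ln (cmod z)" "ln (cmod z) \<le> real k + 1"
      have "0 \<le> ln (cmod z)" using z(2) by linarith
      then have z1: "1 \<le> cmod z" using z(1) by simp
      have "cmod (lagsum v m z) \<le> (\<Sum>n<m. cmod (v n) * cmod (lag m n z))"
        unfolding lagsum_def by (rule order_trans[OF norm_sum]) (simp add: norm_mult)
      then have "wval (lagsum v m) z \<le> (\<Sum>n<m. cmod (v n) * cmod (lag m n z)) * exp (- pot (ln (cmod z)))"
        unfolding wval_def by (intro mult_right_mono) auto
      also have "\<dots> = (\<Sum>n<m. cmod (v n) * wval (lag m n) z)"
        by (simp add: wval_def sum_distrib_right mult.assoc)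
      also have "\<dots> \<le> (\<Sum>n<m. C0 * exp \<eta> * (exp (- \<eta> * \<bar>real k - tau n\<bar>) * a n))"
      proof (rule sum_mono)
        fix n assume n: "n \<in> {..<m}"
        have "\<bar>real k - tau n\<bar> \<le> 1 + \<bar>ln (cmod z) - tau n\<bar>" using z by linarith
        then have "\<eta> * \<bar>real k - tau n\<bar> \<le> \<eta> * (1 + \<bar>ln (cmod z) - tau n\<bar>)" using eta by simp
        then have e: "exp (- \<eta> * \<bar>ln (cmod z) - tau n\<bar>) \<le> exp \<eta> * exp (- \<eta> * \<bar>real k - tau n\<bar>)"
          by (simp add: algebra_simps flip: exp_add)
        have "wval (lag m n) z \<le> C0 * exp (- \<eta> * \<bar>ln (cmod z) - tau n\<bar>) * exp (- pot (tau n))"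
          using lag n z1 by auto
        also have "\<dots> \<le> C0 * (exp \<eta> * exp (- \<eta> * \<bar>real k - tau n\<bar>)) * exp (- pot (tau n))"
          using e C0 by (intro mult_right_mono mult_left_mono) auto
        finally have "cmod (v n) * wval (lag m n) z \<le> cmod (v n) * (C0 * (exp \<eta> * exp (- \<eta> * \<bar>real k - tau n\<bar>)) * exp (- pot (tau n)))"
          by (intro mult_left_mono) auto
        then show "cmod (v n) * wval (lag m n) z \<le> C0 * exp \<eta> * (exp (- \<eta> * \<bar>real k - tau n\<bar>) * a n)"
          by (simp add: a_def mult_ac)
      qed
      also have "\<dots> = M k" by (simp add: M_def sum_distrib_left)
      finally show "wval (lagsum v m) z \<le> M k" .
    next
      fix N :: nat
      have Mp: "M k powr p \<le> C2 * (\<Sum>n<m. exp (- \<eta> * \<bar>real k - tau n\<bar>) * a n powr p)" for k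
      proof -
        have "M k powr p = (C0 * exp \<eta>) powr p * (\<Sum>n<m. exp (- \<eta> * \<bar>real k - tau n\<bar>) * a n) powr p"
          unfolding M_def using C0 a0 by (simp add: powr_mult sum_nonneg)
        also have "\<dots> \<le> (C0 * exp \<eta>) powr p * ((A + 1) powr p * (\<Sum>n<m. exp (- \<eta> * \<bar>real k - tau n\<bar>) * a n powr p))"
          using a0 A p_ge_1 by (intro mult_left_mono weighted_sum_powr_le) auto
        finally show ?thesis by (simp add: C2_def mult.assoc)
      qed
      have "(\<Sum>k<N. M k powr p) \<le> (\<Sum>k<N. C2 * (\<Sum>n<m. exp (- \<eta> * \<bar>real k - tau n\<bar>) * a n powr p))"
        using Mp by (rule sum_mono)
      also have "\<dots> = C2 * (\<Sum>k<N. \<Sum>n<m. exp (- \<eta> * \<bar>real k - tau n\<bar>) * a n powr p)"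
        by (simp add: sum_distrib_left)
      also have "(\<Sum>k<N. \<Sum>n<m. exp (- \<eta> * \<bar>real k - tau n\<bar>) * a n powr p)
        = (\<Sum>n<m. (\<Sum>k<N. exp (- \<eta> * \<bar>tau n - real k\<bar>)) * a n powr p)"
        by (subst sum.swap) (simp add: sum_distrib_right abs_minus_commute)
      also have "\<dots> \<le> (\<Sum>n<m. A' * a n powr p)"
        using A' by (intro sum_mono mult_right_mono) auto
      also have "\<dots> = A' * (\<Sum>n<m. a n powr p)" by (simp add: sum_distrib_left)
      also have "\<dots> \<le> A' * K" using aK A' by (intro mult_left_mono) auto
      finally show "(\<Sum>k<N. M k powr p) \<le> C2 * A' * K" using C2 by (simp add: mult.assoc)
    qed
  qed
  show ?thesis using main C1 C2 A' by (intro exI[of _ "C1 * C2 * A'"]) (auto simp: mult.assoc)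
qed

text \<open>This is Fatou's lemma for the densities.\<close>

lemma fnorm_limit_le:
  assumes hol: "\<And>n. F n holomorphic_on UNIV" and lim: "\<And>z. (\<lambda>n. F n z) \<longlonglongrightarrow> f z"
    and le: "\<And>n. fnorm (F n) \<le> K"
  shows "fnorm f \<le> K"
proof -
    have "(\<lambda>n. dens (F n) z) \<longlonglongrightarrow> dens f z" for z
    using p_pos by (intro tendsto_ennrealI tendsto_powr' tendsto_norm tendsto_mult lim tendsto_const) auto
  then have "dens f z = liminf (\<lambda>n. dens (F n) z)" for z
    by (intro lim_imp_Liminf[symmetric]) auto
  then have "fnorm f = (\<integral>\<^sup>+ z. liminf (\<lambda>n. dens (F n) z) \<partial>lborel)" unfolding fock_norm_pow_def by simp
  also have "\<dots> \<le> liminf (\<lambda>n. fnorm (F n))" unfolding fock_norm_pow_def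
    using fock_integrand_measurable[OF hol] by (intro nn_integral_liminf) auto
  also have "\<dots> \<le> K" using le by (intro Liminf_le) auto
  finally show ?thesis .
qed

lemma interpolation_with_bound:
  assumes sep: "rel_separated \<sigma>" and B: "\<And>n. \<bar>dev n\<bar> \<le> B" and drift: "small_drift (h / 2) dev"
  shows "\<exists>C>0. \<forall>v K. ssum_le v K \<longrightarrow>
    (\<exists>f\<in>fspace. (\<forall>n. f (\<sigma> n) = v n) \<and> fnorm f \<le> ennreal (C * K))"
proof -
  obtain C where C: "C > 0" and le: "\<And>v K m. ssum_le v K \<Longrightarrow> fnorm (lagsum v m) \<le> ennreal (C * K)"
    using fnorm_lagsum_le[OF sep B drift] by blast
  define C1 where "C1 = ptw_const 1 (1/2)"
  have "\<exists>f\<in>fspace. (\<forall>n. f (\<sigma> n) = v n) \<and> fnorm f \<le> ennreal (C * K)" if v: "ssum_le v K" for v K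
  proof -
    have K: "K \<ge> 0" using ssum_le_nonneg[OF v] .
    \<comment> \<open>Local boundedness for Montel's theorem: the maximum principle moves z to a
      circle of radius R at least 1, where the norm bound controls point values.\<close>
    have bdd: "\<exists>B. \<forall>f\<in>range (lagsum v). \<forall>z\<in>S. cmod (f z) \<le> B" if S: "compact S" for S
    proof -
      obtain R0 where R0: "\<And>z. z \<in> S \<Longrightarrow> cmod z \<le> R0"
        using compact_imp_bounded[OF S] by (auto simp: bounded_iff)
      define R where "R = max 1 R0"
      have R: "R \<ge> 1" "\<And>z. z \<in> S \<Longrightarrow> cmod z \<le> R" using R0 by (auto simp: R_def le_max_iff_disj)
      have "cmod (lagsum v m z) \<le> (C1 * (C * K)) powr (1 / p) * exp (pot (ln R))" if zS: "z \<in> S" for m z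
      proof -
        obtain w where w: "cmod w = R" "cmod (lagsum v m z) \<le> cmod (lagsum v m w)"
          using max_modulus_circle[OF lagsum_holomorphic[of v m], of R z] R(1) R(2)[OF zS] by auto
        have "wval (lagsum v m) w \<le> (C1 * (C * K)) powr (1 / p)"
          unfolding C1_def using C K R w le[OF v] by (intro wval_le_of_fnorm lagsum_holomorphic) auto
        then have "cmod (lagsum v m w) \<le> (C1 * (C * K)) powr (1 / p) * exp (pot (ln R))"
          using w by (simp add: wval_def exp_minus field_simps)
        with w show ?thesis by simp
      qed
      then show ?thesis by blast
    qed
    obtain f r where f: "f holomorphic_on UNIV" and r: "strict_mono (r :: nat \<Rightarrow> nat)"
      and lim: "\<And>z. (\<lambda>n. lagsum v (r n) z) \<longlonglongrightarrow> f z"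
    proof (rule Montel[of UNIV "range (lagsum v)" "lagsum v"])
      show "g holomorphic_on UNIV" if "g \<in> range (lagsum v)" for g
        using that lagsum_holomorphic by auto
      show "\<exists>B. \<forall>g\<in>range (lagsum v). \<forall>z\<in>S. cmod (g z) \<le> B" if "compact S" for S
        by (rule bdd[OF that])
      show thesis if "g holomorphic_on UNIV" "strict_mono r"
        "\<And>x. x \<in> UNIV \<Longrightarrow> (\<lambda>n. lagsum v (r n) x) \<longlonglongrightarrow> g x" for g and r :: "nat \<Rightarrow> nat"
        using that that(1) by (intro \<open>\<And>f r. \<lbrakk>f holomorphic_on UNIV; strict_mono r; \<And>z. (\<lambda>n. lagsum v (r n) z) \<longlonglongrightarrow> f z\<rbrakk> \<Longrightarrow> thesis\<close>) auto
    qed auto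
    have fn: "fnorm f \<le> ennreal (C * K)"
      using lagsum_holomorphic lim le[OF v] by (rule fnorm_limit_le)
    have "f (\<sigma> n) = v n" for n
    proof (rule LIMSEQ_unique[OF lim])
      have "eventually (\<lambda>m. lagsum v (r m) (\<sigma> n) = v n) sequentially"
        using eventually_gt_at_top[of n]
        by eventually_elim (use seq_suble[OF r] in \<open>auto intro!: lagsum_sigma elim: less_le_trans\<close>)
      then show "(\<lambda>m. lagsum v (r m) (\<sigma> n)) \<longlonglongrightarrow> v n" by (rule tendsto_eventually)
    qed
    moreover have "f \<in> fspace" using f fn by (auto simp: fock_space_def intro: le_less_trans)
    ultimately show ?thesis using fn by blast
  qed
  with C show ?thesis by blast
qed

text \<open>This is the upper half of the sampling inequality: with c at most half the separation
  constant, the discs of radius c |\<sigma>_i| are disjoint.\<close>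

lemma ssum_le_of_fnorm:
  assumes sep: "rel_separated \<sigma>"
  shows "\<exists>C>0. \<forall>f K. f holomorphic_on UNIV \<longrightarrow> 0 \<le> K \<longrightarrow> fnorm f \<le> ennreal K \<longrightarrow> ssum_le (\<lambda>n. f (\<sigma> n)) (C * K)"
proof -
  obtain c0 where c0: "c0 > 0" "\<And>m n. m \<noteq> n \<Longrightarrow> c0 * max (cmod (\<sigma> m)) (cmod (\<sigma> n)) \<le> cmod (\<sigma> m - \<sigma> n)"
    using assms unfolding rel_separated_def by blast
  define c where "c = min (c0 / 2) (1 / 2)"
  have c: "0 < c" "c \<le> 1/2" "2 * c \<le> c0" using c0 by (auto simp: c_def)
  have m: "0 < cmod (\<sigma> 0)" using sigma_nonzero by simp
  have dis: "disjoint_family_on (\<lambda>i. ball (\<sigma> i) (c * cmod (\<sigma> i))) I" for I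
    unfolding disjoint_family_on_def
  proof (intro ballI impI)
    fix i j :: nat assume "i \<noteq> j"
    have "c * cmod (\<sigma> i) \<le> c * max (cmod (\<sigma> i)) (cmod (\<sigma> j))" "c * cmod (\<sigma> j) \<le> c * max (cmod (\<sigma> i)) (cmod (\<sigma> j))"
      using c(1) by (auto intro!: mult_left_mono)
    moreover have "2 * c * max (cmod (\<sigma> i)) (cmod (\<sigma> j)) \<le> c0 * max (cmod (\<sigma> i)) (cmod (\<sigma> j))"
      using c(3) by (intro mult_right_mono) (auto simp: le_max_iff_disj)
    moreover note c0(2)[OF \<open>i \<noteq> j\<close>]
    ultimately have "c * cmod (\<sigma> i) + c * cmod (\<sigma> j) \<le> dist (\<sigma> i) (\<sigma> j)" by (simp add: dist_norm)
    then show "ball (\<sigma> i) (c * cmod (\<sigma> i)) \<inter> ball (\<sigma> j) (c * cmod (\<sigma> j)) = {}"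
      by (rule disjoint_ballI)
  qed
  have "ssum_le (\<lambda>n. f (\<sigma> n)) (ptw_const (cmod (\<sigma> 0)) c * K)"
    if "f holomorphic_on UNIV" "0 \<le> K" "fnorm f \<le> ennreal K" for f K
    unfolding ssum_le_def
    using sum_wval_powr_le[OF m c(1,2) that _ _ dis] norm_sigma_mono[of 0] by (simp add: wval_def tau_def)
  with ptw_const_pos[OF c(1)] show ?thesis by blast
qed

text \<open>The Jensen-type inequality on a circle just outside the first k zeros gives |f z|
  e^{level k} \<le> Q with Q independent of k. The drift condition makes \<open>level k\<close> at
  least \<epsilon> k - C, so f z has to vanish.\<close>

lemma uniqueness:
  assumes B: "\<And>n. \<bar>dev n\<bar> \<le> B" and drift: "small_drift (h / 2) dev"
    and f: "f \<in> fspace" and zero: "\<And>n. f (\<sigma> n) = 0"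
  shows "f z = 0"
proof (rule ccontr)
  assume fz: "f z \<noteq> 0"
  obtain \<epsilon> C where eps: "\<epsilon> > 0" and dr: "\<And>n k. n \<le> k \<Longrightarrow> \<bar>(\<Sum>j<k. dev j) - (\<Sum>j<n. dev j)\<bar> \<le> (h/2 - \<epsilon>) * (real k - real n) + C"
    using drift unfolding small_drift_def by blast
  have hol: "f holomorphic_on UNIV" using f by (simp add: fock_space_def)
  obtain K where K: "K \<ge> 0" "fnorm f \<le> ennreal K" using f unfolding fock_space_def by (cases "fnorm f") auto
  define W where "W = (ptw_const 1 (1/2) * K) powr (1 / p)"
  obtain A where A: "A > 0" "\<And>t F. finite F \<Longrightarrow> (\<Sum>j\<in>F. exp (- 1 * \<bar>t - tau j\<bar>)) \<le> A"
    using sum_exp_dist_le[OF lin_growth_tau[OF B], of 1] by auto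

  have B0: "B \<ge> 0" using B[of 0] by simp
  \<comment> \<open>The radius exp (node k + b) is at least twice the modulus of each of the first k
    points, while leaving the Gaussian peak costs only \<alpha> b^2.\<close>
  define b where "b = B + ln 2"
  define Q where "Q = exp (2 * A + cmod z * exp (- tau 0) * A) * W * exp (\<alpha> * b\<^sup>2)"
  have bound: "cmod (f z) * exp (level k) \<le> Q" if k: "ln (max 1 (cmod z)) \<le> node k" for k
  proof -
    define L where "L = node k + b"
    define R where "R = exp L"
    have ln2: "ln 2 > (0::real)" by simp
    have L: "ln (max 1 (cmod z)) \<le> L" using k B0 ln2 unfolding L_def b_def by linarith
    then have "max 1 (cmod z) \<le> R" unfolding R_def
      by (metis exp_le_cancel_iff exp_ln less_max_iff_disj zero_less_one)
    then have R: "1 \<le> R" "cmod z \<le> R" by simp_all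
    have tl: "tau j + ln 2 \<le> L" if "j < k" for j
      using that B[of j] node_diff[of k j] mult_pos_pos[OF h_pos, of "real k - real j"] unfolding L_def b_def dev_def by simp
    obtain w where w: "cmod w = R"
      and mm: "cmod (f z) * exp (real k * L) \<le> exp (2 * A) * (\<Prod>j<k. cmod (z - \<sigma> j)) * cmod (f w)"
      using max_modulus_on_sequence[OF A(2) _ hol, of "{..<k}" L z] zero tl R unfolding R_def by auto
    \<comment> \<open>For fixed z the product is comparable from above with the product of the
      moduli, since the sum of |z| / |\<sigma>_j| is bounded.\<close>
    have 2: "(\<Prod>j<k. cmod (z - \<sigma> j)) \<le> exp ((\<Sum>j<k. tau j) + cmod z * exp (- tau 0) * A)"
    proof -
      have "(\<Prod>j<k. cmod (z - \<sigma> j)) \<le> (\<Prod>j<k. exp (tau j + cmod z * exp (- tau 0) * exp (- 1 * \<bar>tau 0 - tau j\<bar>)))"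
      proof (intro prod_mono conjI)
        fix j assume "j \<in> {..<k}"
        have "cmod (z - \<sigma> j) \<le> cmod z + exp (tau j)" using norm_triangle_ineq4[of z "\<sigma> j"] by (simp add: norm_sigma)
        also have "\<dots> = exp (tau j) * (1 + cmod z * exp (- tau j))" by (simp add: algebra_simps flip: exp_add)
        also have "\<dots> \<le> exp (tau j) * exp (cmod z * exp (- tau j))" by (intro mult_left_mono) auto
        also have "exp (- tau j) = exp (- tau 0) * exp (- 1 * \<bar>tau 0 - tau j\<bar>)"
          using tau_mono[of 0 j] by (simp flip: exp_add)
        finally show "cmod (z - \<sigma> j) \<le> exp (tau j + cmod z * exp (- tau 0) * exp (- 1 * \<bar>tau 0 - tau j\<bar>))"
          by (simp add: exp_add mult.assoc)
      qed simp
      also have "\<dots> = exp ((\<Sum>j<k. tau j) + cmod z * exp (- tau 0) * (\<Sum>j<k. exp (- 1 * \<bar>tau 0 - tau j\<bar>)))"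
        by (simp add: exp_sum[symmetric] sum.distrib sum_distrib_left)
      also have "\<dots> \<le> exp ((\<Sum>j<k. tau j) + cmod z * exp (- tau 0) * A)"
        using A(2)[of "{..<k}" "tau 0"] by (simp add: mult_left_mono)
      finally show ?thesis .
    qed
    have 3: "cmod (f w) \<le> W * exp (pot L)"
    proof -
      have "wval f w \<le> W" unfolding W_def using w R by (intro wval_le_of_fnorm hol K) auto
      then show ?thesis using w by (simp add: wval_def R_def exp_minus field_simps)
    qed
    have W0: "W \<ge> 0" by (simp add: W_def)
    have "cmod (f z) * exp (real k * L) \<le> exp (2 * A) * exp ((\<Sum>j<k. tau j) + cmod z * exp (- tau 0) * A) * (W * exp (pot L))"
      using 2 3 W0 by (intro order_trans[OF mm] mult_mono) (auto intro!: prod_nonneg)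
    also have "\<dots> = exp (2 * A + cmod z * exp (- tau 0) * A) * W * exp ((\<Sum>j<k. tau j) + pot L)"
      by (simp add: exp_add mult_ac)
    finally have main: "cmod (f z) * exp (real k * L) \<le> exp (2 * A + cmod z * exp (- tau 0) * A) * W * exp ((\<Sum>j<k. tau j) + pot L)" .
    have lev: "level k = (real k * L - pot L) - (\<Sum>j<k. tau j) + \<alpha> * b\<^sup>2"
      using linear_minus_pot[of k L] by (simp add: level_def L_def)
    have "cmod (f z) * exp (level k) = cmod (f z) * exp (real k * L) * exp (- ((\<Sum>j<k. tau j) + pot L) + \<alpha> * b\<^sup>2)"
      by (simp add: lev mult.assoc flip: exp_add)
    also have "\<dots> \<le> exp (2 * A + cmod z * exp (- tau 0) * A) * W * exp ((\<Sum>j<k. tau j) + pot L) * exp (- ((\<Sum>j<k. tau j) + pot L) + \<alpha> * b\<^sup>2)"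
      using main by (intro mult_right_mono) auto
    also have "\<dots> = Q" unfolding Q_def by (simp add: mult.assoc flip: exp_add)
    finally show ?thesis .
  qed
  obtain k :: nat where k: "real k > max (ln (max 1 (cmod z)) / h) ((Q / cmod (f z) + C) / \<epsilon>)"
    using reals_Archimedean2 by blast
  have "real k * h > ln (max 1 (cmod z))" using k h_pos by (simp add: pos_divide_less_eq)
  moreover have "node k \<ge> real k * h" using h_pos p_pos by (simp add: node_def algebra_simps)
  ultimately have "cmod (f z) * exp (level k) \<le> Q" by (intro bound) linarith
  then have "exp (level k) \<le> Q / cmod (f z)" using fz by (simp add: field_simps)
  then have "level k \<le> Q / cmod (f z)" using exp_ge_add_one_self[of "level k"] by linarith
  moreover have "level k \<ge> \<epsilon> * real k - C"
  proof -
    have "\<bar>\<Sum>j<k. dev j\<bar> \<le> (h/2 - \<epsilon>) * real k + C" using dr[of 0 k] by simp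
    moreover have "level k \<ge> h / 2 * real k - (\<Sum>j<k. dev j)" using h_pos by (simp add: level_eq algebra_simps)
    ultimately show ?thesis by (simp add: algebra_simps)
  qed
  moreover have "\<epsilon> * real k > Q / cmod (f z) + C" using k eps by (simp add: pos_divide_less_eq mult.commute)
  ultimately show False by linarith
qed

theorem complete_interpolating_if:
  assumes sep: "rel_separated \<sigma>" and bd: "bounded (range dev)" and drift: "small_drift (h / 2) dev"
  shows "complete_interpolating p (log_weight \<alpha>) (range \<sigma>)"
proof -
  obtain B where B: "\<And>n. \<bar>dev n\<bar> \<le> B" using bd by (auto simp: bounded_iff)
  obtain C1 where C1: "C1 > 0" and int: "\<And>v K. ssum_le v K \<Longrightarrow>
    (\<exists>f\<in>fspace. (\<forall>n. f (\<sigma> n) = v n) \<and> fnorm f \<le> ennreal (C1 * K))"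
    using interpolation_with_bound[OF sep B drift] by blast
  obtain C2 where C2: "C2 > 0" and up: "\<And>f K. f holomorphic_on UNIV \<Longrightarrow> 0 \<le> K \<Longrightarrow> fnorm f \<le> ennreal K \<Longrightarrow> ssum_le (\<lambda>n. f (\<sigma> n)) (C2 * K)"
    using ssum_le_of_fnorm[OF sep] by blast
  have low: "fnorm f \<le> ennreal (C1 * K)" if f: "f \<in> fspace" and K: "ssum_le (\<lambda>n. f (\<sigma> n)) K" for f K
  proof -
    obtain g where g: "g \<in> fspace" "\<And>n. g (\<sigma> n) = f (\<sigma> n)" "fnorm g \<le> ennreal (C1 * K)"
      using int[OF K] by blast
    have "f z - g z = 0" for z
    proof (rule uniqueness[OF B drift, where f = "\<lambda>z. f z - g z"])
      show "(\<lambda>z. f z - g z) \<in> fspace" using f g(1) by (rule fock_space_diff)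
    qed (simp add: g(2))
    then have "f z = g z" for z by (metis eq_iff_diff_eq_0)
    then have "f = g" by (rule ext)
    with g show ?thesis by simp
  qed
  define C where "C = max C1 C2"
  have C: "C > 0" "C1 \<le> C" "C2 \<le> C" using C1 by (auto simp: C_def)
  have "sampling p (log_weight \<alpha>) (range \<sigma>)"
  proof (rule samplingI[OF C(1)])
    fix f K assume f: "f \<in> fspace" and K: "K \<ge> (0::real)"
    { assume "fnorm f \<le> ennreal K"
      then have "ssum_le (\<lambda>n. f (\<sigma> n)) (C2 * K)" using up f K by (auto simp: fock_space_def)
      moreover have "C2 * K \<le> C * K" using C K by (intro mult_right_mono)
      ultimately show "ssum_le (\<lambda>n. f (\<sigma> n)) (C * K)" unfolding ssum_le_def by (meson order_trans) }
    { assume "ssum_le (\<lambda>n. f (\<sigma> n)) K"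
      then have "fnorm f \<le> ennreal (C1 * K)" by (rule low[OF f])
      also have "\<dots> \<le> ennreal (C * K)" using C K by (intro ennreal_leI mult_right_mono)
      finally show "fnorm f \<le> ennreal (C * K)" . }
  qed
  moreover have "interpolating p (log_weight \<alpha>) (range \<sigma>)" unfolding interpolating_iff using int by blast
  ultimately show ?thesis by (simp add: complete_interpolating_def)
qed

end

section \<open>Necessity: dual systems and vanishing polynomials\<close>

text \<open>The reversed polynomial, the product of the 1 - a z, equals 1 at 0. By the maximum
  principle it has modulus at least 1 somewhere on |v| = 1 / R, and w = 1 / v is the required
  point.\<close>

lemma monic_max_on_circle:
  assumes fin: "finite A" and R: "R > 0"
  obtains w where "cmod w = R" "R ^ card A \<le> (\<Prod>a\<in>A. cmod (w - a))"
proof -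
  define Q where "Q z = (\<Prod>a\<in>A. 1 - a * z)" for z :: complex
  have hol: "Q holomorphic_on UNIV" unfolding Q_def[abs_def] by (intro holomorphic_intros)
  obtain v where v: "cmod v = 1 / R" "cmod (Q 0) \<le> cmod (Q v)"
    using max_modulus_circle[OF hol, of "1/R" 0] R by auto
  have v0: "v \<noteq> 0" using v R by auto
  have "R ^ card A * 1 \<le> R ^ card A * cmod (Q v)" using v R by (intro mult_left_mono) (auto simp: Q_def)
  also have "\<dots> = (\<Prod>a\<in>A. R * cmod (1 - a * v))" by (simp add: Q_def prod.distrib flip: prod_norm)
  also have "\<dots> = (\<Prod>a\<in>A. cmod (1 / v - a))"
  proof (rule prod.cong[OF refl])
    fix a
    have "1 / v - a = (1 - a * v) / v" using v0 by (simp add: field_simps)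
    then show "R * cmod (1 - a * v) = cmod (1 / v - a)" using v R by (simp add: norm_divide)
  qed
  finally show thesis using v R by (intro that[of "1 / v"]) (auto simp: norm_divide)
qed

context fock_seq
begin

section \<open>Functions of polynomial growth and the dual system\<close>

lemma node_mono: "i \<le> j \<Longrightarrow> node i \<le> node j"
  using h_pos by (simp add: node_def)

lemma node_step:
  assumes "i < j"
  shows "node i + h \<le> node j"
proof -
  have "h * 1 \<le> h * (real j - real i)" using assms h_pos by (intro mult_left_mono) auto
  then show ?thesis using node_diff[of j i] by simp
qed

text \<open>A Gaussian is dominated by a two-sided exponential, which brings it within the scope of
  \<open>sum_exp_dist_le\<close>.\<close>

lemma neg_square_le: "- \<alpha> * x\<^sup>2 \<le> 1 / (4 * \<alpha>) - \<bar>x\<bar>"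
proof -
  have "0 \<le> \<alpha> * (\<bar>x\<bar> - 1 / (2 * \<alpha>))\<^sup>2" using alpha_pos by simp
  also have "\<dots> = \<alpha> * x\<^sup>2 - \<bar>x\<bar> + 1 / (4 * \<alpha>)"
    using alpha_pos by (simp add: power2_eq_square field_simps)
  finally show ?thesis by simp
qed

text \<open>By \<open>linear_minus_pot\<close>, the weighted size of z^N is a Gaussian in ln |z|
  centred at \<open>node N\<close>, with peak exp (\<alpha> (node N)^2). Its decay away from the
  peak is uniform in N.\<close>

lemma fnorm_le_of_power_bound:
  "\<exists>C>0. \<forall>f N Q. f holomorphic_on UNIV \<longrightarrow> (\<forall>z. 1 \<le> cmod z \<longrightarrow> cmod (f z) \<le> Q * cmod z ^ N) \<longrightarrow>
    fnorm f \<le> ennreal (C * (Q * exp (\<alpha> * (node N)\<^sup>2)) powr p)"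
proof -
  define C1 where "C1 = pi + pi * exp 4"
  have C1: "C1 > 0" unfolding C1_def by (intro add_pos_pos) auto
  obtain A where A: "A > 0" "\<And>t F. finite F \<Longrightarrow> (\<Sum>j\<in>F. exp (- p * \<bar>t - real j\<bar>)) \<le> A"
    using sum_exp_dist_le[OF lin_growth_of_nat p_pos] by auto
  define D where "D = exp (1 / (4 * \<alpha>) + 1)"
  have Q0: "Q \<ge> 0" if "\<forall>z. 1 \<le> cmod z \<longrightarrow> cmod (f z) \<le> Q * cmod z ^ N" for f :: "complex \<Rightarrow> complex" and N Q
  proof -
    have "cmod (f 1) \<le> Q" using that[rule_format, of 1] by simp
    then show ?thesis using norm_ge_zero order_trans by blast
  qed
  have main: "fnorm f \<le> ennreal (C1 * ((Q * exp (\<alpha> * (node N)\<^sup>2) * D) powr p * A))"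
    if f: "f holomorphic_on UNIV" and le: "\<forall>z. 1 \<le> cmod z \<longrightarrow> cmod (f z) \<le> Q * cmod z ^ N" for f N Q
    unfolding C1_def
  proof (rule fnorm_le[OF f, where M = "\<lambda>k. Q * exp (\<alpha> * (node N)\<^sup>2) * D * exp (- \<bar>node N - real k\<bar>)"])
    note Q = Q0[OF le]
    fix k :: nat and z :: complex assume z: "z \<noteq> 0" "real k \<le> ln (cmod z)" "ln (cmod z) \<le> real k + 1"
    define t where "t = ln (cmod z)"
    have "0 \<le> t" using z(2) unfolding t_def by linarith
    then have z1: "1 \<le> cmod z" using z(1) by (simp add: t_def)
    have zt: "cmod z = exp t" using z by (simp add: t_def)
    have "wval f z \<le> Q * cmod z ^ N * exp (- pot t)"
      unfolding wval_def t_def using le z1 by (intro mult_right_mono) auto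
    also have "\<dots> = Q * exp (real N * t - pot t)"       by (simp add: zt exp_of_nat_mult[symmetric] exp_diff exp_minus divide_inverse)
    also have "\<dots> \<le> Q * exp (\<alpha> * (node N)\<^sup>2 + (1 / (4 * \<alpha>) + 1) - \<bar>node N - real k\<bar>)"
      using neg_square_le[of "t - node N"] z Q unfolding linear_minus_pot t_def[symmetric]
      by (intro mult_left_mono) auto
    also have "\<dots> = Q * exp (\<alpha> * (node N)\<^sup>2) * D * exp (- \<bar>node N - real k\<bar>)"
      unfolding D_def by (simp add: mult.assoc flip: exp_add)
    finally show "wval f z \<le> Q * exp (\<alpha> * (node N)\<^sup>2) * D * exp (- \<bar>node N - real k\<bar>)" .
  next
    note Q = Q0[OF le]
    fix n :: nat
    have "(\<Sum>k<n. (Q * exp (\<alpha> * (node N)\<^sup>2) * D * exp (- \<bar>node N - real k\<bar>)) powr p)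
      = (Q * exp (\<alpha> * (node N)\<^sup>2) * D) powr p * (\<Sum>k<n. exp (- p * \<bar>node N - real k\<bar>))"
      unfolding sum_distrib_left using Q
      by (intro sum.cong refl) (simp add: powr_mult exp_powr_real D_def mult_ac)
    also have "\<dots> \<le> (Q * exp (\<alpha> * (node N)\<^sup>2) * D) powr p * A" using A by (intro mult_left_mono) auto
    finally show "(\<Sum>k<n. (Q * exp (\<alpha> * (node N)\<^sup>2) * D * exp (- \<bar>node N - real k\<bar>)) powr p)
      \<le> (Q * exp (\<alpha> * (node N)\<^sup>2) * D) powr p * A" .
  qed
  have "fnorm f \<le> ennreal (C1 * D powr p * A * (Q * exp (\<alpha> * (node N)\<^sup>2)) powr p)"
    if f: "f holomorphic_on UNIV" and le: "\<forall>z. 1 \<le> cmod z \<longrightarrow> cmod (f z) \<le> Q * cmod z ^ N" for f N Q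
  proof -
    note Q = Q0[OF le]
    have eq: "C1 * ((Q * exp (\<alpha> * (node N)\<^sup>2) * D) powr p * A) = C1 * D powr p * A * (Q * exp (\<alpha> * (node N)\<^sup>2)) powr p"
      using Q by (simp add: powr_mult D_def mult_ac)
    show ?thesis using main[OF that] unfolding eq .
  qed
  then show ?thesis using C1 A by (intro exI[of _ "C1 * D powr p * A"] conjI) (auto simp: D_def)
qed

definition dual_system :: "(nat \<Rightarrow> complex \<Rightarrow> complex) \<Rightarrow> real \<Rightarrow> bool"
  where "dual_system L C \<longleftrightarrow> C > 0 \<and> (\<forall>n. L n \<in> fspace \<and>
    (\<forall>j. L n (\<sigma> j) = (if j = n then 1 else 0)) \<and> fnorm (L n) \<le> ennreal (C * exp (- pot (tau n)) powr p))"

text \<open>Interpolation of unit data gives the functions. Their norm bound, with C independent of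
  n, is the lower sampling inequality applied to them, so the open mapping theorem is avoided; exp
  (- pot (tau n)) powr p is the p-th power of the norm of the data.\<close>

lemma dual_system_exists:
  assumes ci: "complete_interpolating p (log_weight \<alpha>) (range \<sigma>)"
  shows "\<exists>L C. dual_system L C"
proof -
  obtain C where C: "C > 0" and s: "\<And>f K. f \<in> fspace \<Longrightarrow> K \<ge> 0 \<Longrightarrow>
    ssum_le (\<lambda>n. f (\<sigma> n)) K \<Longrightarrow> fnorm f \<le> ennreal (C * K)"
    using sampling_imp ci unfolding complete_interpolating_def by blast
  have int: "\<And>v K. ssum_le v K \<Longrightarrow> (\<exists>f\<in>fspace. \<forall>n. f (\<sigma> n) = v n)"
    using ci unfolding complete_interpolating_def interpolating_iff by blast
  have "\<exists>f. f \<in> fspace \<and> (\<forall>j. f (\<sigma> j) = (if j = n then 1 else 0)) \<and>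
    fnorm f \<le> ennreal (C * exp (- pot (tau n)) powr p)" for n
  proof -
    have ss: "ssum_le (\<lambda>j. if j = n then 1 else 0) (exp (- pot (tau n)) powr p)"
      unfolding ssum_le_def
    proof (intro allI impI)
      fix F :: "nat set" assume F: "finite F"
      have "(\<Sum>j\<in>F. (cmod (if j = n then 1 else 0) * exp (- pot (tau j))) powr p)
        = (\<Sum>j\<in>F. if j = n then exp (- pot (tau n)) powr p else 0)"
        by (intro sum.cong) auto
      also have "\<dots> \<le> exp (- pot (tau n)) powr p" using F by (simp add: sum.delta)
      finally show "(\<Sum>j\<in>F. (cmod (if j = n then 1 else 0) * exp (- pot (tau j))) powr p) \<le> exp (- pot (tau n)) powr p" .
    qed
    obtain f where f: "f \<in> fspace" "\<And>j. f (\<sigma> j) = (if j = n then 1 else 0)"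
      using int[OF ss] by blast
    moreover have "fnorm f \<le> ennreal (C * exp (- pot (tau n)) powr p)"
      using s[OF f(1), of "exp (- pot (tau n)) powr p"] ss by (simp add: f(2))
    ultimately show ?thesis by blast
  qed
  then obtain L where "\<And>n. L n \<in> fspace \<and> (\<forall>j. L n (\<sigma> j) = (if j = n then 1 else 0)) \<and>
    fnorm (L n) \<le> ennreal (C * exp (- pot (tau n)) powr p)" by metis
  then show ?thesis using C unfolding dual_system_def by blast
qed

lemma dual_pointwise:
  assumes L: "dual_system L C" and m: "m > 0"
  shows "\<exists>D>0. \<forall>n z. m \<le> cmod z \<longrightarrow> wval (L n) z \<le> D * exp (- pot (tau n))"
proof -
  define C1 where "C1 = ptw_const m (1/2)"
  have C1: "C1 > 0" by (simp add: C1_def ptw_const_pos)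
  have C: "C > 0" using L by (simp add: dual_system_def)
  have "wval (L n) z \<le> (C1 * C) powr (1 / p) * exp (- pot (tau n))" if "m \<le> cmod z" for n z
  proof -
    have "wval (L n) z \<le> (C1 * (C * exp (- pot (tau n)) powr p)) powr (1 / p)"
      unfolding C1_def using L C that m by (intro wval_le_of_fnorm) (auto simp: dual_system_def fock_space_def)
    also have "\<dots> = (C1 * C) powr (1 / p) * exp (- pot (tau n))"
      using C C1 p_pos by (simp add: powr_mult powr_powr exp_powr_real mult.assoc)
    finally show ?thesis .
  qed
  then show ?thesis using C C1 by (intro exI[of _ "(C1 * C) powr (1 / p)"]) auto
qed

lemma pot_diff: "pot (t + u) - pot t = (2 * \<alpha> * t - 2 / p) * u + \<alpha> * u\<^sup>2"
  using p_pos by (simp add: pot_def power2_eq_square field_simps)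

text \<open>The factor (\<sigma>_n / z)^N, with N near the slope of \<open>pot\<close> at
  \<open>tau n\<close>, flattens the weight, so g is bounded by a constant M independent of n on the
  disc of radius |\<sigma>_n| / 2. Since g is 1 at \<sigma>_n and 0 at \<sigma>_j, the Lipschitz
  bound keeps the two points apart.\<close>

lemma rel_separated_of_dual:
  assumes L: "dual_system L C"
  shows "rel_separated \<sigma>"
proof -
  have m: "cmod (\<sigma> 0) / 2 > 0" using sigma_nonzero by simp
  obtain D where D: "D > 0" and pt: "\<And>n z. cmod (\<sigma> 0) / 2 \<le> cmod z \<Longrightarrow> wval (L n) z \<le> D * exp (- pot (tau n))"
    using dual_pointwise[OF L m] by blast
  define E where "E = 1 + \<bar>2 * \<alpha> * tau 0 - 2 / p\<bar>"
  define M where "M = D * exp (E + \<alpha>)"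
  have M: "M > 0" using D by (simp add: M_def)
  define c where "c = min (1 / (8 * M)) (1 / 4)"
  have c: "c > 0" "c \<le> 1 / (8 * M)" "c \<le> 1 / 4" using M by (auto simp: c_def)
  have one: "c * cmod (\<sigma> n) \<le> cmod (\<sigma> j - \<sigma> n)" if "j \<noteq> n" for j n
  proof -
    define r where "r = cmod (\<sigma> n) / 2"
    have r: "r > 0" using sigma_nonzero by (simp add: r_def)
    define x where "x = 2 * \<alpha> * tau n - 2 / p"
    \<comment> \<open>For negative x this is 0. Then x still lies above its value at
      \<open>tau 0\<close>, which is why that value enters E.\<close>
    define N where "N = nat \<lfloor>x\<rfloor>"
    have N: "\<bar>real N - x\<bar> \<le> E"
    proof (cases "x \<ge> 0")
      case True
      then have "real N = of_int \<lfloor>x\<rfloor>" by (simp add: N_def)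
      then have "\<bar>real N - x\<bar> \<le> 1" by linarith
      then show ?thesis unfolding E_def by linarith
    next
      case False
      then have "N = 0" by (simp add: N_def)
      moreover have "2 * \<alpha> * tau 0 \<le> 2 * \<alpha> * tau n" using alpha_pos tau_mono[of 0 n] by simp
      ultimately show ?thesis using False unfolding E_def x_def by simp
    qed
    define g where "g z = L n z * (\<sigma> n / z) ^ N" for z
    have Lh: "L n holomorphic_on UNIV" using L by (simp add: dual_system_def fock_space_def)
    have far: "r < cmod z \<and> cmod z < 2 * cmod (\<sigma> n)" if "z \<in> ball (\<sigma> n) r" for z
    proof -
      have "cmod (\<sigma> n - z) < r" using that by (simp add: dist_norm)
      then show ?thesis using norm_triangle_ineq2[of "\<sigma> n" z] norm_triangle_ineq2[of z "\<sigma> n"] norm_minus_commute[of z "\<sigma> n"] r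
        unfolding r_def by linarith
    qed
    have "0 \<notin> ball (\<sigma> n) r" using far[of 0] r by auto
    then have gh: "g holomorphic_on ball (\<sigma> n) r" unfolding g_def
      by (intro holomorphic_intros holomorphic_on_subset[OF Lh]) auto
    have gb: "cmod (g z) \<le> M" if z: "z \<in> ball (\<sigma> n) r" for z
    proof -
      define u where "u = ln (cmod z) - tau n"
      have z0: "cmod z > 0" using far[OF z] r by linarith
      have u_eq: "u = ln (cmod z / cmod (\<sigma> n))" using z0 sigma_nonzero[of n] by (simp add: u_def tau_def ln_div)
      have "u \<le> ln 2" unfolding u_eq using far[OF z] z0 sigma_nonzero[of n]
        by (subst ln_le_cancel_iff) (auto simp: field_simps)
      moreover have "ln (1/2) \<le> u" unfolding u_eq using far[OF z] z0 sigma_nonzero[of n]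
        by (subst ln_le_cancel_iff) (auto simp: field_simps r_def)
      ultimately have u1: "\<bar>u\<bar> \<le> 1" using ln_2_less_1 by (simp add: ln_div)
      have lz: "ln (cmod z) = tau n + u" by (simp add: u_def)
      have "cmod (\<sigma> 0) / 2 \<le> cmod z" using far[OF z] norm_sigma_mono[of 0 n] unfolding r_def by simp
      from pt[OF this, of n] have "cmod (L n z) \<le> D * exp (pot (tau n + u) - pot (tau n))"
        unfolding wval_def lz by (simp add: exp_diff exp_minus field_simps)
      moreover have "cmod ((\<sigma> n / z) ^ N) = exp (- (real N * u))"
      proof -
        have "cmod (\<sigma> n / z) = exp (- u)" using u_eq z0 sigma_nonzero[of n] by (simp add: exp_minus norm_divide)
        then show ?thesis by (simp add: norm_power exp_of_nat_mult[symmetric])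
      qed
      ultimately have "cmod (g z) \<le> D * exp (pot (tau n + u) - pot (tau n)) * exp (- (real N * u))"
        unfolding g_def norm_mult by (simp add: mult_right_mono)
      also have "\<dots> = D * exp ((x - real N) * u + \<alpha> * u\<^sup>2)"
        unfolding pot_diff x_def by (simp add: mult.assoc algebra_simps flip: exp_add)
      also have "\<dots> \<le> M"
      proof -
        have "(x - real N) * u \<le> \<bar>x - real N\<bar> * \<bar>u\<bar>" by (metis abs_ge_self abs_mult)
        also have "\<dots> \<le> E * 1" using N u1 by (intro mult_mono) auto
        finally have "(x - real N) * u \<le> E" by simp
        moreover have "\<alpha> * u\<^sup>2 \<le> \<alpha> * 1" using alpha_pos u1 by (intro mult_left_mono) (auto simp: abs_square_le_1)
        ultimately show ?thesis unfolding M_def using D by (intro mult_left_mono) auto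
      qed
      finally show ?thesis .
    qed
    have gn: "g (\<sigma> n) = 1" using L sigma_nonzero[of n] by (simp add: g_def dual_system_def)
    have gj: "g (\<sigma> j) = 0" using L that by (simp add: g_def dual_system_def)
    show ?thesis
    proof (cases "\<sigma> j \<in> ball (\<sigma> n) (r / 2)")
      case True
      have "cmod (g (\<sigma> j) - g (\<sigma> n)) \<le> 4 * M / r * cmod (\<sigma> j - \<sigma> n)"
        by (rule holomorphic_bounded_lipschitz[OF gh gb r True])
      then have "r \<le> 4 * M * cmod (\<sigma> j - \<sigma> n)" using gn gj r by (simp add: field_simps)
      then have "cmod (\<sigma> n) / (8 * M) \<le> cmod (\<sigma> j - \<sigma> n)" using M by (simp add: r_def field_simps)
      moreover have "c * cmod (\<sigma> n) \<le> 1 / (8 * M) * cmod (\<sigma> n)" using c by (intro mult_right_mono) auto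
      ultimately show ?thesis by simp
    next
      case False
      then have "cmod (\<sigma> n) / 4 \<le> cmod (\<sigma> j - \<sigma> n)" by (simp add: dist_norm r_def norm_minus_commute)
      moreover have "c * cmod (\<sigma> n) \<le> 1 / 4 * cmod (\<sigma> n)" using c by (intro mult_right_mono) auto
      ultimately show ?thesis by simp
    qed
  qed
  have "c * max (cmod (\<sigma> i)) (cmod (\<sigma> j)) \<le> cmod (\<sigma> i - \<sigma> j)" if "i \<noteq> j" for i j
    using one[OF that] one[of j i] that by (simp add: max_def norm_minus_commute)
  then show "rel_separated \<sigma>" using c(1) unfolding rel_separated_def by blast
qed

section \<open>Linear growth and one-sided bounds for the deviations\<close>

lemma lin_growth_of_blocks:
  assumes M: "M \<ge> 1" and d: "d > 0" and le: "\<And>n. tau n + d \<le> tau (n + M)"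
  shows "lin_growth (d / real M) d tau"
proof -
  have it: "tau n + real i * d \<le> tau (n + i * M)" for n i
  proof (induction i)
    case (Suc i)
    have "tau (n + i * M) + d \<le> tau (n + i * M + M)" by (rule le)
    then show ?case using Suc by (simp add: algebra_simps)
  qed simp
  have "d / real M * (real j - real n) - d \<le> tau j - tau n" if "n \<le> j" for n j
  proof -
    define i where "i = (j - n) div M"
    have "i * M \<le> j - n" by (simp add: i_def)
    then have 1: "tau n + real i * d \<le> tau j" using it[of n i] tau_mono[of "n + i * M" j] that by linarith
    have "j - n < (i + 1) * M" using M dividend_less_div_times[of M "j - n"] by (simp add: i_def algebra_simps)
    then have "real (j - n) < (real i + 1) * real M" by (metis of_nat_1 of_nat_add of_nat_less_iff of_nat_mult)
    then have "d * (real j - real n) \<le> d * ((real i + 1) * real M)" using d that by (intro mult_left_mono) (auto simp: of_nat_diff)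
    then have "d / real M * (real j - real n) \<le> (real i + 1) * d" using M by (simp add: field_simps)
    then show ?thesis using 1 by (simp add: algebra_simps)
  qed
  then show ?thesis using M d mono_tau by (simp add: lin_growth_def)
qed

text \<open>The upper sampling inequality is tested on the monomials z^N. After division by the
  Gaussian peak it bounds the sum over n of exp (- p \<alpha> (tau n - node N)^2) uniformly in N, so
  a window of length h contains only boundedly many \<open>tau n\<close>.\<close>

lemma lin_growth_of_sampling:
  assumes "sampling p (log_weight \<alpha>) (range \<sigma>)"
  shows "\<exists>\<kappa> c. lin_growth \<kappa> c tau"
proof -
  obtain C where C: "C > 0" and s: "\<And>f K. f \<in> fspace \<Longrightarrow> K \<ge> 0 \<Longrightarrow>
    fnorm f \<le> ennreal K \<Longrightarrow> ssum_le (\<lambda>n. f (\<sigma> n)) (C * K)"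
    using sampling_imp[OF assms] by blast
  obtain C1 where C1: "C1 > 0" and fn: "\<And>f N Q. f holomorphic_on UNIV \<Longrightarrow> (\<forall>z. 1 \<le> cmod z \<longrightarrow> cmod (f z) \<le> Q * cmod z ^ N) \<Longrightarrow>
    fnorm f \<le> ennreal (C1 * (Q * exp (\<alpha> * (node N)\<^sup>2)) powr p)"
    using fnorm_le_of_power_bound by blast
  have gauss: "(\<Sum>n\<in>F. exp (- \<alpha> * (tau n - node N)\<^sup>2) powr p) \<le> C * C1" if F: "finite F" for F N
  proof -
    let ?P = "exp (\<alpha> * (node N)\<^sup>2)"
    have hol: "(\<lambda>z::complex. z ^ N) holomorphic_on UNIV" by (intro holomorphic_intros)
    have n: "fnorm (\<lambda>z. z ^ N) \<le> ennreal (C1 * ?P powr p)"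
      using fn[OF hol, of 1 N] by (simp add: norm_power)
    then have "ssum_le (\<lambda>n. \<sigma> n ^ N) (C * (C1 * ?P powr p))"
      using C1 hol by (intro s) (auto simp: fock_space_def intro: le_less_trans)
    then have "(\<Sum>n\<in>F. (cmod (\<sigma> n ^ N) * exp (- pot (tau n))) powr p) \<le> C * (C1 * ?P powr p)"
      using F unfolding ssum_le_def by blast
    moreover have "cmod (\<sigma> n ^ N) * exp (- pot (tau n)) = ?P * exp (- \<alpha> * (tau n - node N)\<^sup>2)" for n
    proof -
      have "cmod (\<sigma> n ^ N) * exp (- pot (tau n)) = exp (real N * tau n - pot (tau n))"
        by (simp add: norm_power norm_sigma exp_diff exp_minus exp_of_nat_mult field_simps)
      then show ?thesis unfolding linear_minus_pot by (simp flip: exp_add)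
    qed
    ultimately have "?P powr p * (\<Sum>n\<in>F. exp (- \<alpha> * (tau n - node N)\<^sup>2) powr p) \<le> ?P powr p * (C * C1)"
      by (simp add: powr_mult sum_distrib_left mult_ac)
    then show ?thesis by simp
  qed
  \<comment> \<open>Every \<open>tau n\<close> is within h + |node 0 - tau 0| of some node; the
    absolute value covers points to the left of node 0. The other h is the length of the
    window.\<close>
  define H where "H = h + \<bar>node 0 - tau 0\<bar> + h"
  define e where "e = exp (- \<alpha> * H\<^sup>2) powr p"
  have e: "e > 0" by (simp add: e_def)
  have count: "real (j - n + 1) * e \<le> C * C1" if nj: "n \<le> j" "tau j < tau n + h" for n j
  proof -
    obtain N where N: "\<bar>tau n - node N\<bar> \<le> h + \<bar>node 0 - tau 0\<bar>"
    proof (cases "tau n \<le> node 0")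
      case True
      then show ?thesis using tau_mono[of 0 n] h_pos by (intro that[of 0]) linarith
    next
      case False
      define N where "N = nat \<lfloor>(tau n - node 0) / h\<rfloor>"
      have "real N = of_int \<lfloor>(tau n - node 0) / h\<rfloor>" using False h_pos by (simp add: N_def)
      then have "real N \<le> (tau n - node 0) / h" "(tau n - node 0) / h < real N + 1" by linarith+
      then have "real N * h \<le> tau n - node 0" "tau n - node 0 < real N * h + h" using h_pos
        by (simp_all add: pos_le_divide_eq pos_divide_less_eq algebra_simps)
      moreover have "node N - node 0 = real N * h" by (simp add: node_diff)
      ultimately show ?thesis by (intro that[of N]) linarith
    qed
    have "real (j - n + 1) * e = (\<Sum>i\<in>{n..j}. e)" using nj by simp
    also have "\<dots> \<le> (\<Sum>i\<in>{n..j}. exp (- \<alpha> * (tau i - node N)\<^sup>2) powr p)"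
    proof (rule sum_mono)
      fix i assume i: "i \<in> {n..j}"
      then have "tau n \<le> tau i" "tau i \<le> tau j" using tau_mono by auto
      then have "\<bar>tau i - node N\<bar> \<le> \<bar>H\<bar>" using N nj h_pos unfolding H_def by linarith
      then have "(tau i - node N)\<^sup>2 \<le> H\<^sup>2" by (simp add: abs_le_square_iff)
      then show "e \<le> exp (- \<alpha> * (tau i - node N)\<^sup>2) powr p"
        unfolding e_def using alpha_pos p_pos by (intro powr_mono2) auto
    qed
    also have "\<dots> \<le> C * C1" by (rule gauss) simp
    finally show ?thesis .
  qed
  obtain M :: nat where M: "real M > C * C1 / e" using reals_Archimedean2 by blast
  have "C * C1 / e > 0" using C C1 e by simp
  then have M1: "M \<ge> 1" using M by (cases M) auto
  have "tau n + h \<le> tau (n + M)" for n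
  proof (rule ccontr)
    assume "\<not> ?thesis"
    then have "real (n + M - n + 1) * e \<le> C * C1" by (intro count) auto
    then have "real M * e + e \<le> C * C1" by (simp add: algebra_simps)
    moreover have "C * C1 < real M * e" using M e by (simp add: field_simps)
    ultimately show False using e by linarith
  qed
  then show ?thesis using lin_growth_of_blocks[OF M1 h_pos] by blast
qed

text \<open>The function L n has modulus 1 at \<sigma>_n and zeros at the other points, so the
  Jensen-type inequality forces it to be large somewhere on |w| = e^T. The error is made up of 2 A
  from that inequality and A from the upper bound for the |\<sigma>_n - \<sigma>_j|.\<close>

lemma dual_growth:
  assumes L: "dual_system L C" and lg: "lin_growth \<kappa> c tau"
  shows "\<exists>A. \<forall>n k T. (\<forall>j<k. tau j + ln 2 \<le> T) \<longrightarrow> tau n \<le> T \<longrightarrow> (\<exists>w. cmod w = exp T \<and>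
    exp (real (card ({..<k} - {n})) * T - (\<Sum>j\<in>{..<k} - {n}. max (tau n) (tau j)) - A - pot T) \<le> wval (L n) w)"
proof -
  obtain A where A: "A > 0" "\<And>t F. finite F \<Longrightarrow> (\<Sum>j\<in>F. exp (- 1 * \<bar>t - tau j\<bar>)) \<le> A"
    using sum_exp_dist_le[OF lg, of 1] by auto
  have "\<exists>w. cmod w = exp T \<and>
    exp (real (card ({..<k} - {n})) * T - (\<Sum>j\<in>{..<k} - {n}. max (tau n) (tau j)) - 3 * A - pot T) \<le> wval (L n) w"
    if T: "\<forall>j<k. tau j + ln 2 \<le> T" and Tn: "tau n \<le> T" for n k T
  proof -
    let ?I = "{..<k} - {n}"
    have hol: "L n holomorphic_on UNIV" using L by (simp add: dual_system_def fock_space_def)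
    obtain w where w: "cmod w = exp T" and mm: "cmod (L n (\<sigma> n)) * exp (real (card ?I) * T)
       \<le> exp (2 * A) * (\<Prod>j\<in>?I. cmod (\<sigma> n - \<sigma> j)) * cmod (L n w)"
      using max_modulus_on_sequence[OF A(2) _ hol, of ?I T "\<sigma> n"] L T Tn by (auto simp: dual_system_def norm_sigma)
    have 2: "(\<Prod>j\<in>?I. cmod (\<sigma> n - \<sigma> j)) \<le> exp ((\<Sum>j\<in>?I. max (tau n) (tau j)) + A)"
    proof -
      have "(\<Prod>j\<in>?I. cmod (\<sigma> n - \<sigma> j)) \<le> (\<Prod>j\<in>?I. exp (max (tau n) (tau j) + exp (- 1 * \<bar>tau n - tau j\<bar>)))"
        using norm_diff_le[OF sigma_nonzero[of n]] by (intro prod_mono) (auto simp: tau_def[symmetric])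
      also have "\<dots> = exp ((\<Sum>j\<in>?I. max (tau n) (tau j)) + (\<Sum>j\<in>?I. exp (- 1 * \<bar>tau n - tau j\<bar>)))"
        by (simp add: exp_sum[symmetric] sum.distrib)
      also have "\<dots> \<le> exp ((\<Sum>j\<in>?I. max (tau n) (tau j)) + A)" using A(2)[of ?I "tau n"] by simp
      finally show ?thesis .
    qed
    have "exp (real (card ?I) * T) = cmod (L n (\<sigma> n)) * exp (real (card ?I) * T)"
      using L by (simp add: dual_system_def)
    also have "\<dots> \<le> exp (2 * A) * exp ((\<Sum>j\<in>?I. max (tau n) (tau j)) + A) * cmod (L n w)"
      using 2 by (intro order_trans[OF mm] mult_right_mono mult_left_mono) auto
    also have "\<dots> = exp ((\<Sum>j\<in>?I. max (tau n) (tau j)) + 3 * A + pot T) * wval (L n) w"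
      by (simp add: wval_def w exp_add exp_minus field_simps) (simp flip: exp_add)
    finally have "exp (real (card ?I) * T) \<le> exp ((\<Sum>j\<in>?I. max (tau n) (tau j)) + 3 * A + pot T) * wval (L n) w" .
    then have "exp (real (card ?I) * T) / exp ((\<Sum>j\<in>?I. max (tau n) (tau j)) + 3 * A + pot T) \<le> wval (L n) w"
      by (simp add: pos_divide_le_eq mult.commute)
    then show ?thesis using w by (intro exI[of _ w]) (simp add: exp_diff[symmetric] algebra_simps)
  qed
  then show ?thesis by blast
qed

text \<open>Between |\<sigma>_n| and the circle of twice that radius the n earlier zeros force
  growth by a factor of order 2^n, while the pointwise bound admits only an exponent close to (2
  \<alpha> tau n - 2 / p) ln 2. Hence 2 \<alpha> tau n cannot fall far below n + 2 / p = 2 \<alpha>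
  node n.\<close>

lemma dev_bounded_below:
  assumes L: "dual_system L C" and lg: "lin_growth \<kappa> c tau"
  shows "\<exists>B. \<forall>n. - B \<le> dev n"
proof -
  obtain A where A: "\<And>n k T. (\<forall>j<k. tau j + ln 2 \<le> T) \<Longrightarrow> tau n \<le> T \<Longrightarrow> (\<exists>w. cmod w = exp T \<and>
    exp (real (card ({..<k} - {n})) * T - (\<Sum>j\<in>{..<k} - {n}. max (tau n) (tau j)) - A - pot T) \<le> wval (L n) w)"
    using dual_growth[OF L lg] by blast
  have m: "cmod (\<sigma> 0) > 0" using sigma_nonzero by simp
  obtain D where D: "D > 0" and pt: "\<And>n z. cmod (\<sigma> 0) \<le> cmod z \<Longrightarrow> wval (L n) z \<le> D * exp (- pot (tau n))"
    using dual_pointwise[OF L m] by blast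
  define l where "l = ln (2::real)"
  have l: "l > 0" by (simp add: l_def)
  define B where "B = (A + ln D + \<alpha> * l\<^sup>2) / l / (2 * \<alpha>)"
  have "- B \<le> dev n" for n
  proof -
    have "\<forall>j<n. tau j + ln 2 \<le> tau n + l" using tau_mono by (auto simp: l_def)
    from A[OF this, of n] l obtain w where w: "cmod w = exp (tau n + l)" and
      ww: "exp (real (card ({..<n} - {n})) * (tau n + l) - (\<Sum>j\<in>{..<n} - {n}. max (tau n) (tau j)) - A - pot (tau n + l)) \<le> wval (L n) w"
      by auto
    have "(\<Sum>j\<in>{..<n} - {n}. max (tau n) (tau j)) = (\<Sum>j<n. tau n)"
      using tau_mono by (intro sum.cong) (auto simp: max_def order_antisym)
    then have "exp (real n * l - A - pot (tau n + l)) \<le> wval (L n) w" using ww by (simp add: algebra_simps)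
    also have "\<dots> \<le> D * exp (- pot (tau n))"
    proof (rule pt)
      have "cmod (\<sigma> 0) \<le> exp (tau n + l)" unfolding norm_sigma[of 0] using tau_mono[of 0 n] l by simp
      then show "cmod (\<sigma> 0) \<le> cmod w" by (simp add: w)
    qed
    also have "\<dots> = exp (ln D - pot (tau n))" using D by (simp add: exp_diff exp_minus divide_inverse)
    finally have "real n * l - A - (pot (tau n + l) - pot (tau n)) \<le> ln D" by simp
    then have "(real n - (2 * \<alpha> * tau n - 2 / p)) * l \<le> A + ln D + \<alpha> * l\<^sup>2"
      unfolding pot_diff by (simp add: algebra_simps)
    then have "real n - (2 * \<alpha> * tau n - 2 / p) \<le> (A + ln D + \<alpha> * l\<^sup>2) / l" using l by (simp add: pos_le_divide_eq)
    moreover have "real n - (2 * \<alpha> * tau n - 2 / p) = - dev n * (2 * \<alpha>)"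
      using alpha_node[of n] by (simp add: dev_def algebra_simps)
    ultimately have "- dev n * (2 * \<alpha>) \<le> (A + ln D + \<alpha> * l\<^sup>2) / l" by linarith
    then have "- dev n \<le> B" unfolding B_def using alpha_pos by (subst pos_le_divide_eq) simp_all
    then show ?thesis by simp
  qed
  then show ?thesis by blast
qed

section \<open>Polynomials vanishing at the first points, and growth of \<open>level\<close>\<close>

definition zpoly :: "nat \<Rightarrow> complex \<Rightarrow> complex" where "zpoly n z = (\<Prod>j<n. z - \<sigma> j)"

lemma zpoly_holomorphic: "zpoly n holomorphic_on UNIV"
  unfolding zpoly_def[abs_def] by (intro holomorphic_intros)

lemma zpoly_in_fock: "zpoly n \<in> fspace"
proof -
  obtain C1 where fn: "\<And>f N Q. f holomorphic_on UNIV \<Longrightarrow> (\<forall>z. 1 \<le> cmod z \<longrightarrow> cmod (f z) \<le> Q * cmod z ^ N) \<Longrightarrow>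
    fnorm f \<le> ennreal (C1 * (Q * exp (\<alpha> * (node N)\<^sup>2)) powr p)"
    using fnorm_le_of_power_bound by blast
  have "cmod (zpoly n z) \<le> (\<Prod>j<n. 1 + cmod (\<sigma> j)) * cmod z ^ n" if z: "1 \<le> cmod z" for z
  proof -
    have "cmod (zpoly n z) = (\<Prod>j<n. cmod (z - \<sigma> j))" by (simp add: zpoly_def prod_norm)
    also have "\<dots> \<le> (\<Prod>j<n. (1 + cmod (\<sigma> j)) * cmod z)"
    proof (intro prod_mono conjI)
      fix j
      have "cmod (z - \<sigma> j) \<le> cmod z + cmod (\<sigma> j) * 1" using norm_triangle_ineq4[of z "\<sigma> j"] by simp
      also have "\<dots> \<le> cmod z + cmod (\<sigma> j) * cmod z" using z by (intro add_left_mono mult_left_mono) auto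
      finally show "cmod (z - \<sigma> j) \<le> (1 + cmod (\<sigma> j)) * cmod z" by (simp add: algebra_simps)
    qed simp
    also have "\<dots> = (\<Prod>j<n. 1 + cmod (\<sigma> j)) * cmod z ^ n" by (simp add: prod.distrib)
    finally show ?thesis .
  qed
  then have "fnorm (zpoly n) \<le> ennreal (C1 * ((\<Prod>j<n. 1 + cmod (\<sigma> j)) * exp (\<alpha> * (node n)\<^sup>2)) powr p)"
    by (intro fn zpoly_holomorphic) auto
  then show ?thesis using zpoly_holomorphic by (auto simp: fock_space_def intro: le_less_trans)
qed

text \<open>Sampling reduces the norm to the values at \<sigma>_j with j \<ge> n. Their weighted
  sizes follow a Gaussian centred at \<open>node n\<close>, but only \<open>tau j\<close> \<ge>
  \<open>tau n\<close> occur: if \<open>tau n\<close> exceeds \<open>node n\<close>, the peak is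
  missed, and this yields the saving in dev n.\<close>

lemma fnorm_zpoly_le:
  assumes samp: "sampling p (log_weight \<alpha>) (range \<sigma>)" and lg: "lin_growth \<kappa> c tau"
  shows "\<exists>C>0. \<forall>n. fnorm (zpoly n) \<le> ennreal (C * exp (p * \<alpha> * ((node n)\<^sup>2 - (max 0 (dev n))\<^sup>2)))"
proof -
  obtain C where C: "C > 0" and s: "\<And>f K. f \<in> fspace \<Longrightarrow> K \<ge> 0 \<Longrightarrow>
    ssum_le (\<lambda>n. f (\<sigma> n)) K \<Longrightarrow> fnorm f \<le> ennreal (C * K)"
    using sampling_imp[OF samp] by blast
  obtain A where A: "A > 0" "\<And>t F. finite F \<Longrightarrow> (\<Sum>j\<in>F. exp (- 1 * \<bar>t - tau j\<bar>)) \<le> A"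
    using sum_exp_dist_le[OF lg, of 1] by auto
  obtain A' where A': "A' > 0" "\<And>t F. finite F \<Longrightarrow> (\<Sum>j\<in>F. exp (- p * \<bar>t - tau j\<bar>)) \<le> A'"
    using sum_exp_dist_le[OF lg p_pos] by auto
  define D where "D = exp (p * A + p / (4 * \<alpha>)) * A'"
  have D: "D > 0" using A' by (simp add: D_def)
  have "ssum_le (\<lambda>j. zpoly n (\<sigma> j)) (D * exp (p * \<alpha> * ((node n)\<^sup>2 - (max 0 (dev n))\<^sup>2)))" for n
    unfolding ssum_le_def
  proof (intro allI impI)
    fix F :: "nat set" assume F: "finite F"
    \<comment> \<open>This is the point of the half-line from \<open>tau n\<close> to infinity that
      is nearest to \<open>node n\<close>.\<close>
    define t where "t = max (tau n) (node n)"
    define E where "E = exp (p * \<alpha> * ((node n)\<^sup>2 - (max 0 (dev n))\<^sup>2)) * exp (p * A + p / (4 * \<alpha>))"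
    have trm: "(cmod (zpoly n (\<sigma> j)) * exp (- pot (tau j))) powr p \<le> E * exp (- p * \<bar>t - tau j\<bar>)" for j
    proof (cases "n \<le> j")
      case False
      then have "zpoly n (\<sigma> j) = 0" unfolding zpoly_def by (auto simp: prod_zero_iff)
      then show ?thesis by (simp add: E_def)
    next
      case True
      have tj: "tau n \<le> tau j" using tau_mono True by simp
      have "cmod (zpoly n (\<sigma> j)) = (\<Prod>i<n. cmod (\<sigma> j - \<sigma> i))" by (simp add: zpoly_def prod_norm)
      also have "\<dots> \<le> (\<Prod>i<n. exp (tau j + exp (- 1 * \<bar>tau j - tau i\<bar>)))"
      proof (intro prod_mono conjI)
        fix i assume "i \<in> {..<n}"
        then have "max (tau j) (tau i) = tau j" using tau_mono[of i j] True by simp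
        then show "cmod (\<sigma> j - \<sigma> i) \<le> exp (tau j + exp (- 1 * \<bar>tau j - tau i\<bar>))"
          using norm_diff_le[OF sigma_nonzero[of j], of i] by (simp add: tau_def[symmetric])
      qed simp
      also have "\<dots> = exp (real n * tau j + (\<Sum>i<n. exp (- 1 * \<bar>tau j - tau i\<bar>)))"
        by (simp add: exp_sum[symmetric] sum.distrib)
      also have "\<dots> \<le> exp (real n * tau j + A)" using A(2)[of "{..<n}" "tau j"] by simp
      finally have "cmod (zpoly n (\<sigma> j)) * exp (- pot (tau j)) \<le> exp (real n * tau j + A) * exp (- pot (tau j))"
        by (intro mult_right_mono) auto
      also have "\<dots> = exp ((real n * tau j - pot (tau j)) + A)" by (simp flip: exp_add)
      also have "\<dots> \<le> exp (\<alpha> * ((node n)\<^sup>2 - (max 0 (dev n))\<^sup>2) + (A + 1 / (4 * \<alpha>) - \<bar>t - tau j\<bar>))"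
      proof -
        \<comment> \<open>The obtuse-angle inequality for the projection t of \<open>node n\<close>
          onto the half-line containing \<open>tau j\<close>; the distance from t to
          \<open>node n\<close> is \<open>max 0 (dev n)\<close>.\<close>
        have "(max 0 (dev n))\<^sup>2 + (t - tau j)\<^sup>2 \<le> (tau j - node n)\<^sup>2"
        proof (cases "dev n \<ge> 0")
          case True
          then have "t = tau n" by (simp add: t_def dev_def max_def)
          moreover have "(tau j - node n)\<^sup>2 = (dev n)\<^sup>2 + (tau n - tau j)\<^sup>2 + 2 * (dev n * (tau j - tau n))"
            by (simp add: dev_def power2_eq_square algebra_simps)
          moreover have "dev n * (tau j - tau n) \<ge> 0" using True tj by simp
          ultimately show ?thesis using True by simp
        next
          case False
          then have "t = node n" by (simp add: t_def dev_def max_def)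
          then show ?thesis using False by (simp add: power2_commute)
        qed
        then have "\<alpha> * ((max 0 (dev n))\<^sup>2 + (t - tau j)\<^sup>2) \<le> \<alpha> * (tau j - node n)\<^sup>2"
          using alpha_pos by (intro mult_left_mono) auto
        then show ?thesis using neg_square_le[of "t - tau j"] unfolding linear_minus_pot by (simp add: algebra_simps)
      qed
      finally have "(cmod (zpoly n (\<sigma> j)) * exp (- pot (tau j))) powr p \<le> exp (\<alpha> * ((node n)\<^sup>2 - (max 0 (dev n))\<^sup>2) + (A + 1 / (4 * \<alpha>) - \<bar>t - tau j\<bar>)) powr p"
        using p_pos by (intro powr_mono2) auto
      also have "\<dots> = E * exp (- p * \<bar>t - tau j\<bar>)"
        unfolding E_def exp_powr_real exp_add[symmetric] by (simp add: algebra_simps add_divide_distrib)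
      finally show ?thesis .
    qed
    have "(\<Sum>j\<in>F. (cmod (zpoly n (\<sigma> j)) * exp (- pot (tau j))) powr p) \<le> (\<Sum>j\<in>F. E * exp (- p * \<bar>t - tau j\<bar>))"
      using trm by (rule sum_mono)
    also have "\<dots> = E * (\<Sum>j\<in>F. exp (- p * \<bar>t - tau j\<bar>))" by (simp add: sum_distrib_left)
    also have "\<dots> \<le> E * A'" using A'(2)[OF F, of t] by (intro mult_left_mono) (auto simp: E_def)
    finally show "(\<Sum>j\<in>F. (cmod (zpoly n (\<sigma> j)) * exp (- pot (tau j))) powr p) \<le> D * exp (p * \<alpha> * ((node n)\<^sup>2 - (max 0 (dev n))\<^sup>2))"
      by (simp add: E_def D_def mult_ac)
  qed
  then have "fnorm (zpoly n) \<le> ennreal (C * (D * exp (p * \<alpha> * ((node n)\<^sup>2 - (max 0 (dev n))\<^sup>2))))" for n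
    using D by (intro s zpoly_in_fock) auto
  then show ?thesis using C D by (intro exI[of _ "C * D"]) (auto simp: mult.assoc)
qed

text \<open>A monic polynomial of degree n reaches R^n on |w| = R. For R = exp (node n) the weighted
  value is the full Gaussian peak, which contradicts the saving in \<open>fnorm_zpoly_le\<close>
  once dev n is large.\<close>

lemma dev_bounded_above:
  assumes samp: "sampling p (log_weight \<alpha>) (range \<sigma>)" and lg: "lin_growth \<kappa> c tau"
  shows "\<exists>B. \<forall>n. dev n \<le> B"
proof -
  obtain C where C: "C > 0" and zp: "\<And>n. fnorm (zpoly n) \<le> ennreal (C * exp (p * \<alpha> * ((node n)\<^sup>2 - (max 0 (dev n))\<^sup>2)))"
    using fnorm_zpoly_le[OF samp lg] by blast
  define C1 where "C1 = ptw_const (exp (node 0)) (1/2)"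
  have "dev n \<le> max 1 (C1 * C / (p * \<alpha>))" for n
  proof (cases "dev n \<ge> 1")
    case True
    have inj: "inj_on \<sigma> {..<n}" using inj_sigma by (rule inj_on_subset) simp
    obtain w where w: "cmod w = exp (node n)" "exp (node n) ^ card (\<sigma> ` {..<n}) \<le> (\<Prod>a\<in>\<sigma> ` {..<n}. cmod (w - a))"
      using monic_max_on_circle[of "\<sigma> ` {..<n}" "exp (node n)"] by auto
    have "exp (real n * node n) \<le> cmod (zpoly n w)"
      using w(2) by (simp add: card_image[OF inj] prod.reindex[OF inj] zpoly_def prod_norm exp_of_nat_mult)
    then have "exp (real n * node n) * exp (- pot (node n)) \<le> wval (zpoly n) w"
      unfolding wval_def w(1) by (simp add: mult_right_mono)
    moreover have "exp (real n * node n) * exp (- pot (node n)) = exp (\<alpha> * (node n)\<^sup>2)"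
      using linear_minus_pot[of n "node n"] by (simp flip: exp_add)
    ultimately have "exp (\<alpha> * (node n)\<^sup>2) powr p \<le> wval (zpoly n) w powr p"
      using p_pos by (intro powr_mono2) auto
    also have "\<dots> \<le> C1 * (C * exp (p * \<alpha> * ((node n)\<^sup>2 - (max 0 (dev n))\<^sup>2)))"
      unfolding C1_def
    proof (rule wval_powr_le[OF _ zpoly_holomorphic _ zp])
      show "exp (node 0) \<le> cmod w" using node_mono[of 0 n] by (simp add: w)
    qed (use C in auto)
    also have "exp (p * \<alpha> * ((node n)\<^sup>2 - (max 0 (dev n))\<^sup>2)) = exp (\<alpha> * (node n)\<^sup>2) powr p * exp (- (p * \<alpha> * (dev n)\<^sup>2))"
      using True by (simp add: exp_powr_real algebra_simps flip: exp_add)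
    finally have "exp (\<alpha> * (node n)\<^sup>2) powr p * 1 \<le> exp (\<alpha> * (node n)\<^sup>2) powr p * (C1 * C * exp (- (p * \<alpha> * (dev n)\<^sup>2)))"
      by (simp add: mult_ac)
    then have "1 \<le> C1 * C * exp (- (p * \<alpha> * (dev n)\<^sup>2))" by (subst (asm) mult_le_cancel_left_pos) auto
    then have "exp (p * \<alpha> * (dev n)\<^sup>2) \<le> C1 * C" by (simp add: exp_minus field_simps)
    then have le: "p * \<alpha> * (dev n)\<^sup>2 \<le> C1 * C" using exp_ge_add_one_self[of "p * \<alpha> * (dev n)\<^sup>2"] by linarith
    have "p * \<alpha> * (dev n * 1) \<le> p * \<alpha> * (dev n)\<^sup>2"
      using True p_pos alpha_pos unfolding power2_eq_square by (intro mult_left_mono) auto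
    then have "p * \<alpha> * (dev n * 1) \<le> C1 * C" using le by (rule order_trans)
    then have "dev n \<le> C1 * C / (p * \<alpha>)" using p_pos alpha_pos by (simp add: pos_le_divide_eq mult_ac)
    then show ?thesis by simp
  qed simp
  then show ?thesis by blast
qed

text \<open>Consecutive circles have radii in the ratio e^h, so discs of relative radius (1 -
  e^{-h}) / 2 or less are disjoint whatever the arguments of their centres.\<close>

lemma sum_wval_on_circles:
  "\<exists>C>0. \<forall>f K I w. f holomorphic_on UNIV \<longrightarrow> 0 \<le> K \<longrightarrow> fnorm f \<le> ennreal K \<longrightarrow> finite I \<longrightarrow>
    (\<forall>k\<in>I. cmod (w k) = exp (node k + s)) \<longrightarrow> (\<Sum>k\<in>I. wval f (w k) powr p) \<le> C * K"
proof -
  define c where "c = min (1 / 2) ((1 - exp (- h)) / 2)"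
  have c: "0 < c" "c \<le> 1 / 2" "2 * c \<le> 1 - exp (- h)" using h_pos by (auto simp: c_def)
  define C where "C = ptw_const (exp (node 0 + s)) c"
  have C: "C > 0" unfolding C_def using c(1) by (rule ptw_const_pos)
  have "(\<Sum>k\<in>I. wval f (w k) powr p) \<le> C * K"
    if f: "f holomorphic_on UNIV" "0 \<le> K" "fnorm f \<le> ennreal K" "finite I" and w: "\<forall>k\<in>I. cmod (w k) = exp (node k + s)" for f K I w
    unfolding C_def
  proof (rule sum_wval_powr_le[OF _ c(1,2) f])
    show "exp (node 0 + s) \<le> cmod (w k)" if "k \<in> I" for k
      using w that node_mono[of 0] by simp
    have far: "c * cmod (w i) + c * cmod (w j) \<le> dist (w i) (w j)" if ij: "i \<in> I" "j \<in> I" "i < j" for i j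
    proof -
      have "node i + s \<le> (node j + s) - h"
        using node_step[of i j] ij by simp
      then have wi: "cmod (w i) \<le> cmod (w j) * exp (- h)" using w ij by (simp flip: exp_add)
      have "cmod (w j) * exp (- h) \<le> cmod (w j) * 1" using h_pos by (intro mult_left_mono) auto
      then have "c * cmod (w i) \<le> c * cmod (w j)" using c(1) wi by (intro mult_left_mono) auto
      then have "c * cmod (w i) + c * cmod (w j) \<le> 2 * c * cmod (w j)" by simp
      also have "\<dots> \<le> (1 - exp (- h)) * cmod (w j)" using c(3) by (intro mult_right_mono) auto
      also have "\<dots> \<le> cmod (w j) - cmod (w i)" using wi by (simp add: algebra_simps)
      also have "\<dots> \<le> dist (w i) (w j)" using norm_triangle_ineq2[of "w j" "w i"] by (simp add: dist_norm norm_minus_commute)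
      finally show ?thesis .
    qed
    show "disjoint_family_on (\<lambda>i. ball (w i) (c * cmod (w i))) I"
      unfolding disjoint_family_on_def
    proof (intro ballI impI)
      fix i j assume ij: "i \<in> I" "j \<in> I" "i \<noteq> j"
      show "ball (w i) (c * cmod (w i)) \<inter> ball (w j) (c * cmod (w j)) = {}"
      proof (cases "i < j")
        case True
        then show ?thesis using far ij by (intro disjoint_ballI) auto
      next
        case False
        then have "ball (w j) (c * cmod (w j)) \<inter> ball (w i) (c * cmod (w i)) = {}"
          using far ij by (intro disjoint_ballI) auto
        then show ?thesis by blast
      qed
    qed
  qed simp
  with C show ?thesis by blast
qed

text \<open>The norm of \<open>zpoly n\<close> is read off on circles inside \<sigma>_k for all k <
  n. There its first k factors are as large as for z^k at a suitable point, and the remaining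
  factors have about the size |\<sigma>_j|, so the weighted value is about exp (level k) times the
  product of all n moduli.\<close>

lemma level_sum_le:
  assumes samp: "sampling p (log_weight \<alpha>) (range \<sigma>)" and B: "\<And>n. \<bar>dev n\<bar> \<le> B"
  shows "\<exists>C>0. \<forall>n. (\<Sum>k<n. exp (p * level k)) \<le> C * exp (p * level n)"
proof -
  note lg = lin_growth_tau[OF B]
  obtain C where C: "C > 0" and zp: "\<And>n. fnorm (zpoly n) \<le> ennreal (C * exp (p * \<alpha> * ((node n)\<^sup>2 - (max 0 (dev n))\<^sup>2)))"
    using fnorm_zpoly_le[OF samp lg] by blast
  obtain A where A: "A > 0" "\<And>t F. finite F \<Longrightarrow> (\<Sum>j\<in>F. exp (- 1 * \<bar>t - tau j\<bar>)) \<le> A"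
    using sum_exp_dist_le[OF lg, of 1] by auto
  \<comment> \<open>Moving the circle inwards by b leaves it inside half the modulus of every
    \<sigma>_j with j \<ge> k.\<close>
  define b where "b = B + ln 2"
  obtain C1 where C1: "C1 > 0" and circ: "\<And>f K I w. f holomorphic_on UNIV \<Longrightarrow> 0 \<le> K \<Longrightarrow> fnorm f \<le> ennreal K \<Longrightarrow> finite I \<Longrightarrow>
    (\<forall>k\<in>I. cmod (w k) = exp (node k + - b)) \<Longrightarrow> (\<Sum>k\<in>I. wval f (w k) powr p) \<le> C1 * K"
    using sum_wval_on_circles[of "- b"] by blast
  \<comment> \<open>The point is chosen for \<open>zpoly k\<close>, hence independently of n. The
    later factors are bounded below on the whole circle.\<close>
  have "\<exists>w. cmod w = exp (node k + - b) \<and> exp (real k * (node k + - b)) \<le> cmod (zpoly k w)" for k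
  proof -
    have inj: "inj_on \<sigma> {..<k}" using inj_sigma by (rule inj_on_subset) simp
    obtain w where w: "cmod w = exp (node k + - b)" "exp (node k + - b) ^ card (\<sigma> ` {..<k}) \<le> (\<Prod>a\<in>\<sigma> ` {..<k}. cmod (w - a))"
      using monic_max_on_circle[of "\<sigma> ` {..<k}" "exp (node k + - b)"] by auto
    have "exp (real k * (node k + - b)) \<le> cmod (zpoly k w)"
      using w(2) unfolding exp_of_nat_mult by (simp add: card_image[OF inj] prod.reindex[OF inj] zpoly_def prod_norm)
    with w show ?thesis by blast
  qed
  then obtain w where w: "\<And>k. cmod (w k) = exp (node k + - b)" "\<And>k. exp (real k * (node k + - b)) \<le> cmod (zpoly k (w k))"
    by metis
  define D where "D = \<alpha> * b\<^sup>2 + 2 * A"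
  have low: "exp (level k + (\<Sum>j<n. tau j) - D) \<le> wval (zpoly n) (w k)" if kn: "k < n" for k n
  proof -
    define T where "T = node k + - b"
    have split: "zpoly n z = zpoly k z * (\<Prod>j\<in>{k..<n}. z - \<sigma> j)" for z
      unfolding zpoly_def using kn prod.atLeastLessThan_concat[of 0 k n "\<lambda>j. z - \<sigma> j"] by (simp add: atLeast0LessThan)
    have prod: "exp ((\<Sum>j\<in>{k..<n}. tau j) - 2 * A) \<le> (\<Prod>j\<in>{k..<n}. cmod (w k - \<sigma> j))"
    proof -
      have "exp ((\<Sum>j\<in>{k..<n}. tau j) - 2 * A) \<le> exp (\<Sum>j\<in>{k..<n}. tau j + - 2 * exp (- 1 * \<bar>T - tau j\<bar>))"
        using A(2)[of "{k..<n}" T] unfolding sum.distrib sum_distrib_left[symmetric] by simp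
      also have "\<dots> = (\<Prod>j\<in>{k..<n}. exp (tau j + - 2 * exp (- 1 * \<bar>T - tau j\<bar>)))" by (simp add: exp_sum)
      also have "\<dots> \<le> (\<Prod>j\<in>{k..<n}. cmod (w k - \<sigma> j))"
      proof (intro prod_mono conjI)
        fix j assume j: "j \<in> {k..<n}"
        have Tj: "T + ln 2 \<le> tau j"
          using j B[of j] node_mono[of k j] unfolding T_def b_def dev_def by simp
        have l2: "ln 2 > (0::real)" by simp
        have abs: "\<bar>T - tau j\<bar> = tau j - T" using Tj l2 by linarith
        define x where "x = exp (- 1 * \<bar>T - tau j\<bar>)"
        have "x \<le> exp (- ln 2)" unfolding x_def abs using Tj by simp
        then have x: "0 \<le> x" "x \<le> 1 / 2" by (auto simp: x_def exp_minus)
        have "exp (tau j + - 2 * x) = exp (tau j) * exp (- 2 * x)" by (rule exp_add)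
        also have "\<dots> \<le> exp (tau j) * (1 - x)" using x by (intro mult_left_mono one_minus_ge_exp) auto
        also have "\<dots> = exp (tau j) - exp T" unfolding x_def abs by (simp add: algebra_simps flip: exp_add)
        also have "\<dots> = cmod (\<sigma> j) - cmod (w k)" by (simp add: norm_sigma w T_def)
        also have "\<dots> \<le> cmod (w k - \<sigma> j)" using norm_triangle_ineq2[of "\<sigma> j" "w k"] by (simp add: norm_minus_commute)
        finally show "exp (tau j + - 2 * exp (- 1 * \<bar>T - tau j\<bar>)) \<le> cmod (w k - \<sigma> j)" by (simp add: x_def)
      qed simp
      finally show ?thesis .
    qed
    have "exp (real k * T) * exp ((\<Sum>j\<in>{k..<n}. tau j) - 2 * A) \<le> cmod (zpoly n (w k))"
      unfolding split norm_mult prod_norm[symmetric] using w(2)[of k] prod by (intro mult_mono) (auto simp: T_def)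
    then have "exp (real k * T) * exp ((\<Sum>j\<in>{k..<n}. tau j) - 2 * A) * exp (- pot T) \<le> wval (zpoly n) (w k)"
      unfolding wval_def w(1) T_def by (simp add: mult_right_mono)
    moreover have "exp (real k * T) * exp ((\<Sum>j\<in>{k..<n}. tau j) - 2 * A) * exp (- pot T) = exp (level k + (\<Sum>j<n. tau j) - D)"
    proof -
      have "(\<Sum>j\<in>{k..<n}. tau j) = (\<Sum>j<n. tau j) - (\<Sum>j<k. tau j)" using kn by (simp add: sum_diff_lessThan)
      then have "real k * T + ((\<Sum>j\<in>{k..<n}. tau j) - 2 * A) + - pot T = level k + (\<Sum>j<n. tau j) - D"
        using linear_minus_pot[of k T] by (simp add: level_def D_def T_def)
      then show ?thesis by (simp only: exp_add[symmetric])
    qed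
    ultimately show ?thesis by simp
  qed
  have main: "(\<Sum>k<n. exp (p * level k)) \<le> C1 * C * exp (p * D) * exp (p * level n)" for n
  proof -
    define S where "S = (\<Sum>j<n. tau j)"
    have "(\<Sum>k<n. exp (p * level k)) = exp (p * D - p * S) * (\<Sum>k<n. exp (level k + S - D) powr p)"
      unfolding sum_distrib_left exp_powr_real exp_add[symmetric] by (intro sum.cong refl) (simp add: algebra_simps)
    also have "\<dots> \<le> exp (p * D - p * S) * (\<Sum>k<n. wval (zpoly n) (w k) powr p)"
      using low p_pos by (intro mult_left_mono sum_mono powr_mono2) (auto simp: S_def)
    also have "\<dots> \<le> exp (p * D - p * S) * (C1 * (C * exp (p * \<alpha> * (node n)\<^sup>2)))"
    proof (intro mult_left_mono circ zpoly_holomorphic)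
      have "exp (p * \<alpha> * ((node n)\<^sup>2 - (max 0 (dev n))\<^sup>2)) \<le> exp (p * \<alpha> * (node n)\<^sup>2)"
        using p_pos alpha_pos by (simp add: mult_left_mono)
      then show "fnorm (zpoly n) \<le> ennreal (C * exp (p * \<alpha> * (node n)\<^sup>2))"
        using C by (intro order_trans[OF zp] ennreal_leI mult_left_mono) auto
    qed (use C w in auto)
    also have "\<dots> = C1 * C * exp (p * D) * exp (p * level n)"
    proof -
      have "p * D - p * S + p * \<alpha> * (node n)\<^sup>2 = p * D + p * level n" by (simp add: level_def S_def algebra_simps)
      then have "exp (p * D - p * S) * exp (p * \<alpha> * (node n)\<^sup>2) = exp (p * D) * exp (p * level n)"
        by (simp only: exp_add[symmetric])
      then show ?thesis by (simp add: mult_ac)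
    qed
    finally show ?thesis .
  qed
  show ?thesis using main C C1 by (intro exI[of _ "C1 * C * exp (p * D)"] conjI) auto
qed

text \<open>The counterpart for larger indices: L n is evaluated on circles outside \<sigma>_k for k
  > n. Among the first k points it is known to vanish at all but \<sigma>_n; the missing factor has
  size about exp (h (k - n)), which explains the subtraction of h k from
  \<open>level\<close>.\<close>

lemma level_sum_le':
  assumes L: "dual_system L C" and B: "\<And>n. \<bar>dev n\<bar> \<le> B"
  shows "\<exists>D>0. \<forall>n K. (\<Sum>k\<in>{n<..K}. exp (p * (level k - h * real k))) \<le> D * exp (p * (level n - h * real n))"
proof -
  obtain A where A: "\<And>n k T. (\<forall>j<k. tau j + ln 2 \<le> T) \<Longrightarrow> tau n \<le> T \<Longrightarrow> (\<exists>w. cmod w = exp T \<and>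
    exp (real (card ({..<k} - {n})) * T - (\<Sum>j\<in>{..<k} - {n}. max (tau n) (tau j)) - A - pot T) \<le> wval (L n) w)"
    using dual_growth[OF L lin_growth_tau[OF B]] by blast
  define b where "b = B + ln 2"
  obtain C1 where C1: "C1 > 0" and circ: "\<And>f K I w. f holomorphic_on UNIV \<Longrightarrow> 0 \<le> K \<Longrightarrow> fnorm f \<le> ennreal K \<Longrightarrow> finite I \<Longrightarrow>
    (\<forall>k\<in>I. cmod (w k) = exp (node k + b)) \<Longrightarrow> (\<Sum>k\<in>I. wval f (w k) powr p) \<le> C1 * K"
    using sum_wval_on_circles[of b] by blast
  have C: "C > 0" using L by (simp add: dual_system_def)
  define E where "E = \<alpha> * b\<^sup>2 + A + b + B"
  define Y where "Y k = level k - h * real k" for k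
  have low: "\<exists>w. cmod w = exp (node k + b) \<and> exp (Y k - Y n - pot (tau n) - E) \<le> wval (L n) w" if nk: "n < k" for n k
  proof -
    define T where "T = node k + b"
    have le: "tau j + ln 2 \<le> T" if "j \<le> k" for j
      using B[of j] node_mono[OF that] unfolding T_def b_def dev_def by linarith
    have "ln 2 > (0::real)" by simp
    then have tn: "tau n \<le> T" using le[of n] nk by linarith
    obtain w where w: "cmod w = exp T"
      "exp (real (card ({..<k} - {n})) * T - (\<Sum>j\<in>{..<k} - {n}. max (tau n) (tau j)) - A - pot T) \<le> wval (L n) w"
      using A[of k T n] le tn by auto
    have card: "real (card ({..<k} - {n})) = real k - 1" using nk by (simp add: card_Diff_subset of_nat_diff)
    have "(\<Sum>j\<in>{..<k} - {n}. max (tau n) (tau j)) = (\<Sum>j<k. max (tau n) (tau j)) - tau n"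
      using nk by (subst sum_diff1) auto
    also have "(\<Sum>j<k. max (tau n) (tau j)) = (\<Sum>j<n. max (tau n) (tau j)) + (\<Sum>j\<in>{n..<k}. max (tau n) (tau j))"
      using sum_diff_lessThan[of n k "\<lambda>j. max (tau n) (tau j)"] nk by simp
    also have "(\<Sum>j<n. max (tau n) (tau j)) = (\<Sum>j<n. tau n)" using tau_mono by (intro sum.cong) (auto simp: max_def order_antisym)
    also have "(\<Sum>j\<in>{n..<k}. max (tau n) (tau j)) = (\<Sum>j\<in>{n..<k}. tau j)" using tau_mono by (intro sum.cong) (auto simp: max_def)
    also have "(\<Sum>j\<in>{n..<k}. tau j) = (\<Sum>j<k. tau j) - (\<Sum>j<n. tau j)" using nk by (simp add: sum_diff_lessThan)
    finally have sum: "(\<Sum>j\<in>{..<k} - {n}. max (tau n) (tau j)) = real n * tau n + ((\<Sum>j<k. tau j) - (\<Sum>j<n. tau j)) - tau n"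
      by simp
    have "Y k - Y n - pot (tau n) - E \<le> real (card ({..<k} - {n})) * T - (\<Sum>j\<in>{..<k} - {n}. max (tau n) (tau j)) - A - pot T"
    proof -
      have 1: "(real k - 1) * T - pot T = \<alpha> * (node k)\<^sup>2 - \<alpha> * b\<^sup>2 - T"
        using linear_minus_pot[of k T] by (simp add: T_def algebra_simps)
      have 2: "real n * tau n = pot (tau n) + \<alpha> * (node n)\<^sup>2 - \<alpha> * (dev n)\<^sup>2"
        using linear_minus_pot[of n "tau n"] by (simp add: dev_def)
      have 3: "T - tau n = h * (real k - real n) + b - dev n" using node_diff[of k n] by (simp add: T_def dev_def)
      have 4: "\<alpha> * (dev n)\<^sup>2 \<ge> 0" using alpha_pos by simp
      have 5: "h * (real k - real n) = h * real k - h * real n" by (simp add: algebra_simps)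
      show ?thesis unfolding card sum Y_def E_def level_def using 1 2 3 4 5 B[of n] by linarith
    qed
    then have "exp (Y k - Y n - pot (tau n) - E) \<le> wval (L n) w" using w(2) by (meson exp_le_cancel_iff order_trans)
    then show ?thesis using w(1) T_def by blast
  qed
  have main: "(\<Sum>k\<in>{n<..K}. exp (p * Y k)) \<le> C1 * C * exp (p * E) * exp (p * Y n)" for n K
  proof -
    obtain w where w: "\<And>k. n < k \<Longrightarrow> cmod (w k) = exp (node k + b) \<and> exp (Y k - Y n - pot (tau n) - E) \<le> wval (L n) (w k)"
      using low by metis
    have "(\<Sum>k\<in>{n<..K}. exp (p * Y k)) = exp (p * Y n + p * pot (tau n) + p * E) * (\<Sum>k\<in>{n<..K}. exp (Y k - Y n - pot (tau n) - E) powr p)"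
      unfolding sum_distrib_left exp_powr_real exp_add[symmetric] by (intro sum.cong refl) (simp add: algebra_simps)
    also have "\<dots> \<le> exp (p * Y n + p * pot (tau n) + p * E) * (\<Sum>k\<in>{n<..K}. wval (L n) (w k) powr p)"
      using w p_pos by (intro mult_left_mono sum_mono powr_mono2) auto
    also have "\<dots> \<le> exp (p * Y n + p * pot (tau n) + p * E) * (C1 * (C * exp (- pot (tau n)) powr p))"
      using L C w by (intro mult_left_mono circ) (auto simp: dual_system_def fock_space_def)
    also have "\<dots> = C1 * C * exp (p * E) * exp (p * Y n)"
    proof -
      have "exp (p * Y n + p * pot (tau n) + p * E) * exp (- pot (tau n)) powr p = exp (p * E) * exp (p * Y n)"
        by (simp add: exp_powr_real algebra_simps flip: exp_add)
      then show ?thesis by (simp add: mult_ac)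
    qed
    finally show ?thesis .
  qed
  show ?thesis using main C C1 unfolding Y_def by (intro exI[of _ "C1 * C * exp (p * E)"] conjI) auto
qed

text \<open>Linear growth of \<open>tau\<close> has to come from sampling alone, because both
  one-sided bounds for \<open>dev\<close> rest on it; the two-sided bound in turn gives access to
  the two summation inequalities. These force the average slope of \<open>level\<close> to exceed
  some positive number and to stay below h by some positive number.\<close>

theorem complete_interpolating_only_if:
  assumes ci: "complete_interpolating p (log_weight \<alpha>) (range \<sigma>)"
  shows "rel_separated \<sigma> \<and> bounded (range dev) \<and> small_drift (h / 2) dev"
proof -
  have samp: "sampling p (log_weight \<alpha>) (range \<sigma>)" using ci by (simp add: complete_interpolating_def)
  obtain L C where L: "dual_system L C" using dual_system_exists[OF ci] by blast
  obtain \<kappa> c where lg: "lin_growth \<kappa> c tau" using lin_growth_of_sampling[OF samp] by blast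
  obtain B1 where B1: "\<And>n. - B1 \<le> dev n" using dev_bounded_below[OF L lg] by blast
  obtain B2 where B2: "\<And>n. dev n \<le> B2" using dev_bounded_above[OF samp lg] by blast
  define B where "B = max B1 B2"
  have B: "\<bar>dev n\<bar> \<le> B" for n using B1[of n] B2[of n] by (auto simp: B_def abs_le_iff le_max_iff_disj)
  have bd: "bounded (range dev)" using B by (auto simp: bounded_iff)
  have up: "\<exists>D>0. \<exists>\<epsilon>>0. \<forall>k n. k \<le> n \<longrightarrow> exp (p * level k) \<le> D * exp (- \<epsilon> * (real n - real k)) * exp (p * level n)"
    using level_sum_le[OF samp B] by (elim exE conjE) (rule exp_growth_of_sum_le, auto)
  obtain D1 e1 where 1: "D1 > 0" "e1 > 0" "\<And>k n. k \<le> n \<Longrightarrow> exp (p * level k) \<le> D1 * exp (- e1 * (real n - real k)) * exp (p * level n)"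
    using up by blast
  have down: "\<exists>D>0. \<exists>\<epsilon>>0. \<forall>n k. n \<le> k \<longrightarrow> exp (p * (level k - h * real k)) \<le> D * exp (- \<epsilon> * (real k - real n)) * exp (p * (level n - h * real n))"
    using level_sum_le'[OF L B] by (elim exE conjE) (rule exp_decay_of_sum_le, auto)
  obtain D2 e2 where 2: "D2 > 0" "e2 > 0" "\<And>k n. n \<le> k \<Longrightarrow> exp (p * (level k - h * real k)) \<le> D2 * exp (- e2 * (real k - real n)) * exp (p * (level n - h * real n))"
    using down by blast
  \<comment> \<open>Since \<open>level\<close> has slope h / 2 minus the drift, its two slope bounds
    become upper and lower bounds for the drift, symmetric about 0; the smaller margin is
    kept.\<close>
  define \<epsilon> where "\<epsilon> = min e1 e2 / p"
  define E where "E = max (ln D1 / p) (ln D2 / p)"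
  have eps: "\<epsilon> > 0" using 1 2 p_pos by (simp add: \<epsilon>_def)
  have log: "x - y \<le> ln D / p - e / p * u" if "D > 0" "exp (p * x) \<le> D * exp (- e * u) * exp (p * y)" for D e u x y
  proof -
    have "exp (p * x) \<le> exp (ln D + - e * u + p * y)" using that(2) by (simp only: exp_add exp_ln[OF that(1)])
    then have "p * (x - y) \<le> ln D - e * u" by (simp add: algebra_simps)
    then have "x - y \<le> (ln D - e * u) / p" using p_pos by (simp add: pos_le_divide_eq mult.commute)
    then show ?thesis by (simp add: diff_divide_distrib)
  qed
  have "\<bar>(\<Sum>j<k. dev j) - (\<Sum>j<n. dev j)\<bar> \<le> (h / 2 - \<epsilon>) * (real k - real n) + E" if nk: "n \<le> k" for n k
  proof -
    define d where "d = real k - real n"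
    have d: "d \<ge> 0" using nk by (simp add: d_def)
    have lev: "level k - level n = h / 2 * d - ((\<Sum>j<k. dev j) - (\<Sum>j<n. dev j))"
      by (simp add: level_eq d_def field_simps)
    have "\<epsilon> * d \<le> e1 / p * d" "\<epsilon> * d \<le> e2 / p * d" using d p_pos unfolding \<epsilon>_def
      by (intro mult_right_mono divide_right_mono; simp)+
    moreover have "level n - level k \<le> ln D1 / p - e1 / p * d"
      using log[OF 1(1) 1(3)[OF nk]] by (simp add: d_def)
    moreover have "(level k - h * real k) - (level n - h * real n) \<le> ln D2 / p - e2 / p * d"
      using log[OF 2(1) 2(3)[OF nk]] by (simp add: d_def)
    moreover have "ln D1 / p \<le> E" "ln D2 / p \<le> E" by (auto simp: E_def)
    moreover have "h * real k - h * real n = h * d" "(h / 2 - \<epsilon>) * d = h * d / 2 - \<epsilon> * d" "h / 2 * d = h * d / 2"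
      by (simp_all add: d_def algebra_simps)
    ultimately show ?thesis using lev unfolding d_def[symmetric] abs_le_iff by linarith
  qed
  then have "small_drift (h / 2) dev" using eps unfolding small_drift_def by blast
  then show ?thesis using rel_separated_of_dual[OF L] bd by blast
qed

end

section \<open>The characterization\<close>

context fock_seq
begin

theorem complete_interpolating_iff:
  "complete_interpolating p (log_weight \<alpha>) (range \<sigma>) \<longleftrightarrow>
    rel_separated \<sigma> \<and> bounded (range dev) \<and> small_drift (h / 2) dev"
proof
  assume "complete_interpolating p (log_weight \<alpha>) (range \<sigma>)"
  then show "rel_separated \<sigma> \<and> bounded (range dev) \<and> small_drift (h / 2) dev"
    by (rule complete_interpolating_only_if)
next
  assume "rel_separated \<sigma> \<and> bounded (range dev) \<and> small_drift (h / 2) dev"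
  then show "complete_interpolating p (log_weight \<alpha>) (range \<sigma>)"
    by (elim conjE) (rule complete_interpolating_if)
qed

end

section \<open>Scaling and removal of one point\<close>

lemma rel_separated_scale:
  assumes "c \<noteq> 0"
  shows "rel_separated (\<lambda>n. c * \<sigma> n) \<longleftrightarrow> rel_separated \<sigma>"
proof -
  have c: "cmod c > 0" using assms by simp
  have "b * max (cmod (c * \<sigma> m)) (cmod (c * \<sigma> n)) \<le> cmod (c * \<sigma> m - c * \<sigma> n) \<longleftrightarrow>
    b * max (cmod (\<sigma> m)) (cmod (\<sigma> n)) \<le> cmod (\<sigma> m - \<sigma> n)" for b m n
  proof -
    have "max (cmod (c * \<sigma> m)) (cmod (c * \<sigma> n)) = cmod c * max (cmod (\<sigma> m)) (cmod (\<sigma> n))"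
      by (simp add: norm_mult max_mult_distrib_left)
    moreover have "cmod (c * \<sigma> m - c * \<sigma> n) = cmod c * cmod (\<sigma> m - \<sigma> n)"
      by (simp flip: right_diff_distrib add: norm_mult)
    ultimately show ?thesis using c by (simp add: mult.left_commute)
  qed
  then show ?thesis unfolding rel_separated_def by simp
qed

lemma rel_separated_comp:
  assumes "rel_separated \<sigma>" "inj e"
  shows "rel_separated (\<lambda>n. \<sigma> (e n))"
proof -
  obtain c where c: "c > 0" "\<And>m n. m \<noteq> n \<Longrightarrow> c * max (cmod (\<sigma> m)) (cmod (\<sigma> n)) \<le> cmod (\<sigma> m - \<sigma> n)"
    using assms(1) unfolding rel_separated_def by blast
  have "c * max (cmod (\<sigma> (e m))) (cmod (\<sigma> (e n))) \<le> cmod (\<sigma> (e m) - \<sigma> (e n))" if "m \<noteq> n" for m n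
    using assms(2) that by (intro c(2)) (simp add: inj_eq)
  with c(1) show ?thesis unfolding rel_separated_def by blast
qed

lemma finite_uniform_lower_bound:
  fixes g :: "'a \<Rightarrow> real"
  assumes "finite F" "\<And>x. x \<in> F \<Longrightarrow> g x > 0"
  shows "\<exists>c>0. \<forall>x\<in>F. c \<le> g x"
  using assms
proof (induction F rule: finite_induct)
  case empty
  show ?case by (intro exI[of _ 1]) auto
next
  case (insert x F)
  then obtain c where "c > 0" "\<forall>y\<in>F. c \<le> g y" by auto
  then show ?case using insert.prems by (intro exI[of _ "min c (g x)"]) auto
qed

definition skip :: "nat \<Rightarrow> nat \<Rightarrow> nat" where "skip i n = (if n < i then n else Suc n)"

lemma inj_skip: "inj (skip i)"
  by (auto simp: inj_def skip_def split: if_splits)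

lemma skip_surj: "n \<noteq> i \<Longrightarrow> \<exists>m. n = skip i m"
proof (cases "n < i")
  case True
  then show ?thesis by (intro exI[of _ n]) (simp add: skip_def)
next
  case False
  assume "n \<noteq> i"
  with False show ?thesis by (intro exI[of _ "n - 1"]) (auto simp: skip_def)
qed

lemma skip_neq: "skip i n \<noteq> i" by (simp add: skip_def)

lemma range_skip: "range (\<lambda>n. f (skip i n)) = f ` (- {i})"
proof
  show "range (\<lambda>n. f (skip i n)) \<subseteq> f ` (- {i})" using skip_neq by auto
  show "f ` (- {i}) \<subseteq> range (\<lambda>n. f (skip i n))" using skip_surj by blast
qed

text \<open>Points of modulus at least twice that of the restored point are far from it. As the
  moduli tend to infinity, only finitely many others remain, each at positive distance.\<close>

lemma rel_separated_skip_iff: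
  assumes inj: "inj \<sigma>" and nz: "\<And>n. \<sigma> n \<noteq> 0" and unb: "\<And>R. \<exists>N. \<forall>n\<ge>N. R \<le> cmod (\<sigma> n)"
  shows "rel_separated (\<lambda>n. \<sigma> (skip i n)) \<longleftrightarrow> rel_separated \<sigma>"
proof
  assume "rel_separated (\<lambda>n. \<sigma> (skip i n))"
  then obtain c where c: "c > 0" "\<And>m n. m \<noteq> n \<Longrightarrow>
    c * max (cmod (\<sigma> (skip i m))) (cmod (\<sigma> (skip i n))) \<le> cmod (\<sigma> (skip i m) - \<sigma> (skip i n))"
    unfolding rel_separated_def by blast
  obtain N where N: "\<And>n. n \<ge> N \<Longrightarrow> 2 * cmod (\<sigma> i) \<le> cmod (\<sigma> n)" using unb by blast
  have "\<exists>d>0. \<forall>n\<in>{..<N} - {i}. d \<le> cmod (\<sigma> n - \<sigma> i) / max (cmod (\<sigma> n)) (cmod (\<sigma> i))"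
    using inj nz by (intro finite_uniform_lower_bound divide_pos_pos) (auto simp: inj_eq less_max_iff_disj)
  then obtain d where d: "d > 0" "\<And>n. n < N \<Longrightarrow> n \<noteq> i \<Longrightarrow> d \<le> cmod (\<sigma> n - \<sigma> i) / max (cmod (\<sigma> n)) (cmod (\<sigma> i))"
    by auto
  define e where "e = min (1 / 2) (min c d)"
  have e: "e > 0" "e \<le> 1 / 2" "e \<le> c" "e \<le> d" using c d by (auto simp: e_def)
  have at_i: "e * max (cmod (\<sigma> n)) (cmod (\<sigma> i)) \<le> cmod (\<sigma> n - \<sigma> i)" if "n \<noteq> i" for n
  proof (cases "n < N")
    case True
    have pos: "max (cmod (\<sigma> n)) (cmod (\<sigma> i)) > 0" using nz[of n] by (simp add: less_max_iff_disj)
    have "e \<le> cmod (\<sigma> n - \<sigma> i) / max (cmod (\<sigma> n)) (cmod (\<sigma> i))" using d(2)[OF True that] e by linarith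
    then show ?thesis using pos by (simp add: pos_le_divide_eq)
  next
    case False
    then have le: "2 * cmod (\<sigma> i) \<le> cmod (\<sigma> n)" by (intro N) simp
    then have "max (cmod (\<sigma> n)) (cmod (\<sigma> i)) = cmod (\<sigma> n)" using norm_ge_zero[of "\<sigma> i"] by linarith
    then have "e * max (cmod (\<sigma> n)) (cmod (\<sigma> i)) \<le> 1 / 2 * cmod (\<sigma> n)"
      using mult_right_mono[OF e(2), of "cmod (\<sigma> n)"] by simp
    then show ?thesis using le norm_triangle_ineq2[of "\<sigma> n" "\<sigma> i"] by linarith
  qed
  have "e * max (cmod (\<sigma> m)) (cmod (\<sigma> n)) \<le> cmod (\<sigma> m - \<sigma> n)" if mn: "m \<noteq> n" for m n
  proof -
    consider "m = i" | "n = i" | "m \<noteq> i" "n \<noteq> i" by blast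
    then show ?thesis
    proof cases
      case 1
      then show ?thesis using at_i[of n] mn by (simp add: max.commute norm_minus_commute)
    next
      case 2
      then show ?thesis using at_i[of m] mn by simp
    next
      case 3
      obtain a b where ab: "m = skip i a" "n = skip i b" using skip_surj 3 by metis
      then have "a \<noteq> b" using mn by auto
      have "e * max (cmod (\<sigma> m)) (cmod (\<sigma> n)) \<le> c * max (cmod (\<sigma> m)) (cmod (\<sigma> n))"
        using e by (intro mult_right_mono) (auto simp: le_max_iff_disj)
      also have "\<dots> \<le> cmod (\<sigma> m - \<sigma> n)" using c(2)[OF \<open>a \<noteq> b\<close>] ab by simp
      finally show ?thesis .
    qed
  qed
  then show "rel_separated \<sigma>" using e(1) unfolding rel_separated_def by blast
next
  assume "rel_separated \<sigma>"
  then show "rel_separated (\<lambda>n. \<sigma> (skip i n))" using inj_skip by (rule rel_separated_comp)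
qed

text \<open>The modified sequence holds the deviations after removal of point i, measured from nodes
  one gap c further on: points behind i drop by one index and fit the moved nodes, points before i
  fall short by c. The partial sums change by at most two deviations and i * |c|.\<close>

lemma small_drift_skip_iff:
  fixes \<delta> :: "nat \<Rightarrow> real"
  assumes bd: "\<And>n. \<bar>\<delta> n\<bar> \<le> B"
  shows "small_drift \<beta> (\<lambda>n. if n < i then \<delta> n - c else \<delta> (Suc n)) \<longleftrightarrow> small_drift \<beta> \<delta>"
proof -
  let ?\<delta>' = "\<lambda>n. if n < i then \<delta> n - c else \<delta> (Suc n)"
  have eq: "(\<Sum>j<n. ?\<delta>' j) = (if n \<le> i then (\<Sum>j<n. \<delta> j) - real n * c else (\<Sum>j<Suc n. \<delta> j) - \<delta> i - real i * c)" for n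
  proof (induction n)
    case (Suc n)
    consider "n < i" | "n = i" | "i < n" by linarith
    then show ?case using Suc by cases (auto simp: algebra_simps)
  qed simp
  have diff: "\<bar>(\<Sum>j<n. ?\<delta>' j) - (\<Sum>j<n. \<delta> j)\<bar> \<le> 2 * B + real i * \<bar>c\<bar>" for n
  proof (cases "n \<le> i")
    case True
    then have "\<bar>real n * c\<bar> \<le> real i * \<bar>c\<bar>" by (auto simp: abs_mult intro: mult_right_mono)
    then show ?thesis using True bd[of 0] unfolding eq by simp
  next
    case False
    have "\<bar>real i * c\<bar> = real i * \<bar>c\<bar>" by (simp add: abs_mult)
    then show ?thesis using False bd[of n] bd[of i] unfolding eq by simp
  qed
  show ?thesis
  proof
    assume "small_drift \<beta> ?\<delta>'"
    then show "small_drift \<beta> \<delta>"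
      by (rule small_drift_perturb) (subst abs_minus_commute, rule diff)
  next
    assume "small_drift \<beta> \<delta>"
    then show "small_drift \<beta> ?\<delta>'" using diff by (rule small_drift_perturb)
  qed
qed

lemma bounded_range_skip_iff:
  fixes \<delta> :: "nat \<Rightarrow> real"
  shows "bounded (range (\<lambda>n. if n < i then \<delta> n - c else \<delta> (Suc n))) \<longleftrightarrow> bounded (range \<delta>)"
proof
  assume "bounded (range (\<lambda>n. if n < i then \<delta> n - c else \<delta> (Suc n)))"
  then obtain B where "\<forall>x\<in>range (\<lambda>n. if n < i then \<delta> n - c else \<delta> (Suc n)). \<bar>x\<bar> \<le> B"
    unfolding bounded_iff real_norm_def by blast
  then have B: "\<bar>if n < i then \<delta> n - c else \<delta> (Suc n)\<bar> \<le> B" for n by blast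
  have "\<bar>\<delta> n\<bar> \<le> B + \<bar>c\<bar> + \<bar>\<delta> i\<bar>" for n
  proof -
    consider "n < i" | "n = i" | "i < n" by linarith
    then show ?thesis
    proof cases
      case 1
      then show ?thesis using B[of n] by (simp split: if_splits)
    next
      case 2
      have "0 \<le> B" using B[of 0] abs_ge_zero order_trans by blast
      then show ?thesis using 2 by simp
    next
      case 3
      then show ?thesis using B[of "n - 1"] by (auto split: if_splits)
    qed
  qed
  then show "bounded (range \<delta>)" by (auto simp: bounded_iff)
next
  assume "bounded (range \<delta>)"
  then obtain B where B: "\<And>n. \<bar>\<delta> n\<bar> \<le> B" by (auto simp: bounded_iff)
  have "\<bar>if n < i then \<delta> n - c else \<delta> (Suc n)\<bar> \<le> B + \<bar>c\<bar>" for n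
    using B[of n] B[of "Suc n"] by auto
  then show "bounded (range (\<lambda>n. if n < i then \<delta> n - c else \<delta> (Suc n)))"
    unfolding bounded_iff real_norm_def by blast
qed

theorem theorem2:
  fixes \<alpha> :: real and \<gamma> :: "nat \<Rightarrow> complex" and \<delta> \<theta> :: "nat \<Rightarrow> real"
    and \<Gamma> \<Gamma>' :: "complex set"
  assumes "\<alpha> > 0"
    and "inj \<gamma>"
    and "\<And>n. cmod (\<gamma> n) \<le> cmod (\<gamma> (Suc n))"
    and "\<And>n. \<gamma> n = complex_of_real (lambda_seq \<alpha> n * exp (\<delta> n)) * exp (\<i> * complex_of_real (\<theta> n))"
    and "\<Gamma> = range \<gamma>"
    and "\<Gamma>' = (\<lambda>z. complex_of_real (exp (- 1 / (4 * \<alpha>))) * z) ` \<Gamma>"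
  shows "(\<forall>s\<in>\<Gamma>'. complete_interpolating (4/3) (log_weight \<alpha>) (\<Gamma>' - {s})
                  \<longleftrightarrow> separated_bounded_mean \<alpha> \<Gamma> \<delta>) \<and>
         (complete_interpolating 4 (log_weight \<alpha>) \<Gamma>' \<longleftrightarrow> separated_bounded_mean \<alpha> \<Gamma> \<delta>)"
proof -
  define a where "a = complex_of_real (exp (- 1 / (4 * \<alpha>)))"
  have a0: "a \<noteq> 0" by (simp add: a_def)
  define \<sigma> where "\<sigma> n = a * \<gamma> n" for n
  have ng: "cmod (\<gamma> n) = exp ((1 + real n) / (2 * \<alpha>) + \<delta> n)" for n
    unfolding assms(4)[of n] lambda_seq_def by (simp add: norm_mult exp_add)
  have nz_g: "\<gamma> n \<noteq> 0" for n using ng[of n] by (metis exp_not_eq_zero norm_zero)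
  have ns: "cmod (\<sigma> n) = exp ((real n + 1 / 2) / (2 * \<alpha>) + \<delta> n)" for n
  proof -
    have "cmod (\<sigma> n) = exp (- 1 / (4 * \<alpha>) + ((1 + real n) / (2 * \<alpha>) + \<delta> n))"
        unfolding \<sigma>_def norm_mult ng a_def by (simp only: exp_add norm_of_real abs_exp_cancel)
    also have "- 1 / (4 * \<alpha>) + ((1 + real n) / (2 * \<alpha>) + \<delta> n) = (real n + 1 / 2) / (2 * \<alpha>) + \<delta> n"
      using assms(1) by (simp add: field_simps)
    finally show ?thesis .
  qed
  have inj_s: "inj \<sigma>" using assms(2) a0 by (simp add: inj_def \<sigma>_def)
  have mono_s: "cmod (\<sigma> n) \<le> cmod (\<sigma> (Suc n))" for n
    using assms(3)[of n] by (simp add: \<sigma>_def norm_mult mult_left_mono)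
  have nz_s: "\<sigma> n \<noteq> 0" for n using nz_g a0 by (simp add: \<sigma>_def)
  have G': "\<Gamma>' = range \<sigma>" unfolding assms(5,6) by (auto simp: \<sigma>_def a_def)
  have le_lift: "cmod (\<sigma> m) \<le> cmod (\<sigma> n)" if "m \<le> n" for m n
    using mono_s that by (rule lift_Suc_mono_le)
  interpret g: fock_seq \<alpha> 4 \<gamma>
    using assms(1-3) nz_g by unfold_locales auto
  interpret s: fock_seq \<alpha> 4 \<sigma>
    using assms(1) inj_s mono_s nz_s by unfold_locales auto
  have beta: "1 / (4 * \<alpha>) > 0" using assms(1) by simp
  have sbm: "separated_bounded_mean \<alpha> \<Gamma> \<delta> \<longleftrightarrow>
    rel_separated \<sigma> \<and> bounded (range \<delta>) \<and> small_drift (1 / (4 * \<alpha>)) \<delta>"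
  proof -
    have "d_rho_separated \<alpha> \<Gamma> \<longleftrightarrow> rel_separated \<gamma>" unfolding assms(5) by (rule g.d_rho_separated_iff)
    also have "\<dots> \<longleftrightarrow> rel_separated \<sigma>" unfolding \<sigma>_def[abs_def] by (rule rel_separated_scale[OF a0, symmetric])
    finally show ?thesis unfolding separated_bounded_mean_def
      using means_iff_small_drift[OF _ beta, of \<delta>, unfolded minus_divide_left] by blast
  qed
  \<comment> \<open>For p = 4 the nodes are (n + 1/2) / (2 \<alpha>), exactly the logarithmic moduli
    left after scaling by e^{-1/(4 \<alpha>)}.\<close>
  have "s.dev = \<delta>"
  proof
    fix n
    show "s.dev n = \<delta> n"
      using assms(1) by (simp add: s.dev_def s.tau_def s.node_def s.h_def ns field_simps)
  qed
  then have four: "complete_interpolating 4 (log_weight \<alpha>) \<Gamma>' \<longleftrightarrow> separated_bounded_mean \<alpha> \<Gamma> \<delta>"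
    using s.complete_interpolating_iff unfolding sbm G' by (simp add: s.h_def)
  have three: "complete_interpolating (4/3) (log_weight \<alpha>) (\<Gamma>' - {s}) \<longleftrightarrow> separated_bounded_mean \<alpha> \<Gamma> \<delta>"
    if s: "s \<in> \<Gamma>'" for s
  proof -
    obtain i where i: "s = \<sigma> i" using s unfolding G' by auto
    let ?\<sigma>' = "\<lambda>n. \<sigma> (skip i n)"
    \<comment> \<open>For p = 4/3 the nodes are (n + 3/2) / (2 \<alpha>), one gap beyond those for p
      = 4; removing a point moves every later one into place.\<close>
    let ?\<delta>' = "\<lambda>n. if n < i then \<delta> n - 1 / (2 * \<alpha>) else \<delta> (Suc n)"
    interpret r: fock_seq \<alpha> "4/3" ?\<sigma>'
    proof unfold_locales
      show "inj ?\<sigma>'" using inj_s inj_skip[of i] by (simp add: inj_def)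
      show "cmod (\<sigma> (skip i n)) \<le> cmod (\<sigma> (skip i (Suc n)))" for n
        by (rule le_lift) (simp add: skip_def)
    qed (use assms(1) nz_s in auto)
    have range: "range ?\<sigma>' = \<Gamma>' - {s}"
      unfolding range_skip G' i using inj_s by (auto simp: inj_eq)
    have "r.dev = ?\<delta>'"
    proof
      fix n
      show "r.dev n = ?\<delta>' n"
        unfolding r.dev_def r.tau_def r.node_def r.h_def ns ln_exp
        using assms(1) by (cases "n < i") (simp_all add: skip_def field_simps)
    qed
    then have ci: "complete_interpolating (4/3) (log_weight \<alpha>) (\<Gamma>' - {s}) \<longleftrightarrow>
      rel_separated ?\<sigma>' \<and> bounded (range ?\<delta>') \<and> small_drift (1 / (4 * \<alpha>)) ?\<delta>'"
      using r.complete_interpolating_iff unfolding range by (simp add: r.h_def)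
    \<comment> \<open>Unbounded \<delta> falsifies both sides. Bounded \<delta> makes the moduli
      tend to infinity, as needed to restore the removed point in the separation condition.\<close>
    show ?thesis
    proof (cases "bounded (range \<delta>)")
      case False
      then show ?thesis unfolding ci sbm bounded_range_skip_iff by simp
    next
      case True
      then obtain B where B: "\<And>n. \<bar>\<delta> n\<bar> \<le> B" by (auto simp: bounded_iff)
      have "\<exists>N. \<forall>n\<ge>N. R \<le> cmod (\<sigma> n)" for R
      proof -
        obtain N :: nat where "real N > (\<bar>R\<bar> + B) * (2 * \<alpha>)" using reals_Archimedean2 by blast
        then have N: "\<bar>R\<bar> + B < real N / (2 * \<alpha>)" using assms(1) by (simp add: pos_less_divide_eq)
        have "R \<le> cmod (\<sigma> n)" if "n \<ge> N" for n
        proof -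
          have "real N / (2 * \<alpha>) \<le> (real n + 1 / 2) / (2 * \<alpha>)" using that assms(1) by (intro divide_right_mono) auto
          then have "R \<le> (real n + 1 / 2) / (2 * \<alpha>) + \<delta> n" using N B[of n] by linarith
          also have "\<dots> \<le> cmod (\<sigma> n)" unfolding ns
            using exp_ge_add_one_self[of "(real n + 1 / 2) / (2 * \<alpha>) + \<delta> n"] by linarith
          finally show ?thesis .
        qed
        then show ?thesis by blast
      qed
      then have "rel_separated ?\<sigma>' \<longleftrightarrow> rel_separated \<sigma>"
        by (intro rel_separated_skip_iff inj_s nz_s)
      moreover have "small_drift (1 / (4 * \<alpha>)) ?\<delta>' \<longleftrightarrow> small_drift (1 / (4 * \<alpha>)) \<delta>"
        using B by (rule small_drift_skip_iff)
      ultimately show ?thesis unfolding ci sbm bounded_range_skip_iff by simp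
    qed
  qed
  show ?thesis by (intro conjI ballI three four)
qed

end
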